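(* Let $t\in(0,1)$, $r=\sqrt{1-t^2}$, let $\beta$ be an irrational number which is a Liouville number, let $\alpha\in\mathbb R$, let $\{\gamma_k\}_{k\in\mathbb Z}$ be an arbitrary real sequence, and for $\theta\in[0,2\pi)$ let $\theta_k=2\pi\beta k+\theta$, $k\in\mathbb Z$. Let $U=M(\{\theta_k\},\{\alpha\},\{\gamma_k\})$ on $\ell^2(\mathbb Z)$ (with all $\alpha_k=\alpha$). Then for almost every $\theta\in[0,2\pi)$, $U$ is purely singular continuous.
   Context: $\beta$ is called a Liouville number if for every $k\in\mathbb N$, $k\ge1$, there exist positive integers $p_k,q_k$ with $|\beta-p_k/q_k|\le k^{-q_k}$. Let $(\varphi_k)_{k\in\mathbb Z}$ be the canonical orthonormal basis of $\ell^2(\mathbb Z)$. For sequences of real phases $\{\theta_k\},\{\alpha_k\},\{\gamma_k\}$, $k\in\mathbb Z$, and constants $r,t$ with $r^2+t^2=1$, put $$S_k=e^{-i\theta_k}\begin{pmatrix} r e^{-i\alpha_k} & i t e^{i\gamma_k}\\ i t e^{-i\gamma_k} & r e^{i\alpha_k}\end{pmatrix}.$$ $U_e$ is the unitary operator acting on each $\mathrm{span}\{\varphi_{2k},\varphi_{2k+1}\}$, $k\in\mathbb Z$, by the matrix $S_{2k}$ in the ordered basis $(\varphi_{2k},\varphi_{2k+1})$; $U_o$ is the unitary operator acting on each $\mathrm{span}\{\varphi_{2k+1},\varphi_{2k+2}\}$ by $S_{2k+1}$ in the ordered basis $(\varphi_{2k+1},\varphi_{2k+2})$. Set $M(\{\theta_k\},\{\alpha_k\},\{\gamma_k\}):=U_oU_e$.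 *)

theory Defs
  imports "HOL-Analysis.Analysis"
begin

definition liouville_number :: "real \<Rightarrow> bool" where
  "liouville_number \<beta> \<longleftrightarrow>
     (\<forall>k::nat. k \<ge> 1 \<longrightarrow>
        (\<exists>p q :: nat. p > 0 \<and> q > 0 \<and> \<bar>\<beta> - real p / real q\<bar> \<le> 1 / real k ^ q))"

(* The Hilbert space of square-summable sequences is rendered as a carrier set;
   psi j is the coefficient of psi along the canonical basis vector phi_j. *)

definition l2 :: "(int \<Rightarrow> complex) set" where
  "l2 = {\<psi>. (\<lambda>j. (cmod (\<psi> j))\<^sup>2) summable_on UNIV}"

definition l2_inner :: "(int \<Rightarrow> complex) \<Rightarrow> (int \<Rightarrow> complex) \<Rightarrow> complex" where
  "l2_inner \<phi> \<psi> = (\<Sum>\<^sub>\<infinity>j\<in>UNIV. cnj (\<phi> j) * \<psi> j)"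

definition scatter ::
  "real \<Rightarrow> real \<Rightarrow> (int \<Rightarrow> real) \<Rightarrow> (int \<Rightarrow> real) \<Rightarrow> (int \<Rightarrow> real) \<Rightarrow> int \<Rightarrow> complex^2^2" where
  "scatter r t \<theta> \<alpha> \<gamma> k =
     (\<chi> a b. cis (- \<theta> k) *
        (vector [vector [of_real r * cis (- \<alpha> k), \<i> * of_real t * cis (\<gamma> k)],
                 vector [\<i> * of_real t * cis (- \<gamma> k), of_real r * cis (\<alpha> k)]]
         :: complex^2^2) $ a $ b)"

(* U_even acts by S (2k) on the coefficients at (2k, 2k+1), and U_odd by S (2k+1)
   on those at (2k+1, 2k+2), as matrix times column vector. Coordinate j is the first
   entry of its pair if its parity is that of the operator, and otherwise the second
   entry of the pair (j-1, j), whose matrix is S (j-1). *)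

definition U_even :: "(int \<Rightarrow> complex^2^2) \<Rightarrow> (int \<Rightarrow> complex) \<Rightarrow> int \<Rightarrow> complex" where
  "U_even S \<psi> j =
     (if even j then S j $ 1 $ 1 * \<psi> j + S j $ 1 $ 2 * \<psi> (j + 1)
      else S (j - 1) $ 2 $ 1 * \<psi> (j - 1) + S (j - 1) $ 2 $ 2 * \<psi> j)"

definition U_odd :: "(int \<Rightarrow> complex^2^2) \<Rightarrow> (int \<Rightarrow> complex) \<Rightarrow> int \<Rightarrow> complex" where
  "U_odd S \<psi> j =
     (if odd j then S j $ 1 $ 1 * \<psi> j + S j $ 1 $ 2 * \<psi> (j + 1)
      else S (j - 1) $ 2 $ 1 * \<psi> (j - 1) + S (j - 1) $ 2 $ 2 * \<psi> j)"

definition M_op ::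
  "real \<Rightarrow> real \<Rightarrow> (int \<Rightarrow> real) \<Rightarrow> (int \<Rightarrow> real) \<Rightarrow> (int \<Rightarrow> real) \<Rightarrow>
     (int \<Rightarrow> complex) \<Rightarrow> int \<Rightarrow> complex" where
  "M_op r t \<theta> \<alpha> \<gamma> = U_odd (scatter r t \<theta> \<alpha> \<gamma>) \<circ> U_even (scatter r t \<theta> \<alpha> \<gamma>)"

(* For U unitary on l2: mu is the spectral measure of the vector psi, i.e. the measure
   <psi, E(.) psi> where U is the integral of exp(ix) dE(x) over the circle [0, 2 pi).
   It is the unique finite Borel measure there whose Fourier coefficients are
   <psi, U^n psi> for all integers n; those of index -n are the complex conjugates of
   those of index n on both sides, so natural numbers n suffice. *)

definition spectral_measure ::
  "((int \<Rightarrow> complex) \<Rightarrow> (int \<Rightarrow> complex)) \<Rightarrow> (int \<Rightarrow> complex) \<Rightarrow> real measure \<Rightarrow> bool" where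
  "spectral_measure U \<psi> \<mu> \<longleftrightarrow>
     sets \<mu> = sets borel \<and> finite_measure \<mu> \<and> emeasure \<mu> (- {0..<2 * pi}) = 0 \<and>
     (\<forall>n::nat. l2_inner \<psi> ((U ^^ n) \<psi>) = (LINT x|\<mu>. cis (real n * x)))"

(* No atoms, and concentrated on a Lebesgue null set; the zero measure is included. *)

definition singular_continuous_measure :: "real measure \<Rightarrow> bool" where
  "singular_continuous_measure \<mu> \<longleftrightarrow>
     (\<forall>x. emeasure \<mu> {x} = 0) \<and> (\<exists>N \<in> null_sets lborel. emeasure \<mu> (- N) = 0)"

definition sc_subspace :: "((int \<Rightarrow> complex) \<Rightarrow> (int \<Rightarrow> complex)) \<Rightarrow> (int \<Rightarrow> complex) set" where
  "sc_subspace U =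
     {\<psi> \<in> l2. \<exists>\<mu>. spectral_measure U \<psi> \<mu> \<and> singular_continuous_measure \<mu>}"

definition purely_singular_continuous :: "((int \<Rightarrow> complex) \<Rightarrow> (int \<Rightarrow> complex)) \<Rightarrow> bool" where
  "purely_singular_continuous U \<longleftrightarrow> sc_subspace U = l2"

end

theory Submission
  imports Defs "HOL-Probability.Probability" "HOL-Computational_Algebra.Polynomial"
begin

text \<open>
  The operator is the square of a homogeneous quantum walk \<open>W\<close>, restricted to an invariant subspace.
  If the frequency is a rational \<open>p/q\<close> in lowest terms, the transfer matrix over one period shows that
  \<open>c0 + c1 W\<^sup>q + c2 W\<^sup>2\<^sup>q\<close> equals \<open>(\<i> t)\<^sup>q W\<^sup>q\<close> times a forward plus a backward shift by \<open>q\<close> (with phases),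
  where \<open>c0\<close> and \<open>c2\<close> have modulus 1. Its norm is therefore at most \<open>2 t\<^sup>q\<close>. For a Liouville frequency
  the same identity holds along the approximants, on each fixed basis vector and up to errors that are small
  even compared with \<open>t\<^sup>q\<close>.
  Hence trigonometric polynomials with constant coefficient of modulus 1 and otherwise only the high
  frequencies \<open>q\<close> and \<open>2 q\<close> tend to zero in \<open>L\<^sup>2\<close> of every spectral measure, which forces
  singularity. The same identity, tested on an eigenvector, yields Gordon's three-term inequality
  and excludes atoms. This works for every \<open>\<theta>\<close>, as \<open>\<theta>\<close> only enters as a global phase of the operator.
\<close>

section \<open>Square-summable functions\<close>

text \<open>In the square root \<open>W\<close> all bonds look alike: one 2x2 transfer matrix per
  site, whose phases rotate by a fixed factor \<omega> from site to site. Replacing x by \<omega> x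
  then amounts to moving along the chain, which is why, for a primitive q-th root \<omega>, the
  trace over a period keeps only the exponents 0, q and 2 q. The entries of the transfer matrices
  are polynomials in \<open>W\<close>, not functions of a numerical spectral parameter. One and the
  same identity between vectors can therefore be integrated against spectral measures and paired
  with eigenvectors. The quantitative obstacle is Gordon's inequality, which divides the identity by
  \<open>t ^ q\<close>. Replacing \<beta> by p/q during 2 q steps costs about q^2 times |\<beta> -
  p/q|, and this has to be small against \<open>t ^ q\<close>. A bound k^(-q) with k growing beyond
  all limits achieves it for every fixed t; for singularity it suffices that the error itself
  vanishes. \<open>sc_subspace\<close> asks for an actual measure for each vector, so the spectral
  measures are constructed from their Fourier coefficients by Herglotz' theorem.\<close>

definition hl2 :: "('i \<Rightarrow> complex) set" where
  "hl2 = {f. (\<lambda>i. (cmod (f i))\<^sup>2) summable_on UNIV}"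

definition nrm :: "('i \<Rightarrow> complex) \<Rightarrow> real" where
  "nrm f = sqrt (\<Sum>\<^sub>\<infinity>i. (cmod (f i))\<^sup>2)"

definition ip :: "('i \<Rightarrow> complex) \<Rightarrow> ('i \<Rightarrow> complex) \<Rightarrow> complex" where
  "ip f g = (\<Sum>\<^sub>\<infinity>i. cnj (f i) * g i)"

lemma nrm_nonneg [simp]: "0 \<le> nrm f"
  by (simp add: nrm_def infsum_nonneg)

lemma nrm_sq: "(nrm f)\<^sup>2 = (\<Sum>\<^sub>\<infinity>i. (cmod (f i))\<^sup>2)"
  by (simp add: nrm_def infsum_nonneg)

lemma L2_set_le_nrm:
  assumes "f \<in> hl2" "finite F"
  shows "L2_set (\<lambda>i. cmod (f i)) F \<le> nrm f"
proof -
  have "(\<Sum>i\<in>F. (cmod (f i))\<^sup>2) \<le> (\<Sum>\<^sub>\<infinity>i. (cmod (f i))\<^sup>2)"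
    using assms by (intro finite_sum_le_infsum) (auto simp: hl2_def)
  then show ?thesis by (simp add: L2_set_def nrm_def)
qed

text \<open>A bound on all finite \<open>L2_set\<close>s, squared, bounds the partial sums of a
  nonnegative family, so membership and norm bound arrive together. Minkowski, comparison and limit
  arguments can thus be made on finite sets.\<close>

lemma hl2I:
  assumes "\<And>F. finite F \<Longrightarrow> L2_set (\<lambda>i. cmod (f i)) F \<le> B"
  shows "f \<in> hl2" "nrm f \<le> B"
proof -
  have B: "0 \<le> B" using assms[of "{}"] by simp
  have s: "(\<Sum>i\<in>F. (cmod (f i))\<^sup>2) \<le> B\<^sup>2" if "finite F" for F
  proof -
    have "sqrt (\<Sum>i\<in>F. (cmod (f i))\<^sup>2) \<le> B" using assms[OF that] by (simp add: L2_set_def)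
    then show ?thesis using sqrt_le_D by blast
  qed
  show f: "f \<in> hl2" unfolding hl2_def mem_Collect_eq
    by (rule nonneg_bdd_above_summable_on) (auto intro!: bdd_aboveI2[where M="B\<^sup>2"] s)
  have "(\<Sum>\<^sub>\<infinity>i. (cmod (f i))\<^sup>2) \<le> B\<^sup>2"
    using f s by (intro infsum_le_finite_sums) (auto simp: hl2_def)
  then show "nrm f \<le> B" using B by (simp add: nrm_def real_le_lsqrt)
qed

lemma cmod_le_nrm: "f \<in> hl2 \<Longrightarrow> cmod (f i) \<le> nrm f"
  using L2_set_le_nrm[of f "{i}"] by simp

lemma nrm_triangle:
  assumes "f \<in> hl2" "g \<in> hl2"
  shows hl2_add: "(\<lambda>i. f i + g i) \<in> hl2" and nrm_add: "nrm (\<lambda>i. f i + g i) \<le> nrm f + nrm g"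
proof -
  have "L2_set (\<lambda>i. cmod (f i + g i)) F \<le> nrm f + nrm g" if "finite F" for F
  proof -
    have "L2_set (\<lambda>i. cmod (f i + g i)) F \<le> L2_set (\<lambda>i. cmod (f i) + cmod (g i)) F"
      by (intro L2_set_mono) (auto simp: norm_triangle_ineq)
    also have "\<dots> \<le> L2_set (\<lambda>i. cmod (f i)) F + L2_set (\<lambda>i. cmod (g i)) F"
      by (rule L2_set_triangle_ineq)
    finally show ?thesis using L2_set_le_nrm[OF assms(1) that] L2_set_le_nrm[OF assms(2) that] by simp
  qed
  from hl2I[OF this] show "(\<lambda>i. f i + g i) \<in> hl2" "nrm (\<lambda>i. f i + g i) \<le> nrm f + nrm g"
    by auto
qed

lemma hl2_scale:
  assumes "f \<in> hl2" shows "(\<lambda>i. c * f i) \<in> hl2"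
  using assms by (auto simp: hl2_def norm_mult power_mult_distrib intro: summable_on_cmult_right)

lemma nrm_scale: "nrm (\<lambda>i. c * f i) = cmod c * nrm f"
  by (simp add: nrm_def norm_mult power_mult_distrib infsum_cmult_right' real_sqrt_mult)

lemma hl2_zero [simp]: "(\<lambda>i. 0) \<in> hl2" and nrm_zero [simp]: "nrm (\<lambda>i. 0) = 0"
  by (auto simp: hl2_def nrm_def)

lemma hl2_diff: "f \<in> hl2 \<Longrightarrow> g \<in> hl2 \<Longrightarrow> (\<lambda>i. f i - g i) \<in> hl2"
  and nrm_diff: "f \<in> hl2 \<Longrightarrow> g \<in> hl2 \<Longrightarrow> nrm (\<lambda>i. f i - g i) \<le> nrm f + nrm g"
  using nrm_triangle[of f "\<lambda>i. (-1) * g i"] hl2_scale[of g "-1"] nrm_scale[of "-1" g] by auto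

lemma nrm_diff_triangle:
  assumes "f \<in> hl2" "g \<in> hl2" "h \<in> hl2"
  shows "nrm (\<lambda>i. f i - h i) \<le> nrm (\<lambda>i. f i - g i) + nrm (\<lambda>i. g i - h i)"
  using nrm_add[OF hl2_diff[OF assms(1,2)] hl2_diff[OF assms(2,3)]] by simp

lemma hl2_sum:
  assumes "finite A" "\<And>n. n \<in> A \<Longrightarrow> f n \<in> hl2"
  shows "(\<lambda>i. \<Sum>n\<in>A. f n i) \<in> hl2"
  using assms by (induction) (auto intro: hl2_add)

lemma nrm_sum:
  assumes "finite A" "\<And>n. n \<in> A \<Longrightarrow> f n \<in> hl2"
  shows "nrm (\<lambda>i. \<Sum>n\<in>A. f n i) \<le> (\<Sum>n\<in>A. nrm (f n))"
  using assms
proof induction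
  case (insert a A)
  then show ?case
    using nrm_add[OF insert.prems[of a] hl2_sum[OF insert.hyps(1)], of f] by fastforce
qed auto

lemma summable_ip:
  assumes "f \<in> hl2" "g \<in> hl2"
  shows "(\<lambda>i. cnj (f i) * g i) summable_on UNIV"
proof -
  have "(\<lambda>i. (cmod (f i))\<^sup>2 + (cmod (g i))\<^sup>2) summable_on UNIV"
    using assms by (intro summable_on_add) (auto simp: hl2_def)
  moreover have "norm (cnj (f i) * g i) \<le> (cmod (f i))\<^sup>2 + (cmod (g i))\<^sup>2" for i
  proof -
    have "2 * (cmod (f i) * cmod (g i)) \<le> (cmod (f i))\<^sup>2 + (cmod (g i))\<^sup>2"
      using sum_squares_bound[of "cmod (f i)" "cmod (g i)"] by simp
    moreover have "0 \<le> cmod (f i) * cmod (g i)" by simp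
    ultimately show ?thesis unfolding norm_mult complex_mod_cnj by linarith
  qed
  ultimately have "(\<lambda>i. norm (cnj (f i) * g i)) summable_on UNIV"
    by (rule summable_on_comparison_test) simp_all
  then show ?thesis by (rule abs_summable_summable)
qed

lemma ip_add_right: "f \<in> hl2 \<Longrightarrow> g \<in> hl2 \<Longrightarrow> h \<in> hl2 \<Longrightarrow> ip f (\<lambda>i. g i + h i) = ip f g + ip f h"
  unfolding ip_def distrib_left by (intro infsum_add summable_ip)

lemma ip_scale_right: "ip f (\<lambda>i. c * g i) = c * ip f g"
  unfolding ip_def by (simp add: infsum_cmult_right' mult.left_commute)

lemma ip_cnj: "cnj (ip f g) = ip g f"
  unfolding ip_def by (simp flip: infsum_cnj add: mult.commute)

lemma ip_zero [simp]: "ip f (\<lambda>i. 0) = 0"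
  by (simp add: ip_def)

lemma ip_sum_right:
  assumes "finite A" "f \<in> hl2" "\<And>n. n \<in> A \<Longrightarrow> g n \<in> hl2"
  shows "ip f (\<lambda>i. \<Sum>n\<in>A. g n i) = (\<Sum>n\<in>A. ip f (g n))"
  using assms
proof induction
  case (insert a A)
  then show ?case using ip_add_right[of f "g a" "\<lambda>i. \<Sum>n\<in>A. g n i"] hl2_sum[of A g] by auto
qed auto

lemma of_real_cmod_sq: "complex_of_real ((cmod z)\<^sup>2) = cnj z * z"
  by (metis complex_norm_square mult.commute of_real_power)

lemma ip_self:
  assumes "f \<in> hl2"
  shows "ip f f = of_real ((nrm f)\<^sup>2)"
proof -
  have "((\<lambda>i. (cmod (f i))\<^sup>2) has_sum (nrm f)\<^sup>2) UNIV"
    using assms unfolding nrm_sq by (simp add: hl2_def)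
  then have "((\<lambda>i. of_real ((cmod (f i))\<^sup>2) :: complex) has_sum of_real ((nrm f)\<^sup>2)) UNIV"
    by (rule has_sum_of_real)
  then show ?thesis unfolding ip_def of_real_cmod_sq by (rule infsumI)
qed

lemma ip_bound:
  assumes "f \<in> hl2" "g \<in> hl2"
  shows "cmod (ip f g) \<le> nrm f * nrm g"
proof -
  have "norm (\<Sum>i\<in>F. cnj (f i) * g i) \<le> nrm f * nrm g" if "finite F" for F
  proof -
    have "norm (\<Sum>i\<in>F. cnj (f i) * g i) \<le> (\<Sum>i\<in>F. \<bar>cmod (f i)\<bar> * \<bar>cmod (g i)\<bar>)"
      by (rule sum_norm_le) (simp add: norm_mult)
    also have "\<dots> \<le> L2_set (\<lambda>i. cmod (f i)) F * L2_set (\<lambda>i. cmod (g i)) F"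
      by (rule L2_set_mult_ineq)
    also have "\<dots> \<le> nrm f * nrm g"
      using L2_set_le_nrm[OF assms(1) that] L2_set_le_nrm[OF assms(2) that]
      by (intro mult_mono) (auto simp: L2_set_nonneg)
    finally show ?thesis .
  qed
  then have ev: "eventually (\<lambda>F. norm (\<Sum>i\<in>F. cnj (f i) * g i) \<le> nrm f * nrm g) (finite_subsets_at_top UNIV)"
    by (intro eventually_finite_subsets_at_top_weakI) auto
  have "((\<lambda>F. \<Sum>i\<in>F. cnj (f i) * g i) \<longlongrightarrow> ip f g) (finite_subsets_at_top UNIV)"
    using summable_ip[OF assms] unfolding ip_def by (metis has_sum_def has_sum_infsum)
  from tendsto_norm[OF this] show ?thesis
    by (rule tendsto_upperbound) (use ev in auto)
qed

definition basis :: "'i \<Rightarrow> 'i \<Rightarrow> complex" where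
  "basis k = (\<lambda>i. if i = k then 1 else 0)"

lemma basis_L2: "basis k \<in> hl2" "nrm (basis k) = 1"
proof -
  have "((\<lambda>i. (cmod (basis k i))\<^sup>2) has_sum 1) UNIV"
    using has_sum_finite_neutralI[of "{k}" UNIV "\<lambda>i. (cmod (basis k i))\<^sup>2" 1]
    by (auto simp: basis_def)
  then show "basis k \<in> hl2" "nrm (basis k) = 1"
    by (auto simp: hl2_def nrm_def infsumI has_sum_imp_summable)
qed

lemma ip_basis: "ip (basis k) f = f k"
proof -
  have "((\<lambda>i. cnj (basis k i) * f i) has_sum f k) UNIV"
    using has_sum_finite_neutralI[of "{k}" UNIV "\<lambda>i. cnj (basis k i) * f i" "f k"]
    by (auto simp: basis_def)
  then show ?thesis by (simp add: ip_def infsumI)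
qed

text \<open>Choose \<open>F\<close> so that its partial sum is within e^2 of the full sum of
  squares; what is left off \<open>F\<close> has squared norm at most that difference. It reduces
  limits in \<open>hl2\<close> to finitely many coordinates.\<close>

lemma hl2_small_tail:
  assumes "f \<in> hl2" "0 < e"
  obtains F where "finite F" "(\<lambda>i. if i \<in> F then 0 else f i) \<in> hl2"
    "nrm (\<lambda>i. if i \<in> F then 0 else f i) < e"
proof -
  have s: "(\<lambda>i. (cmod (f i))\<^sup>2) summable_on UNIV" using assms by (simp add: hl2_def)
  have "0 < e\<^sup>2" using assms by simp
  moreover have "((\<lambda>F. \<Sum>i\<in>F. (cmod (f i))\<^sup>2) \<longlongrightarrow> (\<Sum>\<^sub>\<infinity>i. (cmod (f i))\<^sup>2)) (finite_subsets_at_top UNIV)"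
    using has_sum_infsum[OF s] by (simp add: has_sum_def)
  ultimately have "\<forall>\<^sub>F F in finite_subsets_at_top UNIV.
      dist (\<Sum>i\<in>F. (cmod (f i))\<^sup>2) (\<Sum>\<^sub>\<infinity>i. (cmod (f i))\<^sup>2) < e\<^sup>2"
    by (simp only: tendsto_iff)
  then obtain F where F: "finite F" "\<bar>(\<Sum>i\<in>F. (cmod (f i))\<^sup>2) - (\<Sum>\<^sub>\<infinity>i. (cmod (f i))\<^sup>2)\<bar> < e\<^sup>2"
    unfolding eventually_finite_subsets_at_top dist_real_def by auto
  let ?g = "\<lambda>i. if i \<in> F then 0 else f i"
  have "(\<Sum>i\<in>G. (cmod (?g i))\<^sup>2) \<le> (nrm f)\<^sup>2 - (\<Sum>i\<in>F. (cmod (f i))\<^sup>2)" if "finite G" for G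
  proof -
    have "(\<Sum>i\<in>G. (cmod (?g i))\<^sup>2) + (\<Sum>i\<in>F. (cmod (f i))\<^sup>2)
        = (\<Sum>i\<in>G-F. (cmod (f i))\<^sup>2) + (\<Sum>i\<in>F. (cmod (f i))\<^sup>2)"
      using that by (intro arg_cong2[where f="(+)"] sum.mono_neutral_cong_right refl) auto
    also have "\<dots> = (\<Sum>i\<in>(G-F) \<union> F. (cmod (f i))\<^sup>2)"
      using that F by (subst sum.union_disjoint) auto
    also have "\<dots> \<le> (nrm f)\<^sup>2"
      using that F s unfolding nrm_sq by (intro finite_sum_le_infsum) auto
    finally show ?thesis by simp
  qed
  then have "L2_set (\<lambda>i. cmod (?g i)) G \<le> sqrt ((nrm f)\<^sup>2 - (\<Sum>i\<in>F. (cmod (f i))\<^sup>2))" if "finite G" for G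
    using that by (simp add: L2_set_def)
  from hl2I[OF this] have "?g \<in> hl2" "nrm ?g \<le> sqrt ((nrm f)\<^sup>2 - (\<Sum>i\<in>F. (cmod (f i))\<^sup>2))" by auto
  moreover have "sqrt ((nrm f)\<^sup>2 - (\<Sum>i\<in>F. (cmod (f i))\<^sup>2)) < e"
    using F(2) assms(2) unfolding nrm_sq by (intro real_less_lsqrt) auto
  ultimately show ?thesis using that[OF F(1)] by auto
qed

section \<open>Linear maps and isometries on coefficient functions\<close>

definition clinear_op :: "(('i \<Rightarrow> complex) \<Rightarrow> ('i \<Rightarrow> complex)) \<Rightarrow> bool" where
  "clinear_op V \<longleftrightarrow> (\<forall>f g. V (\<lambda>i. f i + g i) = (\<lambda>i. V f i + V g i)) \<and>
     (\<forall>c f. V (\<lambda>i. c * f i) = (\<lambda>i. c * V f i))"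

text \<open>Linearity is demanded on all functions because the walk is a local rule that makes sense
  without summability. Isometry is stated through inner products since it is used in the form: the
  inner product of the images under \<open>V ^^ k\<close> and \<open>V ^^ l\<close> is governed by l
  - k.\<close>

definition l2_isometry :: "(('i \<Rightarrow> complex) \<Rightarrow> ('i \<Rightarrow> complex)) \<Rightarrow> bool" where
  "l2_isometry V \<longleftrightarrow> clinear_op V \<and> (\<forall>f\<in>hl2. V f \<in> hl2) \<and>
     (\<forall>f\<in>hl2. \<forall>g\<in>hl2. ip (V f) (V g) = ip f g)"

lemma clinear_opD:
  assumes "clinear_op V"
  shows "V (\<lambda>i. f i + g i) = (\<lambda>i. V f i + V g i)" "V (\<lambda>i. c * f i) = (\<lambda>i. c * V f i)"
    "V (\<lambda>i. f i - g i) = (\<lambda>i. V f i - V g i)" "V (\<lambda>i. 0) = (\<lambda>i. 0)"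
proof -
  show a: "V (\<lambda>i. f i + g i) = (\<lambda>i. V f i + V g i)" "V (\<lambda>i. c * f i) = (\<lambda>i. c * V f i)" for f g c
    using assms by (auto simp: clinear_op_def)
  show "V (\<lambda>i. f i - g i) = (\<lambda>i. V f i - V g i)"
    using a(1)[of f "\<lambda>i. (-1) * g i"] a(2)[of "-1" g] by simp
  show "V (\<lambda>i. 0) = (\<lambda>i. 0)" using a(2)[of 0 "\<lambda>i. 0"] by simp
qed

lemma clinear_op_sum:
  assumes "clinear_op V" "finite A"
  shows "V (\<lambda>i. \<Sum>n\<in>A. f n i) = (\<lambda>i. \<Sum>n\<in>A. V (f n) i)"
  using assms(2) by induction (simp_all add: clinear_opD[OF assms(1)])

lemma clinear_op_funpow: "clinear_op V \<Longrightarrow> clinear_op (V ^^ n)"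
  by (induction n) (auto simp: clinear_op_def)

lemma l2_isometry_funpow: "l2_isometry V \<Longrightarrow> l2_isometry (V ^^ n)"
  by (induction n) (auto simp: l2_isometry_def clinear_op_def)

lemma l2_isometryD:
  assumes "l2_isometry V" "f \<in> hl2"
  shows "V f \<in> hl2" "nrm (V f) = nrm f" "(V ^^ n) f \<in> hl2" "nrm ((V ^^ n) f) = nrm f"
proof -
  have *: "X f \<in> hl2" "nrm (X f) = nrm f" if "l2_isometry X" for X
  proof -
    show *: "X f \<in> hl2" using that assms by (auto simp: l2_isometry_def)
    have "ip (X f) (X f) = ip f f" using that assms by (auto simp: l2_isometry_def)
    then have "(nrm (X f))\<^sup>2 = (nrm f)\<^sup>2" 
      using * assms by (simp add: ip_self flip: of_real_power)
    then show "nrm (X f) = nrm f" by simp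
  qed
  show "V f \<in> hl2" "nrm (V f) = nrm f" "(V ^^ n) f \<in> hl2" "nrm ((V ^^ n) f) = nrm f"
    using *[OF assms(1)] *[OF l2_isometry_funpow[OF assms(1)]] by auto
qed

lemma ip_funpow:
  assumes "l2_isometry V" "f \<in> hl2" "g \<in> hl2"
  shows "ip ((V ^^ n) f) ((V ^^ n) g) = ip f g"
  using l2_isometry_funpow[OF assms(1), of n] assms by (auto simp: l2_isometry_def)

section \<open>Spectral measures of isometries\<close>

lemma borel_measurable_cis_mult [measurable]: "(\<lambda>x::real. cis (y * x)) \<in> borel_measurable borel"
  by (intro borel_measurable_continuous_onI continuous_intros)

section \<open>Fourier coefficients on the circle and Herglotz' theorem\<close>

lemma integral_cis_period:
  fixes m :: int
  shows "integrable lborel (\<lambda>x. indicator {0..2*pi} x *\<^sub>R cis (of_int m * x))"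
    and "(LINT x|lborel. indicator {0..2*pi} x *\<^sub>R cis (of_int m * x)) = (if m = 0 then of_real (2*pi) else 0)"
proof -
  have cont: "continuous_on {0..2*pi} (\<lambda>x. cis (of_int m * x))"
    by (intro continuous_intros)
  show "integrable lborel (\<lambda>x. indicator {0..2*pi} x *\<^sub>R cis (of_int m * x))"
    using borel_integrable_atLeastAtMost'[OF cont] by (simp add: set_integrable_def)
  show "(LINT x|lborel. indicator {0..2*pi} x *\<^sub>R cis (of_int m * x)) = (if m = 0 then of_real (2*pi) else 0)"
  proof (cases "m = 0")
    case True
    then show ?thesis by (simp add: scaleR_conv_of_real)
  next
    case False
    define F where "F = (\<lambda>x::real. cis (of_int m * x) / (\<i> * of_int m))"
    have "(LINT x|lborel. indicator {0..2*pi} x *\<^sub>R cis (of_int m * x)) = F (2*pi) - F 0"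
    proof (rule integral_FTC_Icc)
      show "(F has_vector_derivative cis (of_int m * x)) (at x within {0..2*pi})" for x
      proof -
        have "((\<lambda>x. exp (\<i> * of_int m * of_real x) / (\<i> * of_int m)) has_vector_derivative
            exp (\<i> * of_int m * of_real x)) (at x within {0..2*pi})"
          using False by (auto intro!: derivative_eq_intros has_vector_derivative_real_field)
        then show ?thesis by (simp add: F_def cis_conv_exp mult.assoc)
      qed
    qed (use cont in auto)
    moreover have "cis (of_int m * (2*pi)) = 1"
      using cis_multiple_2pi[of "of_int m"] by (simp add: mult.commute mult.left_commute)
    ultimately show ?thesis using False by (simp add: F_def)
  qed
qed

text \<open>N times the Fejer mean of the Fourier series with terms \<open>c m\<close> e^(-i m x).
  The double sum is kept because for normalised autocorrelations \<open>c\<close> it is, up to a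
  positive factor, a squared norm and hence nonnegative.\<close>

definition fejer :: "(int \<Rightarrow> complex) \<Rightarrow> nat \<Rightarrow> real \<Rightarrow> complex" where
  "fejer c N x = (\<Sum>k<N. \<Sum>l<N. cis (of_int (int k - int l) * x) * c (int l - int k))"

lemma fejer_real:
  assumes sym: "\<And>n. c (- n) = cnj (c n)"
  shows "fejer c N x = of_real (Re (fejer c N x))"
proof -
  have "cnj (fejer c N x) = (\<Sum>k<N. \<Sum>l<N. cis (of_int (int l - int k) * x) * c (int k - int l))"
    unfolding fejer_def cnj_sum complex_cnj_mult cis_cnj
    using sym by (intro sum.cong refl) (metis minus_diff_eq mult_minus_left of_int_minus)
  also have "\<dots> = fejer c N x"
    unfolding fejer_def by (rule sum.swap)
  finally show ?thesis
    by (metis Reals_cnj_iff of_real_Re)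
qed

lemma fejer_fourier:
  fixes n :: nat
  shows "integrable lborel (\<lambda>x. indicator {0..2*pi} x *\<^sub>R (fejer c N x * cis (real n * x)))"
    and "(LINT x|lborel. indicator {0..2*pi} x *\<^sub>R (fejer c N x * cis (real n * x)))
      = of_real (2*pi * real (N - n)) * c (int n)"
proof -
  define e where "e m x = indicator {0..2*pi} x *\<^sub>R cis (of_int m * x)" for m :: int and x
  have e: "integrable lborel (e m)" "(LINT x|lborel. e m x) = (if m = 0 then of_real (2*pi) else 0)" for m
    unfolding e_def by (fact integral_cis_period)+
  have eq: "indicator {0..2*pi} x *\<^sub>R (fejer c N x * cis (real n * x))
      = (\<Sum>k<N. \<Sum>l<N. c (int l - int k) * e (int k - int l + int n) x)" for x
    by (auto simp: e_def fejer_def sum_distrib_right sum_distrib_left cis_mult scaleR_conv_of_real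
        algebra_simps intro!: sum.cong split: split_indicator)
  show "integrable lborel (\<lambda>x. indicator {0..2*pi} x *\<^sub>R (fejer c N x * cis (real n * x)))"
    unfolding eq by (intro Bochner_Integration.integrable_sum integrable_mult_right e)
  have "(LINT x|lborel. indicator {0..2*pi} x *\<^sub>R (fejer c N x * cis (real n * x)))
      = (\<Sum>k<N. \<Sum>l<N. c (int l - int k) * (if int k - int l + int n = 0 then of_real (2*pi) else 0))"
    unfolding eq by (simp add: Bochner_Integration.integral_sum Bochner_Integration.integrable_sum e)
  also have "\<dots> = (\<Sum>k<N. \<Sum>l<N. if l = k + n then of_real (2*pi) * c (int n) else 0)"
    by (intro sum.cong refl) auto
  also have "\<dots> = (\<Sum>k<N. if k + n < N then of_real (2*pi) * c (int n) else 0)"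
    by simp
  \<comment> \<open>There are N - n indices k with k + n < N; for n \<ge> N the truncated difference
    is 0, as it should be.\<close>
  also have "\<dots> = (\<Sum>k\<in>{..<N-n}. of_real (2*pi) * c (int n))"
    by (rule sum.mono_neutral_cong_right) auto
  finally show "(LINT x|lborel. indicator {0..2*pi} x *\<^sub>R (fejer c N x * cis (real n * x)))
      = of_real (2*pi * real (N - n)) * c (int n)" by simp
qed

lemma fejer_measurable [measurable]: "fejer c N \<in> borel_measurable borel"
  unfolding fejer_def by (intro borel_measurable_continuous_onI continuous_intros)

text \<open>The normalised Fejer means are densities of probability measures on [0, 2 pi] whose n-th
  coefficient is (1 - n/(N+1)) \<open>c n\<close> for large N. Common compact support gives
  tightness, so a subsequence converges weakly, and the bounded continuous \<open>cis\<close>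
  carries the coefficients to the limit.\<close>

lemma herglotz:
  fixes c :: "int \<Rightarrow> complex"
  assumes sym: "\<And>n. c (- n) = cnj (c n)" and c0: "c 0 = 1"
    and pos: "\<And>N x. 0 \<le> Re (fejer c N x)"
  obtains M :: "real measure" where "real_distribution M" "emeasure M (- {0..<2*pi}) = 0"
    "\<And>n::nat. c (int n) = (LINT x|M. cis (real n * x))"
proof -
  define f where "f N x = indicator {0..2*pi} x * (Re (fejer c (Suc N) x) / (2*pi * real (Suc N)))" for N x
  define \<mu> where "\<mu> N = density lborel (\<lambda>x. ennreal (f N x))" for N
  have f0: "0 \<le> f N x" for N x
    unfolding f_def using pos by (intro mult_nonneg_nonneg divide_nonneg_nonneg) auto
  have [measurable]: "f N \<in> borel_measurable borel" for N
    unfolding f_def by measurable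
  have f_eq: "f N x *\<^sub>R cis (real n * x)
      = of_real (1 / (2*pi * real (Suc N))) * (indicator {0..2*pi} x *\<^sub>R (fejer c (Suc N) x * cis (real n * x)))" for N n x
    using fejer_real[of c "Suc N" x, OF sym]
    by (simp add: f_def scaleR_conv_of_real split: split_indicator)
  have fint: "integrable lborel (\<lambda>x. f N x *\<^sub>R cis (real n * x))" for N n
    unfolding f_eq by (intro integrable_mult_right fejer_fourier)
  have fcoef: "(LINT x|lborel. f N x *\<^sub>R cis (real n * x)) = of_real (real (Suc N - n) / real (Suc N)) * c (int n)" for N n
  proof -
    have "1 / (2 * pi * real (Suc N)) * (2 * pi * real (Suc N - n)) = real (Suc N - n) / real (Suc N)"
      by simp
    then show ?thesis
      unfolding f_eq integral_mult_right_zero fejer_fourier(2) mult.assoc[symmetric] of_real_mult[symmetric]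
      by (simp only:)
  qed
  have mcoef: "(LINT x|\<mu> N. cis (real n * x)) = of_real (real (Suc N - n) / real (Suc N)) * c (int n)" for N n
    unfolding \<mu>_def using f0 by (subst integral_density) (auto simp: fcoef)
  have [simp]: "sets (\<mu> N) = sets borel" "space (\<mu> N) = UNIV" for N by (auto simp: \<mu>_def)
  have ires: "integrable lborel (f N)" for N
    using integrable_Re[OF fint[of N 0]] by simp
  have ival: "(LINT x|lborel. f N x) = 1" for N
    using integral_Re[OF fint[of N 0]] fcoef[of N 0] c0 by simp
  have em: "emeasure (\<mu> N) UNIV = 1" for N
    unfolding \<mu>_def using f0
    by (simp add: emeasure_density nn_integral_eq_integral[OF ires] ival)
  have outside: "emeasure (\<mu> N) A = 0" if "A \<in> sets borel" "A \<inter> {0..2*pi} = {}" for N A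
  proof -
    have "emeasure (\<mu> N) A = (\<integral>\<^sup>+ x. ennreal (f N x) * indicator A x \<partial>lborel)"
      unfolding \<mu>_def using that by (intro emeasure_density) auto
    also have "\<dots> = (\<integral>\<^sup>+ x. 0 \<partial>(lborel::real measure))"
      using that by (intro nn_integral_cong) (auto simp: f_def split: split_indicator)
    finally show ?thesis by simp
  qed
  have rd: "real_distribution (\<mu> N)" for N
    by (intro real_distribution.intro real_distribution_axioms.intro prob_spaceI) (auto simp: em)
  interpret \<mu>: real_distribution "\<mu> N" for N by (rule rd)
  have comp: "measure (\<mu> N) A = 1" if "A \<in> sets borel" "{0..2*pi} \<subseteq> A" for N A
  proof -
    have "measure (\<mu> N) (UNIV - A) = 0"
    proof -
      have "emeasure (\<mu> N) (UNIV - A) = 0" using that by (intro outside) auto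
      then show ?thesis by (simp add: measure_def)
    qed
    then show ?thesis using \<mu>.prob_compl[of A N] that by simp
  qed
  have "tight \<mu>"
    unfolding tight_def
  proof (intro conjI allI impI)
    fix \<epsilon> :: real assume "\<epsilon> > 0"
    \<comment> \<open>The left end -1 keeps the point 0 inside the half-open interval that tightness
      uses.\<close>
    moreover have "measure (\<mu> N) {-1<..2*pi} = 1" for N by (rule comp) auto
    ultimately show "\<exists>a b. a < b \<and> (\<forall>n. 1 - \<epsilon> < measure (\<mu> n) {a<..b})"
      by (intro exI[of _ "-1"] exI[of _ "2*pi"]) (use pi_gt_zero in \<open>auto intro: less_trans[of _ 0]\<close>)
  qed (rule rd)
  from tight_imp_convergent_subsubsequence[OF this strict_mono_id]
  obtain r M where r: "strict_mono r" and M: "real_distribution M" and wc: "weak_conv_m (\<mu> \<circ> r) M"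
    by auto
  interpret M: real_distribution M by (rule M)
  have cM: "c (int n) = (LINT x|M. cis (real n * x))" for n :: nat
  proof -
    have "(\<lambda>k. LINT x|(\<mu> \<circ> r) k. cis (real n * x)) \<longlonglongrightarrow> (LINT x|M. cis (real n * x))"
      by (rule weak_conv_imp_integral_bdd_continuous_conv[OF _ M wc, where B=1])
        (auto simp: rd cis_conv_exp)
    moreover have "(\<lambda>N. of_real (real (Suc N - n) / real (Suc N)) * c (int n)) \<longlonglongrightarrow> of_real 1 * c (int n)"
    proof (intro tendsto_intros)
      have "(\<lambda>N. 1 - real n / real (Suc N)) \<longlonglongrightarrow> 1 - 0"
        by (intro tendsto_intros LIMSEQ_Suc[OF lim_const_over_n])
      moreover have "\<forall>\<^sub>F N in sequentially. 1 - real n / real (Suc N) = real (Suc N - n) / real (Suc N)"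
        using eventually_ge_at_top[of n] by eventually_elim (simp add: of_nat_diff field_simps)
      ultimately show "(\<lambda>N. real (Suc N - n) / real (Suc N)) \<longlonglongrightarrow> 1"
        by (simp add: tendsto_cong)
    qed
    from LIMSEQ_subseq_LIMSEQ[OF this r]
    have "(\<lambda>k. LINT x|(\<mu> \<circ> r) k. cis (real n * x)) \<longlonglongrightarrow> c (int n)"
      by (simp add: mcoef o_def)
    ultimately show ?thesis by (metis LIMSEQ_unique)
  qed
  have "measure M (- {0..2*pi}) = 0"
  proof -
    \<comment> \<open>Weak convergence tests continuous functions only: \<open>?h\<close> is
      bounded, continuous, 0 exactly on [0, 2 pi] and positive elsewhere, and replaces the indicator
      of the complement.\<close>
    let ?h = "\<lambda>x::real. min 1 (max 0 (- x)) + min 1 (max 0 (x - 2*pi))"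
    have "(\<lambda>k. LINT x|(\<mu> \<circ> r) k. ?h x) \<longlonglongrightarrow> (LINT x|M. ?h x)"
      by (rule weak_conv_imp_integral_bdd_continuous_conv[OF _ M wc, where B=2])
        (auto simp: rd intro!: continuous_intros)
    moreover have "(LINT x|(\<mu> \<circ> r) k. ?h x) = 0" for k
    proof -
      have "AE x in \<mu> (r k). x \<in> {0..2*pi}"
        using comp[of "{0..2*pi}" "r k"] by (subst \<mu>.prob_eq_1[symmetric]) auto
      then have "AE x in \<mu> (r k). ?h x = 0" by eventually_elim auto
      then show ?thesis by (simp add: integral_eq_zero_AE)
    qed
    ultimately have z: "(LINT x|M. ?h x) = 0" by (simp add: LIMSEQ_const_iff)
    have "AE x in M. ?h x = 0"
    proof (subst integral_nonneg_eq_0_iff_AE[symmetric])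
      show "integrable M ?h" by (rule M.integrable_const_bound[where B=2]) auto
    qed (use z in auto)
    then have "AE x in M. x \<in> {0..2*pi}"
      by eventually_elim (auto simp: min_def max_def split: if_splits)
    then have "M.prob {0..2*pi} = 1" by (subst M.prob_eq_1) auto
    then show ?thesis using M.prob_compl[of "{0..2*pi}"] by (simp add: Compl_eq_Diff_UNIV)
  qed
  then have AEM: "AE x in M. x \<in> {0..2*pi}"
    by (intro AE_I[where N="- {0..2*pi}"]) (auto simp: M.emeasure_eq_measure)
  \<comment> \<open>The weak limit may charge 2 pi. The push-forward by \<open>g\<close> glues 2 pi
    to 0, which no \<open>cis (real n * x)\<close> notices, and yields a measure on the half-open
    interval.\<close>
  define g :: "real \<Rightarrow> real" where "g x = (if 0 \<le> x \<and> x < 2*pi then x else 0)" for x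
  have [measurable]: "g \<in> borel_measurable borel" unfolding g_def by measurable
  have gM [measurable]: "g \<in> borel_measurable M" by simp
  define M' where "M' = distr M borel g"
  have "real_distribution M'"
    unfolding M'_def by (rule M.real_distribution_distr) simp
  moreover have "emeasure M' (- {0..<2*pi}) = 0"
  proof -
    have "g x \<in> {0..<2*pi}" for x using pi_gt_zero by (simp add: g_def)
    then have "g -` (- {0..<2*pi}) \<inter> space M = {}" by blast
    then show ?thesis unfolding M'_def by (subst emeasure_distr) auto
  qed
  moreover have "c (int n) = (LINT x|M'. cis (real n * x))" for n :: nat
  proof -
    have "(LINT x|M'. cis (real n * x)) = (LINT x|M. cis (real n * g x))"
      unfolding M'_def by (rule integral_distr) (auto)
    also have "\<dots> = (LINT x|M. cis (real n * x))"
    proof (rule integral_cong_AE)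
      show "AE x in M. cis (real n * g x) = cis (real n * x)"
        using AEM
      proof eventually_elim
        case (elim x)
        have "cis (real n * (2*pi)) = 1"
          using cis_multiple_2pi[of "of_nat n"] by (simp add: mult.commute mult.left_commute)
        with elim show ?case by (cases "x = 2*pi") (auto simp: g_def)
      qed
    qed (auto)
    finally show ?thesis using cM by simp
  qed
  ultimately show ?thesis using that by blast
qed

text \<open>The notion \<open>spectral_measure\<close> for an arbitrary index type; the walk lives
  on \<open>bool \<times> int\<close>.\<close>

definition spectral_meas :: "(('i \<Rightarrow> complex) \<Rightarrow> ('i \<Rightarrow> complex)) \<Rightarrow> ('i \<Rightarrow> complex) \<Rightarrow> real measure \<Rightarrow> bool" where
  "spectral_meas V \<phi> \<mu> \<longleftrightarrow>
     sets \<mu> = sets borel \<and> finite_measure \<mu> \<and> emeasure \<mu> (- {0..<2 * pi}) = 0 \<and>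
     (\<forall>n::nat. ip \<phi> ((V ^^ n) \<phi>) = (LINT x|\<mu>. cis (real n * x)))"

lemma ip_sums:
  assumes "finite A" "finite B" "\<And>k. k \<in> A \<Longrightarrow> f k \<in> hl2" "\<And>l. l \<in> B \<Longrightarrow> g l \<in> hl2"
  shows "ip (\<lambda>i. \<Sum>k\<in>A. a k * f k i) (\<lambda>i. \<Sum>l\<in>B. b l * g l i)
    = (\<Sum>k\<in>A. \<Sum>l\<in>B. cnj (a k) * b l * ip (f k) (g l))"
proof -
  have left: "ip (\<lambda>i. \<Sum>k\<in>A. a k * f k i) h = (\<Sum>k\<in>A. cnj (a k) * ip (f k) h)" if "h \<in> hl2" for h
  proof -
    have "ip h (\<lambda>i. \<Sum>k\<in>A. a k * f k i) = (\<Sum>k\<in>A. a k * ip h (f k))"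
      using ip_sum_right[of A h "\<lambda>k i. a k * f k i"] assms that
      by (simp add: hl2_scale ip_scale_right)
    from arg_cong[OF this, of cnj] show ?thesis by (simp add: ip_cnj)
  qed
  have right: "ip h (\<lambda>i. \<Sum>l\<in>B. b l * g l i) = (\<Sum>l\<in>B. b l * ip h (g l))" if "h \<in> hl2" for h
    using ip_sum_right[of B h "\<lambda>k i. b k * g k i"] assms that
    by (simp add: hl2_scale ip_scale_right)
  have "(\<lambda>i. \<Sum>l\<in>B. b l * g l i) \<in> hl2"
    using assms by (intro hl2_sum hl2_scale) auto
  from left[OF this] show ?thesis
    using assms by (simp add: right sum_distrib_left mult.assoc)
qed

lemma ip_funpow2:
  assumes V: "l2_isometry V" and \<phi>: "\<phi> \<in> hl2"
  shows "k \<le> l \<Longrightarrow> ip ((V ^^ k) \<phi>) ((V ^^ l) \<phi>) = ip \<phi> ((V ^^ (l - k)) \<phi>)"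
    and "l \<le> k \<Longrightarrow> ip ((V ^^ k) \<phi>) ((V ^^ l) \<phi>) = cnj (ip \<phi> ((V ^^ (k - l)) \<phi>))"
proof -
  have *: "ip ((V ^^ k) \<phi>) ((V ^^ l) \<phi>) = ip \<phi> ((V ^^ (l - k)) \<phi>)" if "k \<le> l" for k l
  proof -
    have "(V ^^ l) \<phi> = (V ^^ k) ((V ^^ (l - k)) \<phi>)"
      using that by (metis comp_apply funpow_add le_add_diff_inverse)
    then show ?thesis using ip_funpow[OF V \<phi> l2_isometryD(3)[OF V \<phi>]] by simp
  qed
  then show "k \<le> l \<Longrightarrow> ip ((V ^^ k) \<phi>) ((V ^^ l) \<phi>) = ip \<phi> ((V ^^ (l - k)) \<phi>)" .
  show "l \<le> k \<Longrightarrow> ip ((V ^^ k) \<phi>) ((V ^^ l) \<phi>) = cnj (ip \<phi> ((V ^^ (k - l)) \<phi>))"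
    using *[of l k] by (metis ip_cnj)
qed

text \<open>The autocorrelations \<open>c n\<close> are positive definite: their Fejer sum is the
  squared norm of \<open>?g\<close>, the sum of e^(-i k x) V^k \<phi>, divided by that of \<phi>.
  The division makes \<open>c 0 = 1\<close>, so the zero vector is treated apart, with the null
  measure.\<close>

lemma spectral_meas_exists:
  assumes V: "l2_isometry V" and \<phi>: "\<phi> \<in> hl2"
  obtains \<mu> where "spectral_meas V \<phi> \<mu>"
proof (cases "nrm \<phi> = 0")
  case True
  have "ip \<phi> ((V ^^ n) \<phi>) = 0" for n
    using ip_bound[OF \<phi> l2_isometryD(3)[OF V \<phi>], of n] True by simp
  then have "spectral_meas V \<phi> (null_measure borel)"
    by (auto simp: spectral_meas_def intro!: finite_measureI integral_eq_zero_null_sets[symmetric])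
  then show ?thesis by (rule that)
next
  case False
  define c where "c n = (if n \<ge> 0 then ip \<phi> ((V ^^ nat n) \<phi>) else cnj (ip \<phi> ((V ^^ nat (- n)) \<phi>)))
     / of_real ((nrm \<phi>)\<^sup>2)" for n :: int
  have cdiff: "c (int l - int k) = ip ((V ^^ k) \<phi>) ((V ^^ l) \<phi>) / of_real ((nrm \<phi>)\<^sup>2)" for k l
  proof (cases "k \<le> l")
    case True
    then show ?thesis by (simp add: c_def ip_funpow2(1)[OF V \<phi>] nat_diff_distrib)
  next
    case False
    then show ?thesis by (simp add: c_def ip_funpow2(2)[OF V \<phi>] nat_diff_distrib)
  qed
  have fej: "0 \<le> Re (fejer c N x)" for N x
  proof -
    let ?g = "\<lambda>i. \<Sum>k<N. cis (- real k * x) * (V ^^ k) \<phi> i"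
    have g: "?g \<in> hl2"
      by (intro hl2_sum hl2_scale l2_isometryD(3)[OF V \<phi>]) auto
    have "of_real ((nrm ?g)\<^sup>2) = ip ?g ?g" by (simp only: ip_self[OF g])
    also have "\<dots> = (\<Sum>k<N. \<Sum>l<N. cnj (cis (- real k * x)) * cis (- real l * x) * ip ((V ^^ k) \<phi>) ((V ^^ l) \<phi>))"
      by (intro ip_sums l2_isometryD(3)[OF V \<phi>]) auto
    also have "\<dots> = of_real ((nrm \<phi>)\<^sup>2) * fejer c N x"
      unfolding fejer_def sum_distrib_left cdiff
      using False by (intro sum.cong refl) (simp add: cis_cnj cis_mult algebra_simps)
    finally have "Re (of_real ((nrm ?g)\<^sup>2)) = Re (of_real ((nrm \<phi>)\<^sup>2) * fejer c N x)"
      by (rule arg_cong)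
    then have "(nrm ?g)\<^sup>2 = (nrm \<phi>)\<^sup>2 * Re (fejer c N x)"
      by (simp del: of_real_power)
    then have "0 \<le> (nrm \<phi>)\<^sup>2 * Re (fejer c N x)"
      using zero_le_power2[of "nrm ?g"] by (simp only:)
    then show ?thesis using False by (simp add: zero_le_mult_iff)
  qed
  obtain M where M: "real_distribution M" "emeasure M (- {0..<2*pi}) = 0"
    "\<And>n::nat. c (int n) = (LINT x|M. cis (real n * x))"
  proof (rule herglotz[of c])
    have "ip \<phi> \<phi> = cnj (ip \<phi> \<phi>)" by (simp add: ip_cnj)
    then show "c (- n) = cnj (c n)" for n
      by (cases "n = 0") (auto simp: c_def)
    show "c 0 = 1" using False by (simp add: c_def ip_self[OF \<phi>])
  qed (use fej in auto)
  interpret M: real_distribution M by fact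
  let ?\<mu> = "density M (\<lambda>_. ennreal ((nrm \<phi>)\<^sup>2))"
  have "spectral_meas V \<phi> ?\<mu>"
    unfolding spectral_meas_def
  proof (intro conjI allI)
    show "finite_measure ?\<mu>"
      by (rule finite_measureI)
        (simp add: emeasure_density_const ennreal_mult_eq_top_iff M.emeasure_space_1[simplified])
    show "ip \<phi> ((V ^^ n) \<phi>) = (LINT x|?\<mu>. cis (real n * x))" for n
    proof -
      have "(LINT x|?\<mu>. cis (real n * x)) = (nrm \<phi>)\<^sup>2 *\<^sub>R (LINT x|M. cis (real n * x))"
        by (subst integral_density) auto
      also have "\<dots> = ip \<phi> ((V ^^ n) \<phi>)"
        using False by (simp add: M(3)[symmetric] c_def scaleR_conv_of_real)
      finally show ?thesis by simp
    qed
  qed (auto simp: M(2) emeasure_density_const)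
  then show ?thesis by (rule that)
qed

text \<open>Functional calculus for polynomials: p(V) \<phi> corresponds to p(e^(i x)) in
  L^2(\<mu>). Conjugation supplies the coefficients of negative index, so all inner products of
  powers are known. The norm identity carries operator estimates over to \<mu>.\<close>

lemma spectral_meas_poly:
  assumes V: "l2_isometry V" and \<phi>: "\<phi> \<in> hl2" and S: "spectral_meas V \<phi> \<mu>"
  shows "ip \<phi> (\<lambda>i. \<Sum>n<N. a n * (V ^^ n) \<phi> i) = (LINT x|\<mu>. (\<Sum>n<N. a n * cis (real n * x)))"
    and "(nrm (\<lambda>i. \<Sum>n<N. a n * (V ^^ n) \<phi> i))\<^sup>2 = (LINT x|\<mu>. (cmod (\<Sum>n<N. a n * cis (real n * x)))\<^sup>2)"
proof -
  interpret finite_measure \<mu> using S by (simp add: spectral_meas_def)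
  have sets [measurable_cong]: "sets \<mu> = sets borel" using S by (simp add: spectral_meas_def)
  have int: "integrable \<mu> (\<lambda>x. cis (y * x))" for y :: real
    by (rule integrable_const_bound[where B=1])
      (auto simp: measurable_cong_sets[OF sets refl])
  have mem: "(V ^^ n) \<phi> \<in> hl2" for n by (rule l2_isometryD[OF V \<phi>])
  have coef: "ip \<phi> ((V ^^ n) \<phi>) = (LINT x|\<mu>. cis (real n * x))" for n
    using S by (simp add: spectral_meas_def)
  have coef2: "ip ((V ^^ k) \<phi>) ((V ^^ l) \<phi>) = (LINT x|\<mu>. cis ((real l - real k) * x))" for k l
  proof (cases "k \<le> l")
    case True
    then show ?thesis by (simp add: ip_funpow2(1)[OF V \<phi>] coef of_nat_diff)
  next
    case False
    then have "ip ((V ^^ k) \<phi>) ((V ^^ l) \<phi>) = (LINT x|\<mu>. cnj (cis (real (k - l) * x)))"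
      by (simp add: ip_funpow2(2)[OF V \<phi>] coef)
    also have "\<dots> = (LINT x|\<mu>. cis ((real l - real k) * x))"
      using False by (intro Bochner_Integration.integral_cong refl) (simp add: cis_cnj of_nat_diff algebra_simps)
    finally show ?thesis .
  qed
  show "ip \<phi> (\<lambda>i. \<Sum>n<N. a n * (V ^^ n) \<phi> i) = (LINT x|\<mu>. (\<Sum>n<N. a n * cis (real n * x)))"
    using ip_sum_right[of "{..<N}" \<phi> "\<lambda>n i. a n * (V ^^ n) \<phi> i"] \<phi> mem
    by (simp add: hl2_scale ip_scale_right coef Bochner_Integration.integral_sum int)
  let ?g = "\<lambda>i. \<Sum>n<N. a n * (V ^^ n) \<phi> i"
  have "of_real ((nrm ?g)\<^sup>2) = ip ?g ?g"
    by (intro ip_self[symmetric] hl2_sum hl2_scale mem) auto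
  also have "\<dots> = (\<Sum>k<N. \<Sum>l<N. cnj (a k) * a l * (LINT x|\<mu>. cis ((real l - real k) * x)))"
    unfolding coef2[symmetric] by (intro ip_sums mem) auto
  also have "\<dots> = (LINT x|\<mu>. (\<Sum>k<N. \<Sum>l<N. cnj (a k) * a l * cis ((real l - real k) * x)))"
    by (simp add: Bochner_Integration.integral_sum Bochner_Integration.integrable_sum int)
  also have "\<dots> = (LINT x|\<mu>. of_real ((cmod (\<Sum>n<N. a n * cis (real n * x)))\<^sup>2))"
  proof (intro Bochner_Integration.integral_cong refl)
    fix x
    have "of_real ((cmod (\<Sum>n<N. a n * cis (real n * x)))\<^sup>2) =
       cnj (\<Sum>n<N. a n * cis (real n * x)) * (\<Sum>n<N. a n * cis (real n * x))"
      by (rule of_real_cmod_sq)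
    also have "\<dots> = (\<Sum>k<N. \<Sum>l<N. cnj (a k) * a l * cis ((real l - real k) * x))"
      unfolding cnj_sum complex_cnj_mult sum_product
      by (intro sum.cong refl) (simp add: cis_cnj cis_mult algebra_simps)
    finally show "(\<Sum>k<N. \<Sum>l<N. cnj (a k) * a l * cis ((real l - real k) * x))
       = of_real ((cmod (\<Sum>n<N. a n * cis (real n * x)))\<^sup>2)" by simp
  qed
  finally have "of_real ((nrm ?g)\<^sup>2) = complex_of_real (LINT x|\<mu>. (cmod (\<Sum>n<N. a n * cis (real n * x)))\<^sup>2)"
    by (simp only: integral_complex_of_real)
  then show "(nrm ?g)\<^sup>2 = (LINT x|\<mu>. (cmod (\<Sum>n<N. a n * cis (real n * x)))\<^sup>2)"
    using of_real_eq_iff by blast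
qed

section \<open>Atoms and singularity of spectral measures\<close>

lemma cis_eq_1_iff_period:
  assumes "0 \<le> x" "x < 2*pi" "0 \<le> y" "y < 2*pi" "cis (y - x) = 1"
  shows "y = x"
proof -
  have "cos (y - x) = 1" using assms(5) by (simp add: complex_eq_iff)
  then obtain n :: int where n: "y - x = of_int n * 2 * pi" by (auto simp: cos_one_2pi_int)
  then have "\<bar>of_int n * (2 * pi)\<bar> < 1 * (2*pi)" using assms by linarith
  then have "\<bar>real_of_int n\<bar> < 1" by (simp add: abs_mult)
  then have "n = 0" by linarith
  then show ?thesis using n by simp
qed

text \<open>Scalar mean ergodic theorem: for \<open>w \<noteq> 1\<close> the geometric sums stay
  below 2 / |w - 1|, so division by their length sends them to 0.\<close>

lemma cesaro_cis_limit:
  fixes w :: complex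
  assumes "cmod w = 1"
  shows "(\<lambda>N. (\<Sum>n<Suc N. w ^ n) / of_nat (Suc N)) \<longlonglongrightarrow> (if w = 1 then 1 else 0)"
proof (cases "w = 1")
  case True
  then show ?thesis by (simp del: of_nat_Suc)
next
  case False
  have "(\<lambda>N. (\<Sum>n<Suc N. w ^ n) / of_nat (Suc N)) \<longlonglongrightarrow> 0"
  proof (rule tendsto_norm_zero_cancel, rule Lim_null_comparison)
    show "\<forall>\<^sub>F N in sequentially. norm (norm ((\<Sum>n<Suc N. w ^ n) / of_nat (Suc N)))
       \<le> (2 / cmod (w - 1)) / real (Suc N)"
    proof (intro always_eventually allI)
      fix N
      have "cmod (w ^ Suc N - 1) \<le> cmod (w ^ Suc N) + cmod 1" by (rule norm_triangle_ineq4)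
      then have "cmod (w ^ Suc N - 1) \<le> 2" using assms by (simp add: norm_power norm_mult)
      then have "cmod (\<Sum>n<Suc N. w ^ n) \<le> 2 / cmod (w - 1)"
        using False geometric_sum[of w "Suc N"] by (simp add: norm_divide divide_right_mono del: power_Suc)
      then have "cmod (\<Sum>n<Suc N. w ^ n) / real (Suc N) \<le> 2 / cmod (w - 1) / real (Suc N)"
        by (rule divide_right_mono) simp
      then show "norm (norm ((\<Sum>n<Suc N. w ^ n) / of_nat (Suc N))) \<le> (2 / cmod (w - 1)) / real (Suc N)"
        by (simp only: norm_divide norm_of_nat real_norm_def abs_divide abs_of_nat abs_norm_cancel)
    qed
    show "(\<lambda>N. (2 / cmod (w - 1)) / real (Suc N)) \<longlonglongrightarrow> 0"
      by (rule LIMSEQ_Suc[OF lim_const_over_n])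
  qed
  then show ?thesis using False by simp
qed

text \<open>A finite part of \<phi> sees finitely many coordinates, and Cauchy-Schwarz absorbs the
  tail: bounded and coordinatewise null implies weakly null.\<close>

lemma ip_tendsto_0_pointwise:
  assumes \<phi>: "\<phi> \<in> hl2" and A: "\<And>N. A N \<in> hl2" "\<And>N. nrm (A N) \<le> B"
    and lim: "\<And>i. (\<lambda>N. A N i) \<longlonglongrightarrow> 0"
  shows "(\<lambda>N. ip \<phi> (A N)) \<longlonglongrightarrow> 0"
proof (rule LIMSEQ_I)
  fix e :: real assume e: "e > 0"
  have B: "0 \<le> B" using A(2)[of 0] nrm_nonneg[of "A 0"] by linarith
  obtain S where S: "finite S" "(\<lambda>i. if i \<in> S then 0 else \<phi> i) \<in> hl2"
    "nrm (\<lambda>i. if i \<in> S then 0 else \<phi> i) < e / (2 * (B + 1))"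
    using hl2_small_tail[OF \<phi>, of "e / (2 * (B + 1))"] e B by auto
  let ?t = "\<lambda>i. if i \<in> S then 0 else \<phi> i"
  have split: "ip \<phi> (A N) = (\<Sum>i\<in>S. cnj (\<phi> i) * A N i) + ip ?t (A N)" for N
  proof -
    have "ip \<phi> (A N) = (\<Sum>\<^sub>\<infinity>i. (if i \<in> S then cnj (\<phi> i) * A N i else 0) + cnj (?t i) * A N i)"
      unfolding ip_def by (intro infsum_cong) auto
    also have "\<dots> = (\<Sum>\<^sub>\<infinity>i. if i \<in> S then cnj (\<phi> i) * A N i else 0) + ip ?t (A N)"
      unfolding ip_def
    proof (intro infsum_add)
      show "(\<lambda>i. if i \<in> S then cnj (\<phi> i) * A N i else 0) summable_on UNIV"
        using S(1) by (intro finite_nonzero_values_imp_summable_on) (auto intro: finite_subset[of _ S])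
    qed (rule summable_ip[OF S(2) A(1)])
    also have "(\<Sum>\<^sub>\<infinity>i. if i \<in> S then cnj (\<phi> i) * A N i else 0) = (\<Sum>\<^sub>\<infinity>i\<in>S. cnj (\<phi> i) * A N i)"
      by (intro infsum_cong_neutral) auto
    finally show ?thesis using S(1) by simp
  qed
  have "(\<lambda>N. \<Sum>i\<in>S. cnj (\<phi> i) * A N i) \<longlonglongrightarrow> (\<Sum>i\<in>S. cnj (\<phi> i) * 0)"
    by (intro tendsto_intros lim)
  then have "\<exists>N0. \<forall>N\<ge>N0. norm ((\<Sum>i\<in>S. cnj (\<phi> i) * A N i) - 0) < e/2"
    using e by (intro LIMSEQ_D) auto
  then obtain N0 where N0: "\<And>N. N \<ge> N0 \<Longrightarrow> cmod (\<Sum>i\<in>S. cnj (\<phi> i) * A N i) < e/2" by auto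
  have tail: "cmod (ip ?t (A N)) \<le> e/2" for N
  proof -
    have "cmod (ip ?t (A N)) \<le> nrm ?t * nrm (A N)" by (rule ip_bound[OF S(2) A(1)])
    also have "\<dots> \<le> e / (2 * (B + 1)) * (B + 1)"
      using S(3) A(2)[of N] B e by (intro mult_mono) auto
    also have "\<dots> = e/2" using B by (simp add: field_simps)
    finally show ?thesis .
  qed
  show "\<exists>N0. \<forall>N\<ge>N0. norm (ip \<phi> (A N) - 0) < e"
  proof (intro exI[of _ N0] allI impI)
    fix N assume "N \<ge> N0"
    then show "norm (ip \<phi> (A N) - 0) < e"
      using N0[of N] tail[of N] norm_triangle_ineq[of "\<Sum>i\<in>S. cnj (\<phi> i) * A N i" "ip ?t (A N)"]
      by (simp add: split)
  qed
qed

text \<open>The Cesaro means of \<open>cis (- n x) V\<^sup>n \<phi>\<close> are Cauchy because their symbols converge in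
  \<open>L\<^sup>2(\<mu>)\<close> to the indicator of \<open>x\<close>; their limit is an eigenvector, whose inner product with \<open>\<phi>\<close>
  is the mass of the atom.\<close>

lemma spectral_meas_no_atom:
  assumes V: "l2_isometry V" and \<phi>: "\<phi> \<in> hl2" and S: "spectral_meas V \<phi> \<mu>"
    and local: "\<And>f F i. (\<And>j. (\<lambda>N::nat. f N j) \<longlonglongrightarrow> F j) \<Longrightarrow> (\<lambda>N. V (f N) i) \<longlonglongrightarrow> V F i"
    and no_ev: "\<And>z F. cmod z = 1 \<Longrightarrow> F \<in> hl2 \<Longrightarrow> V F = (\<lambda>i. z * F i) \<Longrightarrow> F = (\<lambda>i. 0)"
  shows "emeasure \<mu> {x} = 0"
proof (cases "x \<in> {0..<2*pi}")
  case False
  have "sets \<mu> = sets borel" "emeasure \<mu> (- {0..<2*pi}) = 0"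
    using S by (auto simp: spectral_meas_def)
  then have "emeasure \<mu> {x} \<le> 0"
    using emeasure_mono[of "{x}" "- {0..<2*pi}" \<mu>] False by auto
  then show ?thesis by simp
next
  case True
  interpret finite_measure \<mu> using S by (simp add: spectral_meas_def)
  have sets [measurable_cong, simp]: "sets \<mu> = sets borel" using S by (simp add: spectral_meas_def)
  have supp: "AE y in \<mu>. y \<in> {0..<2*pi}"
    using S by (intro AE_I[where N="- {0..<2*pi}"]) (auto simp: spectral_meas_def)
  \<comment> \<open>The coefficients are 0 beyond \<open>N\<close>, so that means of different
    lengths expand over one common range and can be subtracted term by term.\<close>
  define a where "a N n = (if n \<le> N then cis (- real n * x) / of_nat (Suc N) else 0)" for N n :: nat
  define A where "A N i = (\<Sum>n<Suc N. a N n * (V ^^ n) \<phi> i)" for N i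
  define G where "G N y = (\<Sum>n<Suc N. a N n * cis (real n * y))" for N y
  have A_ext: "A N i = (\<Sum>n<K. a N n * (V ^^ n) \<phi> i)" and G_ext: "G N y = (\<Sum>n<K. a N n * cis (real n * y))"
    if "N < K" for N K i y
    unfolding A_def G_def using that
    by (rule_tac [!] sum.mono_neutral_left) (auto simp: a_def)
  have Vm: "(V ^^ n) \<phi> \<in> hl2" "nrm ((V ^^ n) \<phi>) = nrm \<phi>" for n using l2_isometryD[OF V \<phi>] by auto
  have Ahl2: "A N \<in> hl2" for N
    unfolding A_def[abs_def] by (intro hl2_sum hl2_scale Vm) auto
  have Anrm: "nrm (A N) \<le> nrm \<phi>" for N
  proof -
    have "nrm (A N) \<le> (\<Sum>n<Suc N. nrm (\<lambda>i. a N n * (V ^^ n) \<phi> i))"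
      unfolding A_def[abs_def] by (intro nrm_sum hl2_scale Vm) auto
    also have "\<dots> = (\<Sum>n<Suc N. nrm \<phi> / real (Suc N))"
      unfolding nrm_scale Vm by (intro sum.cong refl) (auto simp: a_def norm_divide simp del: of_nat_Suc)
    finally show ?thesis by (simp del: of_nat_Suc)
  qed
  have G_eq: "G N y = (\<Sum>n<Suc N. cis (y - x) ^ n) / of_nat (Suc N)" for N y
  proof -
    have "cis (- real n * x) * cis (real n * y) = cis (y - x) ^ n" for n
      unfolding Complex.DeMoivre cis_mult by (rule arg_cong[of _ _ cis]) (simp add: algebra_simps)
    then show ?thesis
      unfolding G_def a_def sum_divide_distrib by (intro sum.cong refl) (auto simp del: of_nat_Suc)
  qed
  have Glim: "(\<lambda>N. G N y) \<longlonglongrightarrow> indicator {x} y" if "y \<in> {0..<2*pi}" for y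
  proof -
    have "(\<lambda>N. G N y) \<longlonglongrightarrow> (if cis (y - x) = 1 then 1 else 0)"
      unfolding G_eq by (rule cesaro_cis_limit) simp
    moreover have "cis (y - x) = 1 \<longleftrightarrow> y = x"
      using cis_eq_1_iff_period[of x y] that True by auto
    ultimately show ?thesis by (cases "y = x") simp_all
  qed
  have Gbound: "cmod (G N y) \<le> 1" for N y
  proof -
    have "cmod (\<Sum>n<Suc N. cis (y - x) ^ n) \<le> (\<Sum>n<Suc N. 1)"
      by (intro sum_norm_le) (simp add: norm_power)
    then show ?thesis unfolding G_eq by (simp add: norm_divide divide_le_eq_1 del: of_nat_Suc)
  qed
  have Gm [measurable]: "G N \<in> borel_measurable borel" for N unfolding G_def by measurable
  have Gd: "(cmod (G N y - indicator {x} y))\<^sup>2 \<le> 4" for N y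
  proof -
    have "cmod (indicator {x} y) \<le> 1" by (simp add: indicator_def)
    then have "cmod (G N y - indicator {x} y) \<le> 2"
      using norm_triangle_ineq4[of "G N y" "indicator {x} y"] Gbound[of N y] by linarith
    from power_mono[OF this, of 2] show ?thesis by simp
  qed
  define \<epsilon> where "\<epsilon> N = (LINT y|\<mu>. (cmod (G N y - indicator {x} y))\<^sup>2)" for N
  have int2: "integrable \<mu> (\<lambda>y. (cmod (G N y - indicator {x} y))\<^sup>2)" for N
    by (rule integrable_const_bound[where B=4]) (use Gd in auto)
  have "\<epsilon> \<longlonglongrightarrow> (LINT y|\<mu>. 0)" unfolding \<epsilon>_def
  proof (rule integral_dominated_convergence[where w="\<lambda>_. 4"])
    show "AE y in \<mu>. (\<lambda>N. (cmod (G N y - indicator {x} y))\<^sup>2) \<longlonglongrightarrow> 0"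
      using supp
    proof eventually_elim
      case (elim y)
      then have "(\<lambda>N. (cmod (G N y - indicator {x} y))\<^sup>2) \<longlonglongrightarrow> (cmod (indicator {x} y - indicator {x} y))\<^sup>2"
        by (intro tendsto_intros Glim)
      then show ?case by simp
    qed
    show "AE y in \<mu>. norm ((cmod (G N y - indicator {x} y))\<^sup>2) \<le> 4" for N
      using Gd by auto
  qed auto
  then have eps: "\<epsilon> \<longlonglongrightarrow> 0" by simp
  \<comment> \<open>The norm of the difference is the L^2(\<mu>) distance of the symbols, both close
    to the indicator of \<open>x\<close>. Coordinatewise Cauchy is extracted, the mode of
    convergence under which \<open>local\<close> lets \<open>V\<close> pass to the limit.\<close>
  have cau: "(cmod (A N i - A M i))\<^sup>2 \<le> 2 * \<epsilon> N + 2 * \<epsilon> M" for N M i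
  proof -
    define K where "K = Suc (max N M)"
    have K: "N < K" "M < K" by (auto simp: K_def)
    have diff: "(\<lambda>i. A N i - A M i) = (\<lambda>i. \<Sum>n<K. (a N n - a M n) * (V ^^ n) \<phi> i)"
      by (simp add: A_ext[OF K(1)] A_ext[OF K(2)] sum_subtractf left_diff_distrib)
    have "(cmod (A N i - A M i))\<^sup>2 \<le> (nrm (\<lambda>i. A N i - A M i))\<^sup>2"
      using cmod_le_nrm[OF hl2_diff[OF Ahl2[of N] Ahl2[of M]], of i] by (intro power_mono) auto
    also have "(nrm (\<lambda>i. A N i - A M i))\<^sup>2 = (LINT y|\<mu>. (cmod (G N y - G M y))\<^sup>2)"
      unfolding diff spectral_meas_poly(2)[OF V \<phi> S]
      by (simp add: G_ext[OF K(1)] G_ext[OF K(2)] sum_subtractf left_diff_distrib)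
    also have "\<dots> \<le> (LINT y|\<mu>. 2 * (cmod (G N y - indicator {x} y))\<^sup>2 + 2 * (cmod (G M y - indicator {x} y))\<^sup>2)"
    proof (rule integral_mono_AE')
      show "AE y in \<mu>. (cmod (G N y - G M y))\<^sup>2
         \<le> 2 * (cmod (G N y - indicator {x} y))\<^sup>2 + 2 * (cmod (G M y - indicator {x} y))\<^sup>2"
      proof (intro always_eventually allI)
        fix y
        let ?u = "cmod (G N y - indicator {x} y)" and ?v = "cmod (G M y - indicator {x} y)"
        have "cmod (G N y - G M y) \<le> ?u + ?v"
          using norm_triangle_ineq4[of "G N y - indicator {x} y" "G M y - indicator {x} y"] by simp
        then have "(cmod (G N y - G M y))\<^sup>2 \<le> (?u + ?v)\<^sup>2" by (intro power_mono) auto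
        also have "\<dots> \<le> 2 * ?u\<^sup>2 + 2 * ?v\<^sup>2"
          using sum_squares_bound[of ?u ?v] by (simp add: power2_sum)
        finally show "(cmod (G N y - G M y))\<^sup>2 \<le> 2 * ?u\<^sup>2 + 2 * ?v\<^sup>2" .
      qed
    qed (auto intro!: Bochner_Integration.integrable_add integrable_mult_right int2)
    also have "\<dots> = 2 * \<epsilon> N + 2 * \<epsilon> M"
      unfolding \<epsilon>_def by (simp add: int2)
    finally show ?thesis .
  qed
  have conv: "\<exists>l. (\<lambda>N. A N i) \<longlonglongrightarrow> l" for i
  proof -
    have "Cauchy (\<lambda>N. A N i)"
    proof (rule CauchyI)
      fix e :: real assume e: "e > 0"
      then obtain N0 where N0: "\<And>N. N \<ge> N0 \<Longrightarrow> norm (\<epsilon> N - 0) < e\<^sup>2 / 4"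
        using LIMSEQ_D[OF eps, of "e\<^sup>2/4"] by auto
      have "cmod (A M i - A N i) < e" if "M \<ge> N0" "N \<ge> N0" for M N
      proof -
        have "(cmod (A M i - A N i))\<^sup>2 < e\<^sup>2"
          using cau[of M i N] N0[OF that(1)] N0[OF that(2)] by (auto simp: abs_less_iff)
        then show ?thesis using e by (simp add: power_less_imp_less_base)
      qed
      then show "\<exists>M. \<forall>m\<ge>M. \<forall>n\<ge>M. norm (A m i - A n i) < e" by blast
    qed
    then show ?thesis by (simp add: Cauchy_convergent_iff convergent_def)
  qed
  then obtain F where F: "\<And>i. (\<lambda>N. A N i) \<longlonglongrightarrow> F i" by metis
  have "F \<in> hl2"
  proof (rule hl2I)
    fix I :: "'a set" assume "finite I"
    have "(\<lambda>N. L2_set (\<lambda>i. cmod (A N i)) I) \<longlonglongrightarrow> L2_set (\<lambda>i. cmod (F i)) I"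
      unfolding L2_set_def by (intro tendsto_intros F)
    then show "L2_set (\<lambda>i. cmod (F i)) I \<le> nrm \<phi>"
      by (rule LIMSEQ_le_const2)
        (use L2_set_le_nrm[OF Ahl2 \<open>finite I\<close>] Anrm order_trans in blast)
  qed
  moreover have "V F = (\<lambda>i. cis x * F i)"
  proof
    fix i
    define b where "b n = cis (- real n * x) * (V ^^ n) \<phi> i" for n
    \<comment> \<open>Up to the factor \<open>cis x\<close>, \<open>V\<close> moves each term of the
      mean to the next one; telescoping leaves a boundary term of size O(1/N).\<close>
    have rel: "V (A N) i = cis x * A N i + cis x * (b (Suc N) - b 0) / of_nat (Suc N)" for N
    proof -
      have VA: "V (A N) = (\<lambda>i. \<Sum>n<Suc N. V (\<lambda>i. a N n * (V ^^ n) \<phi> i) i)"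
        unfolding A_def[abs_def] using V by (intro clinear_op_sum) (auto simp: l2_isometry_def)
      have "V (A N) i = (\<Sum>n<Suc N. a N n * (V ^^ Suc n) \<phi> i)"
        unfolding VA using V by (simp add: l2_isometry_def clinear_opD del: sum.lessThan_Suc)
      also have "\<dots> = (\<Sum>n<Suc N. cis x * b (Suc n) / of_nat (Suc N))"
      proof (intro sum.cong refl)
        fix n assume "n \<in> {..<Suc N}"
        moreover have "cis x * cis (- real (Suc n) * x) = cis (- real n * x)"
          unfolding cis_mult by (rule arg_cong[of _ _ cis]) (simp add: algebra_simps)
        ultimately show "a N n * (V ^^ Suc n) \<phi> i = cis x * b (Suc n) / of_nat (Suc N)"
          unfolding a_def b_def mult.assoc[symmetric] by (simp del: of_nat_Suc funpow.simps)
      qed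
      also have "\<dots> = cis x * ((\<Sum>n<Suc N. b n) + (\<Sum>n<Suc N. b (Suc n) - b n)) / of_nat (Suc N)"
        unfolding sum_subtractf by (simp add: sum_distrib_left sum_divide_distrib del: sum.lessThan_Suc of_nat_Suc)
      also have "(\<Sum>n<Suc N. b (Suc n) - b n) = b (Suc N) - b 0"
        by (rule sum_lessThan_telescope)
      also have "(\<Sum>n<Suc N. b n) = A N i * of_nat (Suc N)"
        unfolding A_def sum_distrib_right
        by (intro sum.cong refl) (auto simp: a_def b_def simp del: of_nat_Suc)
      finally show ?thesis by (simp add: distrib_left add_divide_distrib del: of_nat_Suc)
    qed
    have "(\<lambda>N. cis x * (b (Suc N) - b 0) / of_nat (Suc N)) \<longlonglongrightarrow> 0"
    proof (rule Lim_null_comparison)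
      show "\<forall>\<^sub>F N in sequentially. norm (cis x * (b (Suc N) - b 0) / of_nat (Suc N)) \<le> (2 * nrm \<phi>) / real (Suc N)"
      proof (intro always_eventually allI)
        fix N
        have bn: "cmod (b n) \<le> nrm \<phi>" for n
          using cmod_le_nrm[OF Vm(1)[of n], of i] by (simp add: b_def norm_mult Vm(2))
        have "cmod (b (Suc N) - b 0) \<le> 2 * nrm \<phi>"
          using norm_triangle_ineq4[of "b (Suc N)" "b 0"] bn[of "Suc N"] bn[of 0] by linarith
        then have "cmod (b (Suc N) - b 0) / real (Suc N) \<le> 2 * nrm \<phi> / real (Suc N)"
          by (rule divide_right_mono) simp
        then show "norm (cis x * (b (Suc N) - b 0) / of_nat (Suc N)) \<le> (2 * nrm \<phi>) / real (Suc N)"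
          by (simp only: norm_divide norm_mult norm_cis norm_of_nat mult_1)
      qed
      show "(\<lambda>N. (2 * nrm \<phi>) / real (Suc N)) \<longlonglongrightarrow> 0"
        by (rule LIMSEQ_Suc[OF lim_const_over_n])
    qed
    then have "(\<lambda>N. V (A N) i) \<longlonglongrightarrow> cis x * F i + 0"
      unfolding rel by (intro tendsto_intros F)
    moreover have "(\<lambda>N. V (A N) i) \<longlonglongrightarrow> V F i" by (intro local F)
    ultimately show "V F i = cis x * F i" by (simp add: LIMSEQ_unique)
  qed
  ultimately have "F = (\<lambda>i. 0)" by (intro no_ev[of "cis x"]) auto
  then have "(\<lambda>N. ip \<phi> (A N)) \<longlonglongrightarrow> 0"
    using F by (intro ip_tendsto_0_pointwise[OF \<phi> Ahl2 Anrm]) auto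
  moreover have "ip \<phi> (A N) = (LINT y|\<mu>. G N y)" for N
    unfolding A_def[abs_def] G_def by (rule spectral_meas_poly(1)[OF V \<phi> S])
  moreover have "(\<lambda>N. LINT y|\<mu>. G N y) \<longlonglongrightarrow> (LINT y|\<mu>. indicator {x} y)"
    by (rule integral_dominated_convergence[where w="\<lambda>_. 1"])
      (use supp Glim Gbound in \<open>auto elim: eventually_mono\<close>)
  ultimately have "(LINT y|\<mu>. indicator {x} y) = (0::complex)"
    using LIMSEQ_unique by fastforce
  moreover have "(LINT y|\<mu>. indicator {x} y) = complex_of_real (LINT y|\<mu>. indicator {x} y)"
    unfolding integral_complex_of_real[symmetric]
    by (intro Bochner_Integration.integral_cong) (auto simp: indicator_def)
  ultimately have "measure \<mu> {x} = 0"
    by (simp add: sets_eq_imp_space_eq[OF sets])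
  then show ?thesis by (simp add: emeasure_eq_measure)
qed

text \<open>\<open>P x / of_real (2*pi)\<close> is a partial Fourier sum of the indicator of
  \<open>N\<close>. Expanding the nonnegative integral of the squared distance between the two, with
  orthogonality over the full period, gives S \<le> 2 pi |N|.\<close>

lemma bessel_indicator:
  assumes N: "N \<in> sets borel" "N \<subseteq> {0..2*pi}"
  defines "c \<equiv> \<lambda>n::nat. LINT x|lborel. indicator N x *\<^sub>R cis (real n * x)"
  shows "(\<Sum>n<K. (cmod (c n))\<^sup>2) \<le> (2*pi)\<^sup>2"
proof -
  let ?L = "lborel :: real measure"
  have [measurable]: "N \<in> sets borel" by fact
  have Nfin: "emeasure ?L N \<le> ennreal (2*pi)"
    using emeasure_mono[OF N(2), of ?L] by simp
  have mN: "measure ?L N \<le> 2*pi"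
    using Nfin by (simp add: measure_def enn2real_leI)
  have Nlt: "emeasure ?L N < \<infinity>" using Nfin by (rule order.strict_trans1) simp
  have int: "integrable ?L (\<lambda>x. indicator N x *\<^sub>R cis (y * x))" for y
    by (rule integrableI_bounded_set[where A=N and B=1]) (use Nlt in \<open>auto simp: indicator_def\<close>)
  define S where "S = (\<Sum>n<K. (cmod (c n))\<^sup>2)"
  define P where "P x = (\<Sum>n<K. cnj (c n) * cis (real n * x))" for x
  have P2: "P x * cnj (P x) = (\<Sum>k<K. \<Sum>l<K. cnj (c k) * c l * cis (of_int (int k - int l) * x))" for x
    unfolding P_def cnj_sum complex_cnj_mult sum_product complex_cnj_cnj
    by (intro sum.cong refl) (simp add: cis_cnj cis_mult algebra_simps)
  have intP: "integrable ?L (\<lambda>x. indicator N x *\<^sub>R P x)"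
    and valP: "(LINT x|?L. indicator N x *\<^sub>R P x) = of_real S"
  proof -
    have eq: "indicator N x *\<^sub>R P x = (\<Sum>n<K. cnj (c n) * (indicator N x *\<^sub>R cis (real n * x)))" for x
      by (simp add: P_def scaleR_sum_right)
    show "integrable ?L (\<lambda>x. indicator N x *\<^sub>R P x)"
      unfolding eq by (intro Bochner_Integration.integrable_sum integrable_mult_right int)
    show "(LINT x|?L. indicator N x *\<^sub>R P x) = of_real S"
    proof -
      have "(LINT x|?L. indicator N x *\<^sub>R P x)
          = (\<Sum>n<K. LINT x|?L. cnj (c n) * (indicator N x *\<^sub>R cis (real n * x)))"
        unfolding eq by (intro Bochner_Integration.integral_sum integrable_mult_right int)
      also have "\<dots> = (\<Sum>n<K. cnj (c n) * c n)"
        unfolding integral_mult_right_zero c_def ..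
      finally show ?thesis by (simp only: S_def of_real_sum of_real_cmod_sq)
    qed
  qed
  have eq2: "indicator {0..2*pi} x *\<^sub>R (P x * cnj (P x))
     = (\<Sum>k<K. \<Sum>l<K. (cnj (c k) * c l) * (indicator {0..2*pi} x *\<^sub>R cis (of_int (int k - int l) * x)))" for x
    unfolding P2 by (simp add: scaleR_sum_right)
  have int2: "integrable ?L (\<lambda>x. indicator {0..2*pi} x *\<^sub>R (P x * cnj (P x)))"
    unfolding eq2 by (intro Bochner_Integration.integrable_sum integrable_mult_right integral_cis_period)
  have val2: "(LINT x|?L. indicator {0..2*pi} x *\<^sub>R (P x * cnj (P x))) = of_real (2*pi * S)"
  proof -
    have "(LINT x|?L. indicator {0..2*pi} x *\<^sub>R (P x * cnj (P x)))
        = (\<Sum>k<K. \<Sum>l<K. (cnj (c k) * c l) * (if int k - int l = 0 then of_real (2*pi) else 0))"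
      unfolding eq2
      by (subst Bochner_Integration.integral_sum, intro Bochner_Integration.integrable_sum integrable_mult_right integral_cis_period,
          intro sum.cong refl, subst Bochner_Integration.integral_sum, intro integrable_mult_right integral_cis_period,
          intro sum.cong refl, simp only: integral_mult_right_zero integral_cis_period)
    also have "\<dots> = (\<Sum>k<K. cnj (c k) * c k * of_real (2*pi))"
      by (simp add: if_distrib[of "\<lambda>z. _ * z"] cong: if_cong)
    also have "\<dots> = of_real (2*pi * S)"
      by (simp add: S_def of_real_cmod_sq[symmetric] sum_distrib_right[symmetric] del: of_real_power)
    finally show ?thesis .
  qed
  have "0 \<le> (LINT x|?L. indicator {0..2*pi} x * (cmod (indicator N x - P x / of_real (2*pi)))\<^sup>2)"
    by (intro integral_nonneg_AE) auto
  also have "\<dots> = (LINT x|?L. indicator N x - (1/pi) * Re (indicator N x *\<^sub>R P x)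
       + (1 / (2*pi)\<^sup>2) * Re (indicator {0..2*pi} x *\<^sub>R (P x * cnj (P x))))"
  proof (intro Bochner_Integration.integral_cong refl)
    fix x
    have "(cmod (1 - P x / of_real (2*pi)))\<^sup>2 = 1 - (1/pi) * Re (P x) + (1 / (2*pi)\<^sup>2) * (cmod (P x))\<^sup>2"
    proof -
      have "(cmod (1 - of_real a * z))\<^sup>2 = 1 - 2 * a * Re z + a\<^sup>2 * (cmod z)\<^sup>2" for a :: real and z
        unfolding cmod_power2 by (simp add: power2_eq_square algebra_simps)
      from this[of "1 / (2*pi)" "P x"] show ?thesis by (simp add: power_divide)
    qed
    moreover have "Re (P x * cnj (P x)) = (cmod (P x))\<^sup>2"
      unfolding cmod_power2 by (simp add: power2_eq_square)
    ultimately show "indicator {0..2*pi} x * (cmod (indicator N x - P x / of_real (2*pi)))\<^sup>2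
      = indicator N x - (1/pi) * Re (indicator N x *\<^sub>R P x)
       + (1 / (2*pi)\<^sup>2) * Re (indicator {0..2*pi} x *\<^sub>R (P x * cnj (P x)))"
      using N(2) by (auto simp: indicator_def norm_divide power_divide power_mult_distrib)
  qed
  also have "\<dots> = measure ?L N - (1/pi) * S + (1 / (2*pi)\<^sup>2) * (2*pi*S)"
  proof -
    have "integrable ?L (indicator N :: real \<Rightarrow> real)" "(LINT x|?L. indicator N x) = measure ?L N"
      using Nlt by auto
    then show ?thesis
      by (simp only: Bochner_Integration.integral_add Bochner_Integration.integral_diff
          Bochner_Integration.integrable_diff integrable_mult_right integral_mult_right_zero
          integrable_Re[OF intP] integrable_Re[OF int2] integral_Re[OF intP] integral_Re[OF int2]
          valP val2 Re_complex_of_real)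
  qed
  also have "\<dots> = measure ?L N - S / (2*pi)" by (simp add: field_simps power2_eq_square)
  finally have "S \<le> 2 * pi * measure ?L N" by (simp add: field_simps)
  also have "\<dots> \<le> (2*pi)\<^sup>2" using mN unfolding power2_eq_square by (intro mult_left_mono) auto
  finally show ?thesis by (simp add: S_def)
qed

lemma riemann_lebesgue_indicator:
  assumes N: "N \<in> sets borel" "N \<subseteq> {0..2*pi}"
  shows "(\<lambda>n::nat. LINT x|lborel. indicator N x *\<^sub>R cis (real n * x)) \<longlonglongrightarrow> 0"
proof -
  let ?c = "\<lambda>n::nat. LINT x|lborel. indicator N x *\<^sub>R cis (real n * x)"
  have "summable (\<lambda>n. (cmod (?c n))\<^sup>2)"
    by (rule summableI_nonneg_bounded[where x="(2*pi)\<^sup>2"]) (use bessel_indicator[OF N] in auto)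
  then have "(\<lambda>n. (cmod (?c n))\<^sup>2) \<longlonglongrightarrow> 0" by (rule summable_LIMSEQ_zero)
  then have "(\<lambda>n. sqrt ((cmod (?c n))\<^sup>2)) \<longlonglongrightarrow> sqrt 0" by (intro tendsto_intros)
  then show ?thesis by (simp add: tendsto_norm_zero_iff)
qed

text \<open>A subsequence of the trigonometric polynomials with coefficients \<open>d0\<close>, \<open>d1\<close>, \<open>d2\<close> tends to zero
  \<open>\<mu>\<close>-almost everywhere. On the set where it does, integrating against Lebesgue measure and applying
  the Riemann-Lebesgue lemma leaves only the constant coefficient, of modulus 1, times the measure of
  the set.\<close>

lemma spectral_meas_singular:
  fixes q :: "nat \<Rightarrow> nat" and d0 d1 d2 :: "nat \<Rightarrow> complex"
  assumes V: "l2_isometry V" and \<phi>: "\<phi> \<in> hl2" and S: "spectral_meas V \<phi> \<mu>"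
    and q: "filterlim q at_top sequentially" 
    and d: "\<And>k. cmod (d0 k) = 1" "\<And>k. cmod (d1 k) \<le> B" "\<And>k. cmod (d2 k) \<le> B"
    and lim: "(\<lambda>k. nrm (\<lambda>i. d0 k * \<phi> i + d1 k * (V ^^ q k) \<phi> i + d2 k * (V ^^ (2 * q k)) \<phi> i)) \<longlonglongrightarrow> 0"
  shows "\<exists>N \<in> null_sets lborel. emeasure \<mu> (- N) = 0"
proof -
  interpret finite_measure \<mu> using S by (simp add: spectral_meas_def)
  have sets [measurable_cong, simp]: "sets \<mu> = sets borel" using S by (simp add: spectral_meas_def)
  have supp: "AE y in \<mu>. y \<in> {0..<2*pi}"
    using S by (intro AE_I[where N="- {0..<2*pi}"]) (auto simp: spectral_meas_def)
  have B: "0 \<le> B" using d(2)[of 0] norm_ge_zero order_trans by blast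
  define p where "p k x = d0 k + d1 k * cis (real (q k) * x) + d2 k * cis (real (2 * q k) * x)" for k x
  have [measurable]: "p k \<in> borel_measurable borel" for k unfolding p_def by measurable
  have pB: "cmod (p k x) \<le> 1 + B + B" for k x
  proof -
    have "cmod (p k x) \<le> cmod (d0 k) + cmod (d1 k * cis (real (q k) * x)) + cmod (d2 k * cis (real (2 * q k) * x))"
      unfolding p_def using norm_triangle_ineq norm_triangle_mono by (meson order_refl)
    then show ?thesis using d[of k] by (simp add: norm_mult)
  qed
  have nrm2: "(nrm (\<lambda>i. d0 k * \<phi> i + d1 k * (V ^^ q k) \<phi> i + d2 k * (V ^^ (2 * q k)) \<phi> i))\<^sup>2
      = (LINT x|\<mu>. (cmod (p k x))\<^sup>2)" for k
  proof -
    \<comment> \<open>The three contributions are added rather than chosen by cases, because 0,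
      \<open>q k\<close> and \<open>2 * q k\<close> coincide when \<open>q k = 0\<close>.\<close>
    define a where "a n = (if n = 0 then d0 k else 0) + (if n = q k then d1 k else 0) + (if n = 2 * q k then d2 k else 0)" for n
    have sum_a: "(\<Sum>n<Suc (2 * q k). a n * f n) = d0 k * f 0 + d1 k * f (q k) + d2 k * f (2 * q k)" for f :: "nat \<Rightarrow> complex"
      unfolding a_def distrib_right sum.distrib
      by (simp add: if_distrib[of "\<lambda>z. z * _"] cong: if_cong del: sum.lessThan_Suc)
    have "(nrm (\<lambda>i. \<Sum>n<Suc (2 * q k). a n * (V ^^ n) \<phi> i))\<^sup>2
       = (LINT x|\<mu>. (cmod (\<Sum>n<Suc (2 * q k). a n * cis (real n * x)))\<^sup>2)"
      by (rule spectral_meas_poly(2)[OF V \<phi> S])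
    then show ?thesis unfolding sum_a p_def by simp
  qed
  have "(\<lambda>k. (LINT x|\<mu>. (cmod (p k x))\<^sup>2)) \<longlonglongrightarrow> 0\<^sup>2"
    unfolding nrm2[symmetric] by (intro tendsto_intros lim)
  then have lim2: "(\<lambda>k. (LINT x|\<mu>. norm ((cmod (p k x))\<^sup>2))) \<longlonglongrightarrow> 0" by simp
  have "integrable \<mu> (\<lambda>x. (cmod (p k x))\<^sup>2)" for k
    by (rule integrable_const_bound[where B="(1 + B + B)\<^sup>2"]) (use pB in \<open>auto intro!: power_mono\<close>)
  from tendsto_L1_AE_subseq[OF this lim2] obtain r where r: "strict_mono r"
    and ae: "AE x in \<mu>. (\<lambda>n. (cmod (p (r n) x))\<^sup>2) \<longlonglongrightarrow> 0" by auto
  define N where "N = {x \<in> {0..<2*pi}. (\<lambda>n. (cmod (p (r n) x))\<^sup>2) \<longlonglongrightarrow> 0}"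
  have Nb [measurable]: "N \<in> sets borel" unfolding N_def by measurable
  have Nsub: "N \<subseteq> {0..2*pi}" by (auto simp: N_def)
  have "AE x in \<mu>. x \<in> N" using ae supp by eventually_elim (simp add: N_def)
  then have "emeasure \<mu> (- N) = 0"
    by (subst (asm) AE_iff_measurable[of "- N"]) (auto simp: sets_eq_imp_space_eq[OF sets])
  moreover have "N \<in> null_sets lborel"
  proof -
    let ?L = "lborel :: real measure"
    have Nlt: "emeasure ?L N < \<infinity>"
      using emeasure_mono[OF Nsub, of ?L] by (simp add: order.strict_trans1)
    have int: "integrable ?L (\<lambda>x. indicator N x *\<^sub>R cis (y * x))" for y
      by (rule integrableI_bounded_set[where A=N and B=1]) (use Nlt in \<open>auto simp: indicator_def\<close>)
    define c where "c n = (LINT x|?L. indicator N x *\<^sub>R cis (real n * x))" for n :: nat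
    have c: "c \<longlonglongrightarrow> 0" unfolding c_def using riemann_lebesgue_indicator[OF Nb Nsub] .
    have "(\<lambda>n. LINT x|?L. indicator N x *\<^sub>R p (r n) x) \<longlonglongrightarrow> (LINT x|?L. 0)"
    proof (rule integral_dominated_convergence[where w="\<lambda>x. (1 + B + B) * indicator N x"])
      show "integrable ?L (\<lambda>x. (1 + B + B) * indicator N x)"
        using Nlt by (intro integrable_mult_right integrable_real_indicator) auto
      show "AE x in ?L. (\<lambda>n. indicator N x *\<^sub>R p (r n) x) \<longlonglongrightarrow> 0"
      proof (intro always_eventually allI)
        fix x
        show "(\<lambda>n. indicator N x *\<^sub>R p (r n) x) \<longlonglongrightarrow> 0"
        proof (cases "x \<in> N")
          case True
          then have "(\<lambda>n. sqrt ((cmod (p (r n) x))\<^sup>2)) \<longlonglongrightarrow> sqrt 0"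
            unfolding N_def by (intro tendsto_intros) auto
          then show ?thesis using True by (simp add: tendsto_norm_zero_iff)
        qed simp
      qed
      show "AE x in ?L. norm (indicator N x *\<^sub>R p (r n) x) \<le> (1 + B + B) * indicator N x" for n
        using pB by (auto simp: indicator_def)
    qed auto
    moreover have "(LINT x|?L. indicator N x *\<^sub>R p k x)
        = d0 k * of_real (measure ?L N) + d1 k * c (q k) + d2 k * c (2 * q k)" for k
    proof -
      have "indicator N x *\<^sub>R p k x = d0 k * (indicator N x *\<^sub>R cis (0 * x)) + d1 k * (indicator N x *\<^sub>R cis (real (q k) * x))
         + d2 k * (indicator N x *\<^sub>R cis (real (2 * q k) * x))" for x
        by (simp add: p_def scaleR_add_right)
      moreover have "(LINT x|?L. indicator N x *\<^sub>R cis (0 * x)) = of_real (measure ?L N)"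
        using Nlt by (simp add: scaleR_conv_of_real)
      ultimately show ?thesis
        by (simp only: Bochner_Integration.integral_add Bochner_Integration.integrable_add integrable_mult_right int
            integral_mult_right_zero c_def)
    qed
    ultimately have 1: "(\<lambda>n. d0 (r n) * of_real (measure ?L N) + d1 (r n) * c (q (r n)) + d2 (r n) * c (2 * q (r n))) \<longlonglongrightarrow> 0"
      by simp
    have qr: "filterlim (\<lambda>n. q (r n)) at_top sequentially"
      using q filterlim_subseq[OF r] by (rule filterlim_compose)
    have "filterlim (\<lambda>n. 2 * q (r n)) at_top sequentially"
      using qr by (rule filterlim_at_top_mono) (auto intro: always_eventually)
    then have c2: "(\<lambda>n. c (2 * q (r n))) \<longlonglongrightarrow> 0" by (rule filterlim_compose[OF c])
    have bd: "(\<lambda>n. d (r n) * e n) \<longlonglongrightarrow> 0" if "e \<longlonglongrightarrow> 0" "\<And>k. cmod (d k) \<le> B" for d e :: "nat \<Rightarrow> complex"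
    proof (rule Lim_null_comparison)
      show "\<forall>\<^sub>F n in sequentially. norm (d (r n) * e n) \<le> B * norm (e n)"
        using that(2) by (intro always_eventually allI) (simp add: norm_mult mult_right_mono)
      show "(\<lambda>n. B * norm (e n)) \<longlonglongrightarrow> 0"
        using tendsto_mult[OF tendsto_const tendsto_norm[OF that(1)]] by simp
    qed
    have "(\<lambda>n. d0 (r n) * of_real (measure ?L N)) \<longlonglongrightarrow> 0 - 0 - 0"
      using tendsto_diff[OF tendsto_diff[OF 1 bd[OF c2, of d2, OF d(3)]] bd[OF filterlim_compose[OF c qr], of d1, OF d(2)]]
      by (simp add: algebra_simps)
    then have "(\<lambda>n. norm (d0 (r n) * of_real (measure ?L N))) \<longlonglongrightarrow> 0"
      using tendsto_norm_zero by simp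
    then have "measure ?L N = 0" by (simp add: norm_mult d(1) LIMSEQ_const_iff)
    then show ?thesis using Nlt Nb
      by (auto simp: null_sets_def emeasure_eq_ennreal_measure)
  qed
  ultimately show ?thesis by blast
qed

section \<open>Transfer matrices over the ring of polynomials in the walk\<close>

text \<open>Evaluation of a polynomial at an operator. For linear \<open>W\<close> it turns
  functions into a module over the commutative ring \<open>complex poly\<close>, so determinants and
  adjugates over that ring can be applied to vectors.\<close>

definition papply :: "(('i \<Rightarrow> complex) \<Rightarrow> ('i \<Rightarrow> complex)) \<Rightarrow> complex poly \<Rightarrow> ('i \<Rightarrow> complex) \<Rightarrow> 'i \<Rightarrow> complex" where
  "papply W p v = (\<lambda>i. \<Sum>n\<le>degree p. coeff p n * (W ^^ n) v i)"

lemma papply_bound: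
  assumes "degree p \<le> N"
  shows "papply W p v i = (\<Sum>n\<le>N. coeff p n * (W ^^ n) v i)"
  unfolding papply_def using assms
  by (intro sum.mono_neutral_left) (auto simp: coeff_eq_0)

lemma papply_0 [simp]: "papply W 0 v = (\<lambda>i. 0)"
  by (simp add: papply_def)

lemma papply_add: "papply W (p + q) v = (\<lambda>i. papply W p v i + papply W q v i)"
proof
  fix i
  let ?N = "max (degree p) (degree q)"
  show "papply W (p + q) v i = papply W p v i + papply W q v i"
    using degree_add_le_max[of p q]
    by (simp add: papply_bound[of _ ?N] distrib_right sum.distrib)
qed

lemma papply_smult: "papply W (smult c p) v = (\<lambda>i. c * papply W p v i)"
proof
  fix i show "papply W (smult c p) v i = c * papply W p v i"
    using degree_smult_le[of c p]
    by (simp add: papply_bound[of _ "degree p"] sum_distrib_left mult.assoc)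
qed

lemma papply_diff: "papply W (p - q) v = (\<lambda>i. papply W p v i - papply W q v i)"
  using papply_add[of W p "- q" v] papply_smult[of W "-1" q v] by simp

lemma papply_pCons:
  assumes "clinear_op W"
  shows "papply W (pCons c p) v = (\<lambda>i. c * v i + W (papply W p v) i)"
proof
  fix i
  have "papply W (pCons c p) v i = (\<Sum>n\<le>Suc (degree p). coeff (pCons c p) n * (W ^^ n) v i)"
    by (rule papply_bound) (simp add: degree_pCons_le)
  also have "\<dots> = c * v i + (\<Sum>n\<le>degree p. coeff p n * W ((W ^^ n) v) i)"
    by (subst sum.atMost_Suc_shift) simp
  also have "(\<Sum>n\<le>degree p. coeff p n * W ((W ^^ n) v) i) = W (papply W p v) i"
    unfolding papply_def by (subst clinear_op_sum[OF assms]) (simp_all add: clinear_opD[OF assms])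
  finally show "papply W (pCons c p) v i = c * v i + W (papply W p v) i" .
qed

lemma papply_lin:
  assumes "clinear_op W"
  shows "clinear_op (papply W p)"
  unfolding clinear_op_def papply_def
  by (simp add: clinear_opD[OF clinear_op_funpow[OF assms]] distrib_left sum.distrib sum_distrib_left mult.left_commute)

lemma papply_mult:
  assumes "clinear_op W"
  shows "papply W (p * q) v = papply W p (papply W q v)"
proof (induction p)
  case (pCons c p)
  then show ?case
    by (simp add: papply_add papply_smult papply_pCons[OF assms])
qed simp

lemma papply_monom:
  assumes "clinear_op W"
  shows "papply W (monom c n) v = (\<lambda>i. c * (W ^^ n) v i)"
proof (induction n)
  case 0
  show ?case by (simp add: papply_pCons[OF assms] monom_0 clinear_opD[OF assms])
next
  case (Suc n)
  then show ?case by (simp add: papply_pCons[OF assms] monom_Suc clinear_opD[OF assms])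
qed

lemma papply_const: "clinear_op W \<Longrightarrow> papply W [:c:] v = (\<lambda>i. c * v i)"
  by (simp add: papply_pCons clinear_opD)

text \<open>The walk \<open>W\<close> is the square root of the network model: it maps the amplitudes \<open>f (True, j)\<close> (moving right)
  and \<open>f (False, j + 1)\<close> (moving left), which enter the scatterer at bond \<open>j\<close>, to the outgoing amplitudes at
  \<open>(False, j)\<close> and \<open>(True, j + 1)\<close>. On vectors supported where the flag agrees with the parity of the site,
  its square is \<open>U\<^sub>o U\<^sub>e\<close>.\<close>

locale scattering =
  fixes r t a :: real and g :: "int \<Rightarrow> real"
  assumes rt: "r\<^sup>2 + t\<^sup>2 = 1" and t_pos: "0 < t" and r_pos: "0 < r"
begin

lemma rt_complex: "of_real r * of_real r + of_real t * of_real t = (1::complex)"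
  using arg_cong[OF rt, of complex_of_real] by (simp add: power2_eq_square)

definition walk :: "(int \<Rightarrow> complex) \<Rightarrow> (bool \<times> int \<Rightarrow> complex) \<Rightarrow> bool \<times> int \<Rightarrow> complex" where
  "walk u f = (\<lambda>(s, j).
     if s then u (j - 1) * (\<i> * of_real t * cis (- g (j - 1)) * f (True, j - 1) + of_real r * cis a * f (False, j))
     else u j * (of_real r * cis (- a) * f (True, j) + \<i> * of_real t * cis (g j) * f (False, j + 1)))"

lemma walk_clinear: "clinear_op (walk u)"
  by (auto simp: clinear_op_def walk_def fun_eq_iff algebra_simps)

text \<open>Bond form: the column with entries \<open>f (True, j)\<close> and
  \<open>f (False, j + 1)\<close> is multiplied by the scattering matrix of bond \<open>j\<close>,
  with \<open>u j\<close> as its scalar phase. Row 1 lands at (False, j), row 2 at (True, j +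
  1).\<close>

lemma walk_scatter:
  "walk u f (True, j + 1) = u j * (\<i> * of_real t * cis (- g j) * f (True, j) + of_real r * cis a * f (False, j + 1))"
  "walk u f (False, j) = u j * (of_real r * cis (- a) * f (True, j) + \<i> * of_real t * cis (g j) * f (False, j + 1))"
  by (simp_all add: walk_def)

text \<open>Once the nonzero factor \<open>u j\<close> is dropped, each block is inverted by its
  adjoint. Injectivity therefore holds on all functions, and powers of the walk can be cancelled
  from identities between them.\<close>

lemma walk_inj0:
  assumes u: "\<And>j. u j \<noteq> 0" and z: "walk u f = (\<lambda>i. 0)"
  shows "f = (\<lambda>i. 0)"
proof -
  have *: "f (True, j) = 0 \<and> f (False, j + 1) = 0" for j
  proof -
    let ?x = "f (True, j)" and ?y = "f (False, j + 1)"
    have 1: "\<i> * of_real t * cis (- g j) * ?x + of_real r * cis a * ?y = 0"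
      using fun_cong[OF z, of "(True, j + 1)"] u[of j] unfolding walk_scatter by simp
    have 2: "of_real r * cis (- a) * ?x + \<i> * of_real t * cis (g j) * ?y = 0"
      using fun_cong[OF z, of "(False, j)"] u[of j] unfolding walk_scatter by simp
    have c: "cis a * cis (- a) = 1" "cis (g j) * cis (- g j) = 1" by (simp_all add: cis_mult)
    have x: "?x = of_real r * cis a * (of_real r * cis (- a) * ?x + \<i> * of_real t * cis (g j) * ?y)
       - \<i> * of_real t * cis (g j) * (\<i> * of_real t * cis (- g j) * ?x + of_real r * cis a * ?y)"
      using rt_complex c i_squared by algebra
    have y: "?y = of_real r * cis (- a) * (\<i> * of_real t * cis (- g j) * ?x + of_real r * cis a * ?y)
       - \<i> * of_real t * cis (- g j) * (of_real r * cis (- a) * ?x + \<i> * of_real t * cis (g j) * ?y)"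
      using rt_complex c i_squared by algebra
    show ?thesis by (subst x, subst y) (simp only: 1 2, simp)
  qed
  show ?thesis
  proof
    fix i :: "bool \<times> int"
    obtain s j where "i = (s, j)" by (cases i)
    then show "f i = 0" using *[of j] *[of "j - 1"] by (cases s) auto
  qed
qed

lemma walk_inj:
  assumes u: "\<And>j. u j \<noteq> 0" and eq: "(walk u ^^ n) f = (walk u ^^ n) h"
  shows "f = h"
  using eq
proof (induction n)
  case (Suc n)
  have "walk u (\<lambda>i. (walk u ^^ n) f i - (walk u ^^ n) h i) = (\<lambda>i. 0)"
    using Suc.prems by (simp add: clinear_opD[OF walk_clinear])
  then have "(\<lambda>i. (walk u ^^ n) f i - (walk u ^^ n) h i) = (\<lambda>i. 0)"
    by (rule walk_inj0[OF u])
  then have "(walk u ^^ n) f = (walk u ^^ n) h" by (simp add: fun_eq_iff)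
  then show ?case by (rule Suc.IH)
qed simp

lemma walk_basis:
  "walk u (basis (True, j)) = (\<lambda>i. u j * (of_real r * cis (- a)) * basis (False, j) i
      + u j * (\<i> * of_real t * cis (- g j)) * basis (True, j + 1) i)"
  "walk u (basis (False, j + 1)) = (\<lambda>i. u j * (\<i> * of_real t * cis (g j)) * basis (False, j) i
      + u j * (of_real r * cis a) * basis (True, j + 1) i)"
  by (auto simp: walk_def basis_def fun_eq_iff)

text \<open>Solving the action of \<open>W\<close> on two neighbouring basis vectors for the next pair expresses the pair at
  \<open>j + 1\<close> through the pair at \<open>j\<close>; the entries are polynomials in \<open>W\<close> itself after multiplication by
  \<open>\<i> t W\<close>.\<close>

definition transfer_matrix :: "(int \<Rightarrow> complex) \<Rightarrow> int \<Rightarrow> complex poly ^ 2 ^ 2" where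
  "transfer_matrix u j = vector [vector [[:0, 0, cnj (u j):], [:0, - (of_real r * cis (- a)):]],
                    vector [[:0, of_real r * cis a:], [:- u j:]]]"

lemma transfer_matrix_entries:
  "transfer_matrix u j $ 1 $ 1 = [:0, 0, cnj (u j):]" "transfer_matrix u j $ 1 $ 2 = [:0, - (of_real r * cis (- a)):]"
  "transfer_matrix u j $ 2 $ 1 = [:0, of_real r * cis a:]" "transfer_matrix u j $ 2 $ 2 = [:- u j:]"
  by (simp_all add: transfer_matrix_def vector_2)

text \<open>First identity: apply \<open>W\<close> once more to the formula for
  \<open>W (basis (True, j))\<close> and solve for the term at j + 1; as |u j| = 1, division by
  \<open>u j\<close> is multiplication by its conjugate. Second: eliminate
  \<open>basis (True, j + 1)\<close> between the two formulas of \<open>walk_basis\<close>; r^2 +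
  t^2 = 1 leaves the coefficient \<open>- u j\<close>.\<close>

lemma transfer_step:
  assumes u: "cmod (u j) = 1"
  defines "W \<equiv> walk u"
  shows "(\<lambda>i. \<i> * of_real t * W (basis (True, j + 1)) i) = (\<lambda>i. cis (g j) *
      (papply W (transfer_matrix u j $ 1 $ 1) (basis (True, j)) i + papply W (transfer_matrix u j $ 1 $ 2) (basis (False, j)) i))"
    and "(\<lambda>i. \<i> * of_real t * W (basis (False, j + 1)) i) = (\<lambda>i. cis (g j) *
      (papply W (transfer_matrix u j $ 2 $ 1) (basis (True, j)) i + papply W (transfer_matrix u j $ 2 $ 2) (basis (False, j)) i))"
proof -
  note lin = clinear_opD[OF walk_clinear, of u, folded W_def]
  have c: "cis a * cis (- a) = 1" "cis (g j) * cis (- g j) = 1" by (simp_all add: cis_mult)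
  have uu: "cnj (u j) * u j = 1"
    using of_real_cmod_sq[of "u j"] u by simp
  have p: "papply W (transfer_matrix u j $ 1 $ 1) v = (\<lambda>i. cnj (u j) * W (W v) i)"
    "papply W (transfer_matrix u j $ 1 $ 2) v = (\<lambda>i. - (of_real r * cis (- a)) * W v i)"
    "papply W (transfer_matrix u j $ 2 $ 1) v = (\<lambda>i. of_real r * cis a * W v i)"
    "papply W (transfer_matrix u j $ 2 $ 2) v = (\<lambda>i. - u j * v i)" for v
    unfolding W_def transfer_matrix_entries
    by (simp_all only: papply_pCons[OF walk_clinear] papply_0 clinear_opD[OF walk_clinear]) simp_all
  note WT = walk_basis(1)[of u j, folded W_def] and WF = walk_basis(2)[of u j, folded W_def]
  show "(\<lambda>i. \<i> * of_real t * W (basis (True, j + 1)) i) = (\<lambda>i. cis (g j) *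
      (papply W (transfer_matrix u j $ 1 $ 1) (basis (True, j)) i + papply W (transfer_matrix u j $ 1 $ 2) (basis (False, j)) i))"
  proof
    fix i
    have "W (W (basis (True, j))) i = u j * (of_real r * cis (- a)) * W (basis (False, j)) i
      + u j * (\<i> * of_real t * cis (- g j)) * W (basis (True, j + 1)) i"
      unfolding WT by (simp add: lin)
    then show "\<i> * of_real t * W (basis (True, j + 1)) i = cis (g j) *
      (papply W (transfer_matrix u j $ 1 $ 1) (basis (True, j)) i + papply W (transfer_matrix u j $ 1 $ 2) (basis (False, j)) i)"
      unfolding p using c uu by algebra
  qed
  show "(\<lambda>i. \<i> * of_real t * W (basis (False, j + 1)) i) = (\<lambda>i. cis (g j) *
      (papply W (transfer_matrix u j $ 2 $ 1) (basis (True, j)) i + papply W (transfer_matrix u j $ 2 $ 2) (basis (False, j)) i))"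
  proof
    fix i
    show "\<i> * of_real t * W (basis (False, j + 1)) i = cis (g j) *
      (papply W (transfer_matrix u j $ 2 $ 1) (basis (True, j)) i + papply W (transfer_matrix u j $ 2 $ 2) (basis (False, j)) i)"
      unfolding p WT WF using c rt_complex i_squared by algebra
  qed
qed

primrec transfer_product :: "(int \<Rightarrow> complex) \<Rightarrow> int \<Rightarrow> nat \<Rightarrow> complex poly ^ 2 ^ 2" where
  "transfer_product u j 0 = mat 1"
| "transfer_product u j (Suc n) = transfer_matrix u (j + int n) ** transfer_product u j n"

lemma mat2_mult:
  fixes A B :: "'a::comm_ring_1 ^ 2 ^ 2"
  shows "(A ** B) $ i $ k = A $ i $ 1 * B $ 1 $ k + A $ i $ 2 * B $ 2 $ k"
  by (simp add: matrix_matrix_mult_def sum_2)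

text \<open>Each step contributes the scalar phase \<open>cis (g k)\<close>, collected in
  \<open>ph\<close>; the transfer matrices themselves are free of \<open>g\<close>. This is why the
  sequence \<gamma> may be arbitrary.\<close>

lemma transfer_forward:
  assumes u: "\<And>j. cmod (u j) = 1"
  defines "W \<equiv> walk u"
  shows "\<exists>ph. cmod ph = 1 \<and>
    (\<forall>i. (\<i> * of_real t) ^ n * (W ^^ n) (basis (True, j + int n)) i = ph *
      (papply W (transfer_product u j n $ 1 $ 1) (basis (True, j)) i + papply W (transfer_product u j n $ 1 $ 2) (basis (False, j)) i)) \<and>
    (\<forall>i. (\<i> * of_real t) ^ n * (W ^^ n) (basis (False, j + int n)) i = ph *
      (papply W (transfer_product u j n $ 2 $ 1) (basis (True, j)) i + papply W (transfer_product u j n $ 2 $ 2) (basis (False, j)) i))"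
proof (induction n)
  case 0
  have "clinear_op W" by (simp add: W_def walk_clinear)
  then have "papply W 1 v = v" for v using papply_const[of W 1 v] by (simp add: one_pCons)
  then show ?case by (intro exI[of _ 1]) (simp add: mat_def)
next
  case (Suc n)
  have L: "clinear_op W" by (simp add: W_def walk_clinear)
  define k where "k = j + int n"
  let ?c = "\<i> * of_real t" and ?P = "transfer_product u j n"
  obtain ph where ph: "cmod ph = 1"
    and T: "\<And>i. ?c ^ n * (W ^^ n) (basis (True, k)) i = ph *
      (papply W (?P $ 1 $ 1) (basis (True, j)) i + papply W (?P $ 1 $ 2) (basis (False, j)) i)"
    and F: "\<And>i. ?c ^ n * (W ^^ n) (basis (False, k)) i = ph *
      (papply W (?P $ 2 $ 1) (basis (True, j)) i + papply W (?P $ 2 $ 2) (basis (False, j)) i)"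
    using Suc.IH unfolding k_def by blast
  have pw: "(W ^^ m) (papply W p v) = papply W p ((W ^^ m) v)" for m p v
    using papply_mult[OF L, of "monom 1 m" p v] papply_mult[OF L, of p "monom 1 m" v]
    by (simp add: mult.commute papply_monom[OF L])
  have key: "?c ^ Suc n * (W ^^ Suc n) x i = (cis (g k) * ph) *
      (papply W (p1 * ?P $ 1 $ 1 + p2 * ?P $ 2 $ 1) (basis (True, j)) i
       + papply W (p1 * ?P $ 1 $ 2 + p2 * ?P $ 2 $ 2) (basis (False, j)) i)"
    if st: "(\<lambda>i. ?c * W x i) = (\<lambda>i. cis (g k) * (papply W p1 (basis (True, k)) i + papply W p2 (basis (False, k)) i))"
    for x p1 p2 i
  proof -
    note Ln = clinear_opD[OF clinear_op_funpow[OF L]] and Lp = clinear_opD[OF papply_lin[OF L]]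
    have "(\<lambda>i. ?c ^ Suc n * (W ^^ Suc n) x i) = (\<lambda>i. ?c ^ n * (W ^^ n) (\<lambda>i. ?c * W x i) i)"
      by (simp add: Ln funpow_swap1 mult.assoc mult.left_commute)
    also have "\<dots> = (\<lambda>i. cis (g k) * (papply W p1 (\<lambda>i. ?c ^ n * (W ^^ n) (basis (True, k)) i) i
        + papply W p2 (\<lambda>i. ?c ^ n * (W ^^ n) (basis (False, k)) i) i))"
      unfolding st by (simp add: Ln pw Lp distrib_left mult.left_commute)
    also have "\<dots> = (\<lambda>i. (cis (g k) * ph) *
      (papply W (p1 * ?P $ 1 $ 1 + p2 * ?P $ 2 $ 1) (basis (True, j)) i
       + papply W (p1 * ?P $ 1 $ 2 + p2 * ?P $ 2 $ 2) (basis (False, j)) i))"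
      unfolding T F by (simp add: Lp papply_add papply_mult[OF L] algebra_simps)
    finally show ?thesis by (rule fun_cong)
  qed
  have Sk: "j + int (Suc n) = k + 1" by (simp add: k_def)
  show ?case
  proof (intro exI[of _ "cis (g k) * ph"] conjI allI)
    show "cmod (cis (g k) * ph) = 1" using ph by (simp add: norm_mult)
  qed (unfold Sk transfer_product.simps mat2_mult k_def[symmetric],
      (rule key, rule transfer_step[of u, folded W_def], rule u)+)
qed


lemma transfer_product_entries_Suc:
  "transfer_product u j (Suc n) $ 1 $ k = pCons 0 (pCons 0 (smult (cnj (u (j + int n))) (transfer_product u j n $ 1 $ k)))
     - pCons 0 (smult (of_real r * cis (- a)) (transfer_product u j n $ 2 $ k))"
  "transfer_product u j (Suc n) $ 2 $ k = pCons 0 (smult (of_real r * cis a) (transfer_product u j n $ 1 $ k))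
     - smult (u (j + int n)) (transfer_product u j n $ 2 $ k)"
  by (simp_all add: mat2_mult transfer_matrix_entries)

lemma coeff_pCons_0: "coeff (pCons 0 p) n = (if n = 0 then 0 else coeff p (n - 1))"
  by (cases n) auto

text \<open>Staying in row 1 costs x^2, staying in row 2 costs nothing, and each change of row costs
  one x. So x^(2n) arises only by always staying in row 1 and x^0 on the diagonal only by always
  staying in row 2, with products of phases as coefficients. The claims are coupled by the recursion
  and proved together.\<close>

lemma transfer_product_coeffs:
  shows "k > 2 * n \<Longrightarrow> coeff (transfer_product u j n $ 1 $ 1) k = 0"
    and "k \<ge> 2 * n \<Longrightarrow> coeff (transfer_product u j n $ 2 $ 1) k = 0"
    and "k \<ge> 2 * n \<Longrightarrow> coeff (transfer_product u j n $ 1 $ 2) k = 0"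
    and "k \<ge> 2 * n \<Longrightarrow> k > 0 \<Longrightarrow> coeff (transfer_product u j n $ 2 $ 2) k = 0"
    and "coeff (transfer_product u j n $ 1 $ 1) (2 * n) = (\<Prod>i<n. cnj (u (j + int i)))"
    and "coeff (transfer_product u j n $ 2 $ 2) 0 = (\<Prod>i<n. - u (j + int i))"
    and "n > 0 \<Longrightarrow> coeff (transfer_product u j n $ 1 $ 1) 0 = 0"
proof (induction n arbitrary: k)
  case 0
  { case 1 then show ?case by (simp add: mat_def) }
  { case 2 then show ?case by (simp add: mat_def) }
  { case 3 then show ?case by (simp add: mat_def) }
  { case 4 then show ?case by (simp add: mat_def) }
  { case 5 then show ?case by (simp add: mat_def) }
  { case 6 then show ?case by (simp add: mat_def) }
  { case 7 then show ?case by simp }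
next
  case (Suc n)
  note IH = Suc
  { case 1 then show ?case using IH(1)[of "k - Suc (Suc 0)"] IH(2)[of "k - 1"]
      unfolding transfer_product_entries_Suc by (simp add: coeff_pCons_0) }
  { case 2 then show ?case using IH(1)[of "k - 1"] IH(2)[of k]
      unfolding transfer_product_entries_Suc by (simp add: coeff_pCons_0) }
  { case 3 then show ?case using IH(3)[of "k - Suc (Suc 0)"] IH(4)[of "k - 1"]
      unfolding transfer_product_entries_Suc by (simp add: coeff_pCons_0) }
  { case 4 then show ?case using IH(3)[of "k - 1"] IH(4)[of k]
      unfolding transfer_product_entries_Suc by (simp add: coeff_pCons_0) }
  { case 5 then show ?case using IH(5) IH(2)[of "Suc (2 * n)"]
      unfolding transfer_product_entries_Suc by (simp add: coeff_pCons_0 mult.commute) }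
  { case 6 then show ?case using IH(6)
      unfolding transfer_product_entries_Suc by (simp add: coeff_pCons_0 mult.commute) }
  { case 7 then show ?case
      unfolding transfer_product_entries_Suc by (simp add: coeff_pCons_0) }
qed

text \<open>One transfer matrix has determinant (r^2 - 1) x^2 = (i t x)^2. Thus the adjugate over a
  period inverts it up to the square of the factor (i t W)^q that \<open>transfer_forward\<close>
  carries.\<close>

lemma det_transfer_product:
  assumes u: "\<And>j. cmod (u j) = 1"
  shows "det (transfer_product u j n) = monom ((\<i> * of_real t) ^ (2 * n)) (2 * n)"
proof (induction n)
  case 0
  show ?case by simp
next
  case (Suc n)
  have uu: "cnj (u k) * u k = 1" for k
    using of_real_cmod_sq[of "u k"] u by simp
  have c: "cis a * cis (- a) = 1" by (simp add: cis_mult)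
  have "of_real r * cis (- a) * (of_real r * cis a) - cnj (u k) * u k = (\<i> * of_real t)\<^sup>2" for k
    using rt_complex c uu[of k] i_squared by algebra
  then have "det (transfer_matrix u k) = monom ((\<i> * of_real t)\<^sup>2) 2" for k
    by (simp add: det_2 transfer_matrix_entries monom_altdef power2_eq_square algebra_simps)
  then show ?case
    using Suc by (simp add: det_mul mult_monom power_mult_distrib power_add[symmetric] algebra_simps del: power_mult_distrib)
qed

text \<open>Cayley-Hamilton for the transfer matrix over one period, \<open>P + adj P = tr P\<close>: the first summand moves a basis
  vector one period forward, the second one period backward.\<close>

lemma transfer_two_sided:
  assumes u: "\<And>j. cmod (u j) = 1" and per: "\<And>j. u (j + int q) = u j"
  defines "W \<equiv> walk u"
  shows "\<exists>g1 g2. cmod g1 = 1 \<and> cmod g2 = 1 \<and>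
    (\<forall>i. papply W (trace (transfer_product u j q)) (basis (s, j)) i =
      (\<i> * of_real t) ^ q * (W ^^ q) (\<lambda>i. g1 * basis (s, j + int q) i + g2 * basis (s, j - int q) i) i)"
proof -
  have L: "clinear_op W" by (simp add: W_def walk_clinear)
  note Ln = clinear_opD[OF clinear_op_funpow[OF L]] and Lp = clinear_opD[OF papply_lin[OF L]]
  let ?c = "(\<i> * of_real t) ^ q" and ?P = "transfer_product u j q"
  let ?A = "?P $ 1 $ 1" and ?B = "?P $ 1 $ 2" and ?C = "?P $ 2 $ 1" and ?D = "?P $ 2 $ 2"
  have c0: "?c \<noteq> 0" using t_pos by simp
  have per': "transfer_product u (j - int q) n = transfer_product u j n" for n
  proof (induction n)
    case (Suc n)
    have "u (j - int q + int n) = u (j + int n)" using per[of "j - int q + int n"] by (simp add: algebra_simps)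
    then show ?case using Suc by (simp add: transfer_matrix_def)
  qed simp
  obtain ph where ph: "cmod ph = 1"
    and T: "\<And>i. ?c * (W ^^ q) (basis (True, j + int q)) i = ph *
      (papply W ?A (basis (True, j)) i + papply W ?B (basis (False, j)) i)"
    and F: "\<And>i. ?c * (W ^^ q) (basis (False, j + int q)) i = ph *
      (papply W ?C (basis (True, j)) i + papply W ?D (basis (False, j)) i)"
    using transfer_forward[of u, OF u, where n=q and j=j] unfolding W_def by blast
  obtain ph' where ph': "cmod ph' = 1"
    and T': "(\<lambda>i. ?c * (W ^^ q) (basis (True, j)) i) = (\<lambda>i. ph' *
      (papply W ?A (basis (True, j - int q)) i + papply W ?B (basis (False, j - int q)) i))"
    and F': "(\<lambda>i. ?c * (W ^^ q) (basis (False, j)) i) = (\<lambda>i. ph' *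
      (papply W ?C (basis (True, j - int q)) i + papply W ?D (basis (False, j - int q)) i))"
    using transfer_forward[of u, OF u, where n=q and j="j - int q"] unfolding per' W_def fun_eq_iff by auto
  have pw: "papply W p ((W ^^ m) v) = (W ^^ m) (papply W p v)" for m p v
    using papply_mult[OF L, of "monom 1 m" p v] papply_mult[OF L, of p "monom 1 m" v]
    by (simp add: mult.commute papply_monom[OF L])
  have det: "papply W (?A * ?D - ?B * ?C) v i = ?c * (?c * (W ^^ q) ((W ^^ q) v) i)" for v i
  proof -
    have "?A * ?D - ?B * ?C = monom (?c * ?c) (q + q)"
      using det_transfer_product[of u, OF u, of j q] by (simp add: det_2 mult_2 power_add)
    then show ?thesis by (simp add: papply_monom[OF L] funpow_add)
  qed
  have inj: "x = y" if "(\<lambda>i. ?c * (W ^^ q) x i) = (\<lambda>i. ?c * (W ^^ q) y i)" for x y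
  proof (rule walk_inj[where u=u and n=q])
    show "u j \<noteq> 0" for j using u[of j] by auto
    show "(walk u ^^ q) x = (walk u ^^ q) y"
      using that c0 unfolding fun_eq_iff W_def mult_cancel_left by blast
  qed
  have comm: "papply W p1 (papply W p2 v) = papply W (p1 * p2) v" for p1 p2 v
    by (simp add: papply_mult[OF L])
  \<comment> \<open>\<open>T'\<close> and \<open>F'\<close> express the pair at \<open>j\<close>
    through the pair at \<open>j - int q\<close> by the same matrix. The adjugate row (D, -B)
    applied to them produces the determinant, that is the factor (i t W)^q twice; \<open>inj\<close>
    cancels one copy.\<close>
  have backT: "(\<lambda>i. papply W ?D (basis (True, j)) i - papply W ?B (basis (False, j)) i)
      = (\<lambda>i. ph' * (?c * (W ^^ q) (basis (True, j - int q)) i))"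
  proof (rule inj)
    have "(\<lambda>i. ?c * (W ^^ q) (\<lambda>i. papply W ?D (basis (True, j)) i - papply W ?B (basis (False, j)) i) i)
      = (\<lambda>i. papply W ?D (\<lambda>i. ?c * (W ^^ q) (basis (True, j)) i) i - papply W ?B (\<lambda>i. ?c * (W ^^ q) (basis (False, j)) i) i)"
      by (simp add: Ln Lp pw right_diff_distrib)
    also have "\<dots> = (\<lambda>i. ph' * (papply W (?A * ?D - ?B * ?C) (basis (True, j - int q)) i))"
      unfolding T' F' by (simp add: Lp comm papply_diff algebra_simps)
    also have "\<dots> = (\<lambda>i. ?c * (W ^^ q) (\<lambda>i. ph' * (?c * (W ^^ q) (basis (True, j - int q)) i)) i)"
      unfolding det by (simp add: Ln mult.left_commute)
    finally show "(\<lambda>i. ?c * (W ^^ q) (\<lambda>i. papply W ?D (basis (True, j)) i - papply W ?B (basis (False, j)) i) i) = \<dots>" .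
  qed
  have backF: "(\<lambda>i. papply W ?A (basis (False, j)) i - papply W ?C (basis (True, j)) i)
      = (\<lambda>i. ph' * (?c * (W ^^ q) (basis (False, j - int q)) i))"
  proof (rule inj)
    have "(\<lambda>i. ?c * (W ^^ q) (\<lambda>i. papply W ?A (basis (False, j)) i - papply W ?C (basis (True, j)) i) i)
      = (\<lambda>i. papply W ?A (\<lambda>i. ?c * (W ^^ q) (basis (False, j)) i) i - papply W ?C (\<lambda>i. ?c * (W ^^ q) (basis (True, j)) i) i)"
      by (simp add: Ln Lp pw right_diff_distrib)
    also have "\<dots> = (\<lambda>i. ph' * (papply W (?A * ?D - ?B * ?C) (basis (False, j - int q)) i))"
      unfolding T' F' by (simp add: Lp comm papply_diff algebra_simps)
    also have "\<dots> = (\<lambda>i. ?c * (W ^^ q) (\<lambda>i. ph' * (?c * (W ^^ q) (basis (False, j - int q)) i)) i)"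
      unfolding det by (simp add: Ln mult.left_commute)
    finally show "(\<lambda>i. ?c * (W ^^ q) (\<lambda>i. papply W ?A (basis (False, j)) i - papply W ?C (basis (True, j)) i) i) = \<dots>" .
  qed
  have cn: "cnj ph * ph = 1" using of_real_cmod_sq[of ph] ph by simp
  \<comment> \<open>The forward formula gives \<open>x1 + x2\<close>, a diagonal plus an
    off-diagonal term, and the backward one \<open>x4 - x2\<close>; the off-diagonal term cancels
    and the trace remains.\<close>
  have alg: "x1 + x4 = c * (cp * w + p' * w')"
    if "c * w = p * (x1 + x2)" "x4 - x2 = p' * (c * w')" "cp * p = 1" for x1 x2 x4 c cp p p' w w' :: complex
    using that by algebra
  have tr: "trace ?P = ?A + ?D" by (simp add: trace_def sum_2)
  show ?thesis
  proof (rule exI[of _ "cnj ph"], rule exI[of _ ph'], intro conjI allI)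
    fix i
    show "papply W (trace ?P) (basis (s, j)) i =
      ?c * (W ^^ q) (\<lambda>i. cnj ph * basis (s, j + int q) i + ph' * basis (s, j - int q) i) i"
    proof (cases s)
      case True
      show ?thesis using alg[OF T[of i] fun_cong[OF backT, of i] cn] True
        by (simp add: tr papply_add Ln)
    next
      case False
      have "?c * (W ^^ q) (basis (False, j + int q)) i = ph *
          (papply W ?D (basis (False, j)) i + papply W ?C (basis (True, j)) i)"
        using F[of i] by (simp add: add.commute)
      from alg[OF this fun_cong[OF backF, of i] cn] show ?thesis using False
        by (simp add: tr papply_add Ln add.commute)
    qed
  qed (use ph ph' in auto)
qed

end

section \<open>Isometry of the walk and the form of the trace over one period\<close>

lemma summable_bool_prod:
  fixes h :: "bool \<times> 'b \<Rightarrow> 'a::banach"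
  shows "h summable_on UNIV \<longleftrightarrow> (\<lambda>j. h (True, j)) summable_on UNIV \<and> (\<lambda>j. h (False, j)) summable_on UNIV"
    and "h summable_on UNIV \<Longrightarrow> infsum h UNIV = (\<Sum>\<^sub>\<infinity>j. h (True, j)) + (\<Sum>\<^sub>\<infinity>j. h (False, j))"
proof -
  have U: "UNIV = range (Pair True) \<union> range (Pair False :: 'b \<Rightarrow> bool \<times> 'b)"
  proof (intro set_eqI iffI)
    fix x :: "bool \<times> 'b"
    obtain s j where "x = (s, j)" by (cases x)
    then show "x \<in> range (Pair True) \<union> range (Pair False)" by (cases s) auto
  qed simp
  have D: "range (Pair True) \<inter> range (Pair False :: 'b \<Rightarrow> bool \<times> 'b) = {}" by auto
  have R: "h summable_on range (Pair s) \<longleftrightarrow> (\<lambda>j. h (s, j)) summable_on UNIV"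
    "infsum h (range (Pair s)) = (\<Sum>\<^sub>\<infinity>j. h (s, j))" for s
    using summable_on_reindex[of "Pair s" UNIV h] infsum_reindex[of "Pair s" UNIV h]
    by (auto simp: o_def inj_on_def)
  show iff: "h summable_on UNIV \<longleftrightarrow> (\<lambda>j. h (True, j)) summable_on UNIV \<and> (\<lambda>j. h (False, j)) summable_on UNIV"
    using summable_on_Un_disjoint[OF _ _ D, of h] summable_on_subset_banach[of h UNIV]
    unfolding U[symmetric] R(1)[symmetric] by blast
  show "h summable_on UNIV \<Longrightarrow> infsum h UNIV = (\<Sum>\<^sub>\<infinity>j. h (True, j)) + (\<Sum>\<^sub>\<infinity>j. h (False, j))"
    using infsum_Un_disjoint[OF _ _ D, of h] iff unfolding U[symmetric] R by blast
qed

lemma bij_shift: "bij_betw (\<lambda>j. j + c) UNIV (UNIV :: int set)"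
  by (rule bij_betwI[where g="\<lambda>j. j - c"]) auto

context scattering
begin

text \<open>Every block is unitary, so the local inner product over a bond is conserved. A bond
  pairs (True, j) with (False, j + 1) on input and (True, j + 1) with (False, j) on output; shifting
  one summation index matches the totals.\<close>

lemma walk_isometry:
  assumes u: "\<And>j. cmod (u j) = 1"
  shows "l2_isometry (walk u)"
proof -
  have key: "cnj (walk u f (True, j + 1)) * walk u h (True, j + 1) + cnj (walk u f (False, j)) * walk u h (False, j)
    = cnj (f (True, j)) * h (True, j) + cnj (f (False, j + 1)) * h (False, j + 1)" for f h j
  proof -
    have uu: "cnj (u j) * u j = 1" using of_real_cmod_sq[of "u j"] u[of j] by simp
    have c: "cis a * cis (- a) = 1" "cis (g j) * cis (- g j) = 1" by (simp_all add: cis_mult)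
    show ?thesis
      unfolding walk_scatter complex_cnj_mult complex_cnj_add complex_cnj_complex_of_real
        complex_cnj_i cis_cnj minus_minus
      using uu c rt_complex i_squared by algebra
  qed
  have mem: "walk u f \<in> hl2" if f: "f \<in> hl2" for f
  proof -
    have "(\<lambda>j. (cmod (f (True, j)))\<^sup>2) summable_on UNIV" and F: "(\<lambda>j. (cmod (f (False, j)))\<^sup>2) summable_on UNIV"
      using f summable_bool_prod(1)[of "\<lambda>i. (cmod (f i))\<^sup>2"] by (auto simp: hl2_def)
    then have S: "(\<lambda>j. (cmod (f (True, j)))\<^sup>2 + (cmod (f (False, j + 1)))\<^sup>2) summable_on UNIV"
      using summable_on_reindex_bij_betw[OF bij_shift[of 1], of "\<lambda>j. (cmod (f (False, j)))\<^sup>2"]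
      by (intro summable_on_add) auto
    have eq: "(cmod (walk u f (True, j + 1)))\<^sup>2 + (cmod (walk u f (False, j)))\<^sup>2
       = (cmod (f (True, j)))\<^sup>2 + (cmod (f (False, j + 1)))\<^sup>2" for j
      using key[of f j f] unfolding of_real_cmod_sq[symmetric] of_real_add[symmetric] of_real_eq_iff .
    have "(\<lambda>j. (cmod (walk u f (True, j + 1)))\<^sup>2) summable_on UNIV"
      by (rule summable_on_comparison_test[OF S]) (auto simp flip: eq)
    then have "(\<lambda>j. (cmod (walk u f (True, j)))\<^sup>2) summable_on UNIV"
      using summable_on_reindex_bij_betw[OF bij_shift[of 1], of "\<lambda>j. (cmod (walk u f (True, j)))\<^sup>2"] by simp
    moreover have "(\<lambda>j. (cmod (walk u f (False, j)))\<^sup>2) summable_on UNIV"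
      by (rule summable_on_comparison_test[OF S]) (auto simp flip: eq)
    ultimately show ?thesis
      using summable_bool_prod(1)[of "\<lambda>i. (cmod (walk u f i))\<^sup>2"] by (simp add: hl2_def)
  qed
  have "ip (walk u f) (walk u h) = ip f h" if f: "f \<in> hl2" and h: "h \<in> hl2" for f h
  proof -
    let ?k = "\<lambda>i. cnj (walk u f i) * walk u h i" and ?l = "\<lambda>i. cnj (f i) * h i"
    have k: "?k summable_on UNIV" and l: "?l summable_on UNIV"
      using summable_ip mem f h by blast+
    note k' = k[unfolded summable_bool_prod(1)] and l' = l[unfolded summable_bool_prod(1)]
    note sh = summable_on_reindex_bij_betw[OF bij_shift[of 1]] infsum_reindex_bij_betw[OF bij_shift[of 1]]
    have "ip (walk u f) (walk u h) = (\<Sum>\<^sub>\<infinity>j. ?k (True, j + 1)) + (\<Sum>\<^sub>\<infinity>j. ?k (False, j))"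
      unfolding ip_def summable_bool_prod(2)[OF k] sh(2)[of "\<lambda>j. ?k (True, j)"] ..
    also have "\<dots> = (\<Sum>\<^sub>\<infinity>j. ?k (True, j + 1) + ?k (False, j))"
      using k' sh(1)[of "\<lambda>j. ?k (True, j)"] by (intro infsum_add[symmetric]) auto
    also have "\<dots> = (\<Sum>\<^sub>\<infinity>j. ?l (True, j) + ?l (False, j + 1))"
      by (simp only: key)
    also have "\<dots> = (\<Sum>\<^sub>\<infinity>j. ?l (True, j)) + (\<Sum>\<^sub>\<infinity>j. ?l (False, j + 1))"
      using l' sh(1)[of "\<lambda>j. ?l (False, j)"] by (intro infsum_add) auto
    also have "\<dots> = ip f h"
      unfolding ip_def summable_bool_prod(2)[OF l] sh(2)[of "\<lambda>j. ?l (False, j)"] ..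
    finally show ?thesis .
  qed
  then show ?thesis using mem walk_clinear by (auto simp: l2_isometry_def)
qed

text \<open>Replacing the spectral parameter \<open>x\<close> by \<open>\<omega> x\<close> shifts the chain by one site. As the trace over a full period
  is invariant under shifts, it only contains powers of \<open>x\<close> whose exponents are multiples of the period.\<close>

lemma transfer_product_rotate:
  assumes u: "\<And>j. u j = \<omega> * u (j - 1)" and w: "cmod \<omega> = 1"
  shows "pcompose (transfer_product u j n $ i $ k) [:0, \<omega>:] = smult (\<omega> ^ n) (transfer_product u (j - 1) n $ i $ k)"
proof -
  have ww: "cnj \<omega> * \<omega> = 1" using of_real_cmod_sq[of \<omega>] w by simp
  have two: "x = 1 \<or> x = 2" for x :: 2 using exhaust_2 by blast
  \<comment> \<open>The entry with x^2 picks up \<omega>^2, while its conjugated phase gives one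
    \<omega> back; like the other entries it gains exactly one factor \<omega>.\<close>
  have cu: "cnj (u m) * (\<omega> * \<omega>) = \<omega> * cnj (u (m - 1))" for m
    using ww unfolding u[of m] complex_cnj_mult by algebra
  have transfer_matrix: "pcompose (transfer_matrix u m $ i $ k) [:0, \<omega>:] = smult \<omega> (transfer_matrix u (m - 1) $ i $ k)" for m i k
    using two[of i] two[of k] cu[of m] u[of m] by (auto simp: transfer_matrix_entries pcompose_pCons mult_ac)
  show ?thesis
  proof (induction n arbitrary: i k)
    case 0
    show ?case using two[of i] two[of k] by (auto simp: mat_def pcompose_1)
  next
    case (Suc n)
    have idx: "j - 1 + int n = j + int n - 1" by simp
    show ?case
      by (simp add: mat2_mult pcompose_add pcompose_mult Suc transfer_matrix smult_add_right mult.commute idx)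
  qed
qed

lemma transfer_product_Suc': "transfer_product u j (Suc n) = transfer_product u (j + 1) n ** transfer_matrix u j"
proof (induction n)
  case (Suc n)
  have "transfer_product u j (Suc (Suc n)) = transfer_matrix u (j + int (Suc n)) ** transfer_product u j (Suc n)" by simp
  also have "\<dots> = (transfer_matrix u (j + 1 + int n) ** transfer_product u (j + 1) n) ** transfer_matrix u j"
    unfolding Suc matrix_mul_assoc by (simp add: algebra_simps)
  finally show ?case by simp
qed simp

text \<open>Moving the window by one site takes a factor off the right end and puts one on the left
  end, by periodicity the same matrix; the trace is cyclic.\<close>

lemma trace_transfer_product_shift:
  assumes per: "\<And>j. u (j + int q) = u j" and q: "q > 0"
  shows "trace (transfer_product u j q) = trace (transfer_product u 0 q)"
proof -
  obtain m where m: "q = Suc m" using q by (cases q) auto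
  have step: "trace (transfer_product u j q) = trace (transfer_product u (j + 1) q)" for j
  proof -
    have "trace (transfer_product u j q) = trace (transfer_matrix u j ** transfer_product u (j + 1) m)"
      unfolding m transfer_product_Suc' by (rule trace_mul_sym)
    also have "transfer_matrix u j = transfer_matrix u (j + 1 + int m)"
      using per[of j] by (simp add: transfer_matrix_def m algebra_simps)
    finally show ?thesis by (simp add: m)
  qed
  show ?thesis
  proof (induction j rule: int_induct[where k=0])
    case (step1 i) then show ?case using step[of i] by simp
  next
    case (step2 i) then show ?case using step[of "i - 1"] by simp
  qed simp
qed

text \<open>Degree at most 2 q and exponents divisible by q leave three terms, the outer ones with
  products of unimodular phases as coefficients. The middle coefficient is bounded later, through
  the operator identity.\<close>

lemma trace_transfer_product_form:
  assumes unit: "\<And>j. cmod (u j) = 1" and u: "\<And>j. u j = \<omega> * u (j - 1)" and w: "\<omega> ^ q = 1"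
    and prim: "\<And>k. \<omega> ^ k = 1 \<Longrightarrow> q dvd k" and q: "q > 0"
  obtains c0 c1 c2 where "cmod c0 = 1" "cmod c2 = 1"
    "\<And>j. trace (transfer_product u j q) = monom c0 0 + monom c1 q + monom c2 (2 * q)"
proof -
  have w1: "cmod \<omega> = 1" using unit[of 0] unit[of "-1"] u[of 0] by (simp add: norm_mult)
  have per: "u (j + int n) = \<omega> ^ n * u j" for j n
  proof (induction n)
    case (Suc n) then show ?case using u[of "j + int (Suc n)"] by (simp add: algebra_simps)
  qed simp
  define \<tau> where "\<tau> = trace (transfer_product u 0 q)"
  have tr: "trace (transfer_product u j q) = \<tau>" for j
    unfolding \<tau>_def using q by (intro trace_transfer_product_shift) (auto simp: per w)
  have tr': "trace M = M $ 1 $ 1 + M $ 2 $ 2" for M :: "complex poly ^ 2 ^ 2"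
    by (simp add: trace_def sum_2)
  have "pcompose \<tau> [:0, \<omega>:] = \<tau>"
    using transfer_product_rotate[of u, OF u w1, of 0 q] tr[of "-1"] w
    by (simp add: \<tau>_def tr' pcompose_add)
  then have "\<omega> ^ k * coeff \<tau> k = coeff \<tau> k" for k by (metis coeff_pcompose_linear)
  then have dv: "q dvd k" if "coeff \<tau> k \<noteq> 0" for k using that prim[of k] by (metis mult_cancel_right1)
  have deg: "coeff \<tau> k = 0" if "k > 2 * q" for k
    using that transfer_product_coeffs(1)[of q k u 0] transfer_product_coeffs(4)[of q k u 0] by (simp add: \<tau>_def tr')
  have "\<tau> = monom (coeff \<tau> 0) 0 + monom (coeff \<tau> q) q + monom (coeff \<tau> (2 * q)) (2 * q)"
  proof (rule poly_eqI)
    fix k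
    show "coeff \<tau> k = coeff (monom (coeff \<tau> 0) 0 + monom (coeff \<tau> q) q + monom (coeff \<tau> (2 * q)) (2 * q)) k"
    proof (cases "k = 0 \<or> k = q \<or> k = 2 * q")
      case True then show ?thesis using q by auto
    next
      case False
      have "coeff \<tau> k = 0"
      proof (rule ccontr)
        assume nz: "coeff \<tau> k \<noteq> 0"
        then obtain m where m: "k = q * m" using dv by blast
        have "k \<le> 2 * q" using deg nz by (meson not_le)
        then have "m \<le> 2" using m q by (simp add: mult.commute)
        then have "m = 0 \<or> m = 1 \<or> m = 2" by auto
        then show False using m False by auto
      qed
      then show ?thesis using False by auto
    qed
  qed
  moreover have "cmod (coeff \<tau> 0) = 1" "cmod (coeff \<tau> (2 * q)) = 1"
    using transfer_product_coeffs(4)[where n=q and k="2 * q" and u=u and j=0] transfer_product_coeffs(5)[where n=q and u=u and j=0]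
      transfer_product_coeffs(6)[where n=q and u=u and j=0] transfer_product_coeffs(7)[where n=q and u=u and j=0] q
    by (simp_all add: \<tau>_def tr' unit prod_norm[symmetric])
  ultimately show ?thesis using that tr by metis
qed

end

section \<open>Periodic approximation\<close>

lemma nrm_le_pointwise:
  assumes h: "h \<in> hl2" and c: "0 \<le> c" and le: "\<And>i. cmod (f i) \<le> c * cmod (h i)"
  shows "f \<in> hl2" "nrm f \<le> c * nrm h"
proof -
  have "L2_set (\<lambda>i. cmod (f i)) F \<le> c * nrm h" if "finite F" for F
  proof -
    have "L2_set (\<lambda>i. cmod (f i)) F \<le> L2_set (\<lambda>i. c * cmod (h i)) F"
      by (intro L2_set_mono le) auto
    also have "\<dots> = c * L2_set (\<lambda>i. cmod (h i)) F"
      using c by (simp add: L2_set_right_distrib)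
    also have "\<dots> \<le> c * nrm h"
      by (intro mult_left_mono L2_set_le_nrm h that c)
    finally show ?thesis .
  qed
  from hl2I[OF this] show "f \<in> hl2" "nrm f \<le> c * nrm h" by auto
qed

text \<open>Supports are tracked because the phases of two frequencies drift apart linearly in the
  site index: the walks are close only on vectors near the origin.\<close>

definition supp_in :: "int \<Rightarrow> (bool \<times> int \<Rightarrow> complex) \<Rightarrow> bool" where
  "supp_in m f \<longleftrightarrow> (\<forall>s j. f (s, j) \<noteq> 0 \<longrightarrow> \<bar>j\<bar> \<le> m)"

lemma supp_in_basis: "\<bar>j\<bar> \<le> m \<Longrightarrow> supp_in m (basis (s, j))"
  by (auto simp: supp_in_def basis_def)

lemma cmod_cis_diff: "cmod (cis x - cis y) \<le> \<bar>x - y\<bar>"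
proof -
  have "cis x - cis y = cis y * (cis (x - y) - 1)" by (simp add: right_diff_distrib cis_mult)
  then have "cmod (cis x - cis y) = cmod (exp (\<i> * of_real (x - y)) - 1)"
    by (simp add: norm_mult cis_conv_exp)
  also have "\<dots> = 2 * \<bar>sin ((x - y) / 2)\<bar>" using dist_exp_i_1[of "x - y"] by simp
  also have "\<dots> \<le> \<bar>x - y\<bar>" using abs_sin_x_le_abs_x[of "(x - y) / 2"] by simp
  finally show ?thesis .
qed

context scattering
begin

lemma supp_in_walk:
  assumes "supp_in m f" shows "supp_in (m + 1) (walk u f)"
proof -
  have z: "f (s, j) = 0" if "\<bar>j\<bar> > m" for s j using assms that by (force simp: supp_in_def)
  show ?thesis unfolding supp_in_def
  proof (intro allI impI, rule ccontr)
    fix s j assume nz: "walk u f (s, j) \<noteq> 0" and "\<not> \<bar>j\<bar> \<le> m + 1"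
    then have "\<bar>j\<bar> > m" "\<bar>j - 1\<bar> > m" "\<bar>j + 1\<bar> > m" by auto
    then have "walk u f (s, j) = 0" by (simp add: walk_def z)
    with nz show False by simp
  qed
qed

lemma supp_in_walk_funpow: "supp_in m f \<Longrightarrow> supp_in (m + int n) ((walk u ^^ n) f)"
  by (induction n) (use supp_in_walk in \<open>force simp: add.commute add.left_commute\<close>)+

text \<open>Both walks produce the same amplitude \<open>X\<close> at a bond and differ only in the
  phase in front of it; |u| = 1 makes |X| the modulus of the output. The bond may lie one site
  outside the support, hence \<open>m + 1\<close>.\<close>

lemma walk_diff:
  assumes u: "\<And>j. cmod (u j) = 1"
    and D: "0 \<le> D" "\<And>j. cmod (u j - u' j) \<le> D * of_int \<bar>j\<bar>"
    and f: "f \<in> hl2" "supp_in m f" and m: "0 \<le> m"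
  shows "nrm (\<lambda>i. walk u f i - walk u' f i) \<le> D * (of_int m + 1) * nrm f"
proof -
  note iso = walk_isometry[of u, OF u]
  have z: "f (s, j) = 0" if "\<bar>j\<bar> > m" for s j using f that by (force simp: supp_in_def)
  have "cmod (walk u f i - walk u' f i) \<le> D * (of_int m + 1) * cmod (walk u f i)" for i
  proof -
    obtain X k where k: "walk u f i = u k * X" "walk u' f i = u' k * X" "X \<noteq> 0 \<Longrightarrow> \<bar>k\<bar> \<le> m + 1"
    proof -
      obtain s j where i: "i = (s, j)" by (cases i)
      show ?thesis
      proof (cases s)
        case True
        show ?thesis
        proof (rule that[of "j - 1" "\<i> * of_real t * cis (- g (j - 1)) * f (True, j - 1) + of_real r * cis a * f (False, j)"])
          assume nz: "\<i> * of_real t * cis (- g (j - 1)) * f (True, j - 1) + of_real r * cis a * f (False, j) \<noteq> 0"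
          then have "\<bar>j - 1\<bar> \<le> m \<or> \<bar>j\<bar> \<le> m" using z[of "j - 1" True] z[of j False] by force
          then show "\<bar>j - 1\<bar> \<le> m + 1" by linarith
        qed (use True in \<open>auto simp: i walk_def\<close>)
      next
        case False
        show ?thesis
        proof (rule that[of j "of_real r * cis (- a) * f (True, j) + \<i> * of_real t * cis (g j) * f (False, j + 1)"])
          assume nz: "of_real r * cis (- a) * f (True, j) + \<i> * of_real t * cis (g j) * f (False, j + 1) \<noteq> 0"
          then have "\<bar>j\<bar> \<le> m \<or> \<bar>j + 1\<bar> \<le> m" using z[of j True] z[of "j + 1" False] by force
          then show "\<bar>j\<bar> \<le> m + 1" by linarith
        qed (use False in \<open>auto simp: i walk_def\<close>)
      qed
    qed
    show ?thesis
    proof (cases "X = 0")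
      case True then show ?thesis by (simp add: k)
    next
      case False
      have "cmod (u k - u' k) \<le> D * of_int \<bar>k\<bar>" by (rule D)
      also have "\<dots> \<le> D * (of_int m + 1)" using k(3)[OF False] D(1) by (intro mult_left_mono) linarith+
      finally show ?thesis
        unfolding k left_diff_distrib[symmetric] norm_mult u by (simp add: mult_right_mono)
    qed
  qed
  from nrm_le_pointwise(2)[OF l2_isometryD(1)[OF iso f(1)] _ this]
  show ?thesis using D(1) m by (simp add: l2_isometryD(2)[OF iso f(1)])
qed

text \<open>Telescoping: the isometry carries the old error along unchanged, and each step adds an
  error made on a support that has grown by one site. Hence the quadratic growth in
  \<open>n\<close>.\<close>

lemma walk_funpow_diff:
  assumes u: "\<And>j. cmod (u j) = 1" and u': "\<And>j. cmod (u' j) = 1"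
    and D: "0 \<le> D" "\<And>j. cmod (u j - u' j) \<le> D * of_int \<bar>j\<bar>"
    and f: "f \<in> hl2" "supp_in m f" and m: "0 \<le> m"
  shows "nrm (\<lambda>i. (walk u ^^ n) f i - (walk u' ^^ n) f i) \<le> real n * D * (of_int m + real n) * nrm f"
proof (induction n)
  case (Suc n)
  note iso = walk_isometry[of u, OF u] and iso' = walk_isometry[of u', OF u']
  let ?x = "(walk u ^^ n) f" and ?y = "(walk u' ^^ n) f"
  have x: "?x \<in> hl2" and y: "?y \<in> hl2" "nrm ?y = nrm f"
    using l2_isometryD(3)[OF iso f(1)] l2_isometryD(3,4)[OF iso' f(1)] by auto
  have "nrm (\<lambda>i. walk u ?x i - walk u' ?y i)
     \<le> nrm (\<lambda>i. walk u ?x i - walk u ?y i) + nrm (\<lambda>i. walk u ?y i - walk u' ?y i)"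
    by (rule nrm_diff_triangle[OF l2_isometryD(1)[OF iso x] l2_isometryD(1)[OF iso y(1)] l2_isometryD(1)[OF iso' y(1)]])
  also have "nrm (\<lambda>i. walk u ?x i - walk u ?y i) = nrm (\<lambda>i. ?x i - ?y i)"
    using l2_isometryD(2)[OF iso hl2_diff[OF x y(1)]] by (simp add: clinear_opD[OF walk_clinear])
  also have "\<dots> \<le> real n * D * (of_int m + real n) * nrm f" by (rule Suc)
  also have "\<dots> \<le> real n * D * (of_int m + real (Suc n)) * nrm f"
    using D m by (intro mult_right_mono mult_left_mono) auto
  also have "nrm (\<lambda>i. walk u ?y i - walk u' ?y i) \<le> D * (of_int (m + int n) + 1) * nrm ?y"
    using m by (intro walk_diff u D y supp_in_walk_funpow f) auto
  also have "\<dots> = D * (of_int m + real (Suc n)) * nrm f" by (simp add: y algebra_simps)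
  finally show ?case by (simp add: algebra_simps)
qed simp

lemma t_power_le_1: "t ^ n \<le> 1"
proof -
  have "t\<^sup>2 \<le> 1\<^sup>2" using rt zero_le_power2[of r] unfolding one_power2 by linarith
  then have "t \<le> 1" by (rule power2_le_imp_le) simp
  then show ?thesis using t_pos by (intro power_le_one) auto
qed

definition rot :: "real \<Rightarrow> real \<Rightarrow> int \<Rightarrow> complex" where
  "rot \<beta> \<theta> j = cis (- (2 * pi * \<beta> * of_int j + \<theta>))"

lemma cmod_rot [simp]: "cmod (rot \<beta> \<theta> j) = 1"
  by (simp add: rot_def)

lemma rot_step: "rot \<beta> \<theta> j = cis (- (2 * pi * \<beta>)) * rot \<beta> \<theta> (j - 1)"
  unfolding rot_def cis_mult by (rule arg_cong[of _ _ cis]) (simp add: algebra_simps)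

lemma rot_diff: "cmod (rot \<beta> \<theta> j - rot \<beta>' \<theta> j) \<le> 2 * pi * \<bar>\<beta> - \<beta>'\<bar> * of_int \<bar>j\<bar>"
proof -
  have "cmod (rot \<beta> \<theta> j - rot \<beta>' \<theta> j) \<le> \<bar>2 * pi * (\<beta>' - \<beta>) * of_int j\<bar>"
    unfolding rot_def by (rule order_trans[OF cmod_cis_diff]) (simp add: algebra_simps)
  then show ?thesis by (simp add: abs_mult abs_minus_commute)
qed

text \<open>Coprimality makes \<omega> = e^(-2 pi i p/q) a primitive q-th root of unity, as the
  trace formula requires.\<close>

lemma rational_trace_identity:
  fixes p q :: nat and \<theta> :: real
  assumes pq: "coprime p q" and q: "q > 0"
  defines "W \<equiv> walk (rot (real p / real q) \<theta>)"
  shows "\<exists>c0 c1 c2. cmod c0 = 1 \<and> cmod c2 = 1 \<and> cmod c1 \<le> 4 \<and> (\<forall>s j. \<exists>g1 g2. cmod g1 = 1 \<and> cmod g2 = 1 \<and>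
    (\<forall>i. c0 * basis (s, j) i + c1 * (W ^^ q) (basis (s, j)) i + c2 * (W ^^ (2 * q)) (basis (s, j)) i
      = (\<i> * of_real t) ^ q * (W ^^ q) (\<lambda>i. g1 * basis (s, j + int q) i + g2 * basis (s, j - int q) i) i))"
proof -
  let ?u = "rot (real p / real q) \<theta>"
  define \<omega> where "\<omega> = cis (- (2 * pi * (real p / real q)))"
  have u: "?u j = \<omega> * ?u (j - 1)" for j
    unfolding \<omega>_def by (rule rot_step)
  have wk: "\<omega> ^ k = cis (- (2 * pi * (real p * real k / real q)))" for k
    unfolding \<omega>_def Complex.DeMoivre by (rule arg_cong[of _ _ cis]) (simp add: algebra_simps)
  have w: "\<omega> ^ q = 1"
  proof -
    have "cis (2 * pi * (- real p)) = 1" by (rule cis_multiple_2pi) auto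
    then show ?thesis using q unfolding wk by simp
  qed
  have prim: "q dvd k" if "\<omega> ^ k = 1" for k
  proof -
    have "cos (2 * pi * (real p * real k / real q)) = 1"
      using that unfolding wk by (simp add: complex_eq_iff)
    then obtain n :: int where "2 * pi * (real p * real k / real q) = of_int n * 2 * pi"
      by (auto simp: cos_one_2pi_int)
    then have "real p * real k = of_int n * real q" using q by (simp add: field_simps)
    then have "of_int (int (p * k)) = (of_int (n * int q) :: real)" by simp
    then have "int (p * k) = n * int q" by (simp only: of_int_eq_iff)
    then have "int q dvd int (p * k)" by simp
    then have "q dvd p * k" by (simp only: int_dvd_int_iff)
    then show ?thesis using pq by (simp add: coprime_commute coprime_dvd_mult_right_iff)
  qed
  obtain c0 c1 c2 where c: "cmod c0 = 1" "cmod c2 = 1"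
    "\<And>j. trace (transfer_product ?u j q) = monom c0 0 + monom c1 q + monom c2 (2 * q)"
    by (rule trace_transfer_product_form[of ?u \<omega> q, OF cmod_rot u w prim q]) (assumption, rule that)
  have per: "?u (j + int q) = ?u j" for j
  proof -
    have "?u (j + int n) = \<omega> ^ n * ?u j" for n
    proof (induction n)
      case (Suc n) then show ?case using u[of "j + int (Suc n)"] by (simp add: algebra_simps)
    qed simp
    then show ?thesis by (simp add: w)
  qed
  have id: "\<exists>g1 g2. cmod g1 = 1 \<and> cmod g2 = 1 \<and>
    (\<forall>i. c0 * basis (s, j) i + c1 * (W ^^ q) (basis (s, j)) i + c2 * (W ^^ (2 * q)) (basis (s, j)) i
      = (\<i> * of_real t) ^ q * (W ^^ q) (\<lambda>i. g1 * basis (s, j + int q) i + g2 * basis (s, j - int q) i) i)" for s j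
    using transfer_two_sided[of ?u q j s, OF cmod_rot per]
    unfolding c(3) papply_add papply_monom[OF walk_clinear] W_def by (simp add: add.assoc)
  \<comment> \<open>Solve the identity on one basis vector for the middle term: the remaining terms
    have norms at most 2, 1 and 1.\<close>
  moreover have "cmod c1 \<le> 4"
  proof -
    let ?e = "basis (True, 0) :: bool \<times> int \<Rightarrow> complex"
    obtain g1 g2 where g: "cmod g1 = 1" "cmod g2 = 1" and
      eq: "\<And>i. c0 * ?e i + c1 * (W ^^ q) ?e i + c2 * (W ^^ (2 * q)) ?e i
      = (\<i> * of_real t) ^ q * (W ^^ q) (\<lambda>i. g1 * basis (True, 0 + int q) i + g2 * basis (True, 0 - int q) i) i"
      using id[of True 0] by blast
    let ?f = "\<lambda>i. g1 * basis (True, 0 + int q) i + g2 * basis (True, 0 - int q) i"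
    have iso: "l2_isometry W" unfolding W_def by (rule walk_isometry) simp
    have f: "?f \<in> hl2" by (intro hl2_add hl2_scale basis_L2)
    have nf: "nrm ?f \<le> 2"
      using nrm_add[OF hl2_scale[OF basis_L2(1)] hl2_scale[OF basis_L2(1)], of g1 "(True, 0 + int q)" g2 "(True, 0 - int q)"]
      by (simp add: nrm_scale basis_L2 g)
    note tq = t_power_le_1[of q]
    have W: "(W ^^ n) h \<in> hl2" "nrm ((W ^^ n) h) = nrm h" if "h \<in> hl2" for n h
      using l2_isometryD[OF iso that] by auto
    let ?A = "\<lambda>i. (\<i> * of_real t) ^ q * (W ^^ q) ?f i" and ?B = "\<lambda>i. c0 * ?e i" and ?C = "\<lambda>i. c2 * (W ^^ (2 * q)) ?e i"
    have mem: "?A \<in> hl2" "?B \<in> hl2" "?C \<in> hl2"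
      by (intro hl2_scale W f basis_L2)+
    have "cmod c1 = nrm (\<lambda>i. c1 * (W ^^ q) ?e i)" by (simp add: nrm_scale W basis_L2)
    also have "(\<lambda>i. c1 * (W ^^ q) ?e i) = (\<lambda>i. (?A i - ?B i) - ?C i)"
      unfolding eq[symmetric] by simp
    also have "nrm \<dots> \<le> nrm ?A + nrm ?B + nrm ?C"
      using nrm_diff[OF hl2_diff[OF mem(1,2)] mem(3)] nrm_diff[OF mem(1,2)] by linarith
    also have "\<dots> \<le> t ^ q * 2 + 1 + 1"
      unfolding nrm_scale W(2)[OF f] W(2)[OF basis_L2(1)] basis_L2(2) c
      using nf t_pos by (simp add: norm_mult norm_power)
    also have "\<dots> \<le> 4" using tq by simp
    finally show ?thesis .
  qed
  ultimately show ?thesis using c(1,2) by blast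
qed

text \<open>The coefficients are those of the rational walk; only the powers of the walk are
  exchanged, in three terms, at the cost given by \<open>walk_funpow_diff\<close>.\<close>

lemma approx_trace_identity:
  fixes p q :: nat and \<beta> \<theta> :: real
  assumes pq: "coprime p q" and q: "q > 0"
  defines "W \<equiv> walk (rot \<beta> \<theta>)"
  shows "\<exists>c0 c1 c2. cmod c0 = 1 \<and> cmod c2 = 1 \<and> cmod c1 \<le> 4 \<and> (\<forall>s j. \<exists>g1 g2. cmod g1 = 1 \<and> cmod g2 = 1 \<and>
    nrm (\<lambda>i. (c0 * basis (s, j) i + c1 * (W ^^ q) (basis (s, j)) i + c2 * (W ^^ (2 * q)) (basis (s, j)) i)
      - (\<i> * of_real t) ^ q * (W ^^ q) (\<lambda>i. g1 * basis (s, j + int q) i + g2 * basis (s, j - int q) i) i)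
    \<le> 24 * pi * real q * (of_int \<bar>j\<bar> + 3 * real q) * \<bar>\<beta> - real p / real q\<bar>)"
proof -
  define \<beta>' where "\<beta>' = real p / real q"
  define W' where "W' = walk (rot \<beta>' \<theta>)"
  define D where "D = 2 * pi * \<bar>\<beta> - \<beta>'\<bar>"
  have D0: "0 \<le> D" by (simp add: D_def)
  note tq = t_power_le_1[of q]
  have iso: "l2_isometry W" "l2_isometry W'" unfolding W_def W'_def by (rule walk_isometry; simp)+
  have Wn: "(W ^^ n) h \<in> hl2" "nrm ((W ^^ n) h) = nrm h" "(W' ^^ n) h \<in> hl2" if "h \<in> hl2" for n h
    using l2_isometryD[OF iso(1) that] l2_isometryD[OF iso(2) that] by auto
  have pd: "nrm (\<lambda>i. (W ^^ n) f i - (W' ^^ n) f i) \<le> real n * D * (of_int m + real n) * nrm f"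
    if "f \<in> hl2" "supp_in m f" "0 \<le> m" for n f m
    unfolding W_def W'_def D_def
    by (intro walk_funpow_diff rot_diff that cmod_rot) auto
  obtain c0 c1 c2 where c: "cmod c0 = 1" "cmod c2 = 1" "cmod c1 \<le> 4" and
    id: "\<And>s j. \<exists>g1 g2. cmod g1 = 1 \<and> cmod g2 = 1 \<and>
    (\<forall>i. c0 * basis (s, j) i + c1 * (W' ^^ q) (basis (s, j)) i + c2 * (W' ^^ (2 * q)) (basis (s, j)) i
      = (\<i> * of_real t) ^ q * (W' ^^ q) (\<lambda>i. g1 * basis (s, j + int q) i + g2 * basis (s, j - int q) i) i)"
    using rational_trace_identity[OF pq q, of \<theta>] unfolding W'_def \<beta>'_def by blast
  have "\<exists>g1 g2. cmod g1 = 1 \<and> cmod g2 = 1 \<and>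
    nrm (\<lambda>i. (c0 * basis (s, j) i + c1 * (W ^^ q) (basis (s, j)) i + c2 * (W ^^ (2 * q)) (basis (s, j)) i)
      - (\<i> * of_real t) ^ q * (W ^^ q) (\<lambda>i. g1 * basis (s, j + int q) i + g2 * basis (s, j - int q) i) i)
    \<le> 24 * pi * real q * (of_int \<bar>j\<bar> + 3 * real q) * \<bar>\<beta> - real p / real q\<bar>" for s j
  proof -
    let ?e = "basis (s, j) :: bool \<times> int \<Rightarrow> complex"
    obtain g1 g2 where g: "cmod g1 = 1" "cmod g2 = 1" and
      eq: "\<And>i. c0 * ?e i + c1 * (W' ^^ q) ?e i + c2 * (W' ^^ (2 * q)) ?e i
      = (\<i> * of_real t) ^ q * (W' ^^ q) (\<lambda>i. g1 * basis (s, j + int q) i + g2 * basis (s, j - int q) i) i"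
      using id[of s j] by blast
    let ?f = "\<lambda>i. g1 * basis (s, j + int q) i + g2 * basis (s, j - int q) i"
    have f: "?f \<in> hl2" by (intro hl2_add hl2_scale basis_L2)
    have nf: "nrm ?f \<le> 2"
      using nrm_add[OF hl2_scale[OF basis_L2(1)] hl2_scale[OF basis_L2(1)], of g1 "(s, j + int q)" g2 "(s, j - int q)"]
      by (simp add: nrm_scale basis_L2 g)
    have sf: "supp_in (\<bar>j\<bar> + int q) ?f"
      by (auto simp: supp_in_def basis_def)
    let ?A = "\<lambda>i. c1 * ((W ^^ q) ?e i - (W' ^^ q) ?e i)"
    let ?B = "\<lambda>i. c2 * ((W ^^ (2 * q)) ?e i - (W' ^^ (2 * q)) ?e i)"
    let ?C = "\<lambda>i. (\<i> * of_real t) ^ q * ((W ^^ q) ?f i - (W' ^^ q) ?f i)"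
    have mem: "?A \<in> hl2" "?B \<in> hl2" "?C \<in> hl2"
      by (intro hl2_scale hl2_diff Wn f basis_L2)+
    have nA: "nrm ?A \<le> 4 * (real q * D * (of_int \<bar>j\<bar> + real q) * 1)"
      unfolding nrm_scale
      using pd[of ?e "\<bar>j\<bar>" q] c by (intro mult_mono) (auto simp: basis_L2 supp_in_basis)
    have nB: "nrm ?B \<le> 1 * (real (2 * q) * D * (of_int \<bar>j\<bar> + real (2 * q)) * 1)"
      unfolding nrm_scale c(2)
      using pd[of ?e "\<bar>j\<bar>" "2 * q"] by (intro mult_mono) (auto simp: basis_L2 supp_in_basis)
    have nC: "nrm ?C \<le> 1 * (real q * D * (of_int \<bar>j\<bar> + real q + real q) * 2)"
    proof -
      have "nrm (\<lambda>i. (W ^^ q) ?f i - (W' ^^ q) ?f i) \<le> real q * D * (of_int \<bar>j\<bar> + real q + real q) * nrm ?f"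
        using pd[OF f sf, of q] by simp
      also have "\<dots> \<le> real q * D * (of_int \<bar>j\<bar> + real q + real q) * 2"
        using nf D0 by (intro mult_left_mono) auto
      finally show ?thesis
        unfolding nrm_scale using tq t_pos D0 by (intro mult_mono) (auto simp: norm_mult norm_power)
    qed
    have e1: "(\<lambda>i. (c0 * ?e i + c1 * (W ^^ q) ?e i + c2 * (W ^^ (2 * q)) ?e i) - (\<i> * of_real t) ^ q * (W ^^ q) ?f i)
      = (\<lambda>i. (?A i + ?B i) - ?C i)"
      using eq by (intro ext) (simp add: right_diff_distrib algebra_simps)
    have e2: "nrm (\<lambda>i. (?A i + ?B i) - ?C i) \<le> nrm ?A + nrm ?B + nrm ?C"
      using nrm_diff[OF hl2_add[OF mem(1,2)] mem(3)] nrm_add[OF mem(1,2)] by linarith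
    \<comment> \<open>With x = q D, b = |j| and y = q the three errors add up to x (8 b + 12 y),
      which the factor 12 absorbs; D = 2 pi |\<beta> - p/q| then makes it 24 pi.\<close>
    have e3: "nrm ?A + nrm ?B + nrm ?C \<le> 12 * (real q * D * (of_int \<bar>j\<bar> + 3 * real q))"
    proof -
      have x: "0 \<le> real q * D" using D0 by simp
      have "4 * (x * (b + y)) + 2 * (x * (b + 2 * y)) + 2 * (x * (b + y + y)) \<le> 12 * (x * (b + 3 * y))"
        if "0 \<le> x" "0 \<le> b" "0 \<le> y" for x b y :: real
      proof -
        have "4 * (b + y) + 2 * (b + 2 * y) + 2 * (b + y + y) \<le> 12 * (b + 3 * y)" using that by simp
        from mult_left_mono[OF this that(1)] show ?thesis by (simp add: algebra_simps)
      qed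
      from this[OF x, of "of_int \<bar>j\<bar>" "real q"]
      have "4 * (real q * D * (of_int \<bar>j\<bar> + real q)) + 2 * (real q * D * (of_int \<bar>j\<bar> + 2 * real q))
        + 2 * (real q * D * (of_int \<bar>j\<bar> + real q + real q)) \<le> 12 * (real q * D * (of_int \<bar>j\<bar> + 3 * real q))"
        by simp
      moreover have "1 * (real (2 * q) * D * (of_int \<bar>j\<bar> + real (2 * q)) * 1) = 2 * (real q * D * (of_int \<bar>j\<bar> + 2 * real q))"
        by simp
      ultimately show ?thesis using nA nB nC by linarith
    qed
    have e4: "12 * (real q * D * (of_int \<bar>j\<bar> + 3 * real q)) = 24 * pi * real q * (of_int \<bar>j\<bar> + 3 * real q) * \<bar>\<beta> - real p / real q\<bar>"
      by (simp add: D_def \<beta>'_def)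
    have "nrm (\<lambda>i. (c0 * ?e i + c1 * (W ^^ q) ?e i + c2 * (W ^^ (2 * q)) ?e i) - (\<i> * of_real t) ^ q * (W ^^ q) ?f i)
      \<le> 24 * pi * real q * (of_int \<bar>j\<bar> + 3 * real q) * \<bar>\<beta> - real p / real q\<bar>"
      unfolding e1 e4[symmetric] using e2 e3 by (rule order_trans)
    then show ?thesis using g by blast
  qed
  then show ?thesis using c by blast
qed

end

section \<open>Liouville frequencies\<close>

text \<open>Reducing a fraction shrinks its denominator and thereby only weakens the bound.
  Denominators tend to infinity by irrationality: if \<open>q k < M\<close>, then M! \<beta> lies
  within M!/(k + 1) of an integer, whereas its distance \<delta> from the integers is
  positive.\<close>

lemma liouville_coprime_approx:
  assumes liou: "liouville_number \<beta>" and irr: "\<beta> \<notin> \<rat>"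
  obtains p q :: "nat \<Rightarrow> nat" where "\<And>k. coprime (p k) (q k)" "\<And>k. q k > 0"
    "\<And>k. \<bar>\<beta> - real (p k) / real (q k)\<bar> \<le> 1 / real (Suc k) ^ q k" "filterlim q at_top sequentially"
proof -
  have "\<exists>p q. coprime p q \<and> q > 0 \<and> \<bar>\<beta> - real p / real q\<bar> \<le> 1 / real (Suc k) ^ q" for k :: nat
  proof -
    have "Suc k \<ge> 1" by simp
    with liou obtain P Q :: nat where PQ: "Q > 0" "\<bar>\<beta> - real P / real Q\<bar> \<le> 1 / real (Suc k) ^ Q"
      unfolding liouville_number_def by blast
    define d where "d = gcd P Q"
    have d: "d > 0" using PQ by (simp add: d_def)
    have P: "P = d * (P div d)" and Q: "Q = d * (Q div d)" by (simp_all add: d_def)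
    have "coprime (P div d) (Q div d)" unfolding d_def using PQ by (intro div_gcd_coprime) auto
    moreover have "Q div d > 0" using Q PQ(1) by (metis gr0I mult_0_right)
    moreover have "real P / real Q = real (P div d) / real (Q div d)"
    proof -
      have "real P = real d * real (P div d)" "real Q = real d * real (Q div d)"
        using P Q by (metis of_nat_mult)+
      then show ?thesis using d by simp
    qed
    moreover have "1 / real (Suc k) ^ Q \<le> 1 / real (Suc k) ^ (Q div d)"
      by (intro divide_left_mono power_increasing) auto
    ultimately show ?thesis using PQ(2) by (metis order_trans)
  qed
  then obtain p q where pq: "\<And>k. coprime (p k) (q k)" "\<And>k. q k > 0"
    "\<And>k. \<bar>\<beta> - real (p k) / real (q k)\<bar> \<le> 1 / real (Suc k) ^ q k" by metis
  have "filterlim q at_top sequentially"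
    unfolding filterlim_at_top
  proof
    fix M :: nat
    define x where "x = fact M * \<beta>"
    have xi: "x \<notin> \<int>"
    proof
      assume "x \<in> \<int>"
      then have "x / fact M \<in> \<rat>"
        using Ints_subset_Rats Rats_divide[of x "fact M"] by (metis Rats_of_nat of_nat_fact subsetD)
      then show False using irr by (simp add: x_def)
    qed
    define \<delta> where "\<delta> = min (x - of_int \<lfloor>x\<rfloor>) (of_int \<lfloor>x\<rfloor> + 1 - x)"
    have "of_int \<lfloor>x\<rfloor> \<noteq> x" using xi by (metis Ints_of_int)
    moreover have "of_int \<lfloor>x\<rfloor> \<le> x" "x < of_int \<lfloor>x\<rfloor> + 1" by linarith+
    ultimately have \<delta>0: "\<delta> > 0" unfolding \<delta>_def min_less_iff_conj by linarith
    have "\<exists>K. fact M / \<delta> < real K" using reals_Archimedean2 by blast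
    then obtain K where K: "fact M / \<delta> < real K" by blast
    have "M \<le> q k" if "k \<ge> K" for k
    proof (rule ccontr)
      assume "\<not> M \<le> q k"
      then have "q k dvd fact M" using pq(2)[of k] by (intro dvd_fact) auto
      then obtain c where c: "fact M = q k * c" by (auto elim: dvdE)
      have fc: "(fact M :: real) = real (q k) * real c" using c by (metis of_nat_fact of_nat_mult)
      have "x - of_int (int (c * p k)) = fact M * (\<beta> - real (p k) / real (q k))"
        unfolding x_def right_diff_distrib using pq(2)[of k] by (simp add: fc)
      then have "\<bar>x - of_int (int (c * p k))\<bar> = fact M * \<bar>\<beta> - real (p k) / real (q k)\<bar>"
        by (simp add: abs_mult)
      also have "\<dots> \<le> fact M * (1 / real (Suc k) ^ q k)" by (intro mult_left_mono pq) auto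
      also have "\<dots> \<le> fact M * (1 / real (Suc k) ^ 1)"
        using pq(2)[of k] by (intro mult_left_mono divide_left_mono power_increasing) auto
      also have "\<dots> < \<delta>"
      proof -
        have "fact M / \<delta> < real (Suc k)" using K that by simp
        then show ?thesis using \<delta>0 by (simp add: field_simps)
      qed
      finally have lt: "\<bar>x - of_int (int (c * p k))\<bar> < \<delta>" .
      have "int (c * p k) \<le> \<lfloor>x\<rfloor> \<or> int (c * p k) \<ge> \<lfloor>x\<rfloor> + 1" by linarith
      then have "real_of_int (int (c * p k)) \<le> of_int \<lfloor>x\<rfloor> \<or> real_of_int (int (c * p k)) \<ge> of_int \<lfloor>x\<rfloor> + 1"
        by linarith
      then show False using lt unfolding \<delta>_def by linarith
    qed
    then show "\<forall>\<^sub>F k in sequentially. M \<le> q k" using eventually_sequentially by blast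
  qed
  then show ?thesis using pq that by blast
qed

text \<open>By q \<le> 2^q the quotient is at most (m + 4) (4 / (t (k + 1)))^q. Once the base is at
  most 1, q \<ge> 1 bounds the power by the base itself. Here the growing base of the Liouville
  condition beats the factor 1 / t^q.\<close>

lemma superexponential_error_tendsto_0:
  fixes q :: "nat \<Rightarrow> nat" and t m :: real and \<epsilon> :: "nat \<Rightarrow> real"
  assumes t: "0 < t" and m: "0 \<le> m" and q: "\<And>k. q k > 0"
    and \<epsilon>: "\<And>k. 0 \<le> \<epsilon> k" "\<And>k. \<epsilon> k \<le> 1 / real (Suc k) ^ q k"
  shows "(\<lambda>k. real (q k) * (m + 4 * real (q k)) * \<epsilon> k / t ^ q k) \<longlonglongrightarrow> 0"
proof (rule Lim_null_comparison)
  obtain K where K: "4 / t < real K" using reals_Archimedean2 by blast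
  show "\<forall>\<^sub>F k in sequentially. norm (real (q k) * (m + 4 * real (q k)) * \<epsilon> k / t ^ q k) \<le> ((m + 4) * (4 / t)) / real (Suc k)"
    using eventually_ge_at_top[of K]
  proof eventually_elim
    case (elim k)
    define x where "x = 4 / t / real (Suc k)"
    have "4 / t < real (Suc k)" using K elim by simp
    then have x: "0 \<le> x" "x \<le> 1" unfolding x_def using t by (simp, subst divide_le_eq_1_pos) auto
    have q2: "real (q k) \<le> 2 ^ q k" using less_exp[of "q k"] by (metis of_nat_le_iff less_imp_le of_nat_numeral of_nat_power)
    have "m * 1 \<le> m * 2 ^ q k" using m by (intro mult_left_mono) auto
    then have m2: "m + 4 * real (q k) \<le> (m + 4) * 2 ^ q k" unfolding distrib_right using q2 by linarith
    have "real (q k) * (m + 4 * real (q k)) * \<epsilon> k \<le> (2 ^ q k * ((m + 4) * 2 ^ q k)) * (1 / real (Suc k) ^ q k)"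
      using q2 m2 m \<epsilon> by (intro mult_mono) auto
    then have "real (q k) * (m + 4 * real (q k)) * \<epsilon> k / t ^ q k
        \<le> (2 ^ q k * ((m + 4) * 2 ^ q k)) * (1 / real (Suc k) ^ q k) / t ^ q k"
      using t by (intro divide_right_mono) auto
    also have "\<dots> = (m + 4) * x ^ q k"
    proof -
      have "(2::real) ^ q k * 2 ^ q k = 4 ^ q k" by (simp flip: power_mult_distrib)
      then show ?thesis by (simp add: x_def power_divide power_mult_distrib mult.left_commute mult.commute[of t] del: of_nat_Suc)
    qed
    also have "\<dots> \<le> (m + 4) * x ^ 1"
      using x m q[of k] by (intro mult_left_mono power_decreasing) auto
    finally show ?case
      using t m \<epsilon>(1)[of k] by (simp add: x_def abs_mult del: of_nat_Suc)
  qed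
  show "(\<lambda>k. ((m + 4) * (4 / t)) / real (Suc k)) \<longlonglongrightarrow> 0"
    by (rule LIMSEQ_Suc[OF lim_const_over_n])
qed

lemma hl2_tendsto_0_at_infinity:
  fixes F :: "bool \<times> int \<Rightarrow> complex"
  assumes F: "F \<in> hl2" and J: "filterlim (\<lambda>k::nat. \<bar>J k\<bar>) at_top sequentially"
  shows "(\<lambda>k. cmod (F (s, J k))) \<longlonglongrightarrow> 0"
proof (rule LIMSEQ_I)
  fix e :: real assume "e > 0"
  then obtain S where S: "finite S" "(\<lambda>i. if i \<in> S then 0 else F i) \<in> hl2" "nrm (\<lambda>i. if i \<in> S then 0 else F i) < e"
    using hl2_small_tail[OF F] by blast
  have "bdd_above ((\<lambda>i. \<bar>snd i\<bar>) ` S)" using S(1) by (intro bdd_above_finite) auto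
  then obtain M where M: "\<And>i. i \<in> S \<Longrightarrow> \<bar>snd i\<bar> \<le> M" by (auto simp: bdd_above_def)
  have "\<forall>\<^sub>F k in sequentially. M + 1 \<le> \<bar>J k\<bar>" using J by (simp add: filterlim_at_top)
  then obtain N where N: "\<And>k. k \<ge> N \<Longrightarrow> M + 1 \<le> \<bar>J k\<bar>" by (auto simp: eventually_sequentially)
  have "cmod (F (s, J k)) < e" if "k \<ge> N" for k
  proof -
    have "(s, J k) \<notin> S" using M[of "(s, J k)"] N[OF that] by auto
    then have "cmod (F (s, J k)) \<le> nrm (\<lambda>i. if i \<in> S then 0 else F i)"
      using cmod_le_nrm[OF S(2), of "(s, J k)"] by simp
    then show ?thesis using S(3) by simp
  qed
  then show "\<exists>N. \<forall>k\<ge>N. norm (cmod (F (s, J k)) - 0) < e" by auto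
qed

text \<open>Finite combinations of basis vectors are dense, and the uniform bound \<open>B\<close>
  controls the tail.\<close>

lemma strong_limit_0:
  assumes lin: "\<And>k::nat. clinear_op (R k)" and mem: "\<And>k f. f \<in> hl2 \<Longrightarrow> R k f \<in> hl2"
    and bd: "\<And>k f. f \<in> hl2 \<Longrightarrow> nrm (R k f) \<le> B * nrm f"
    and bas: "\<And>i. (\<lambda>k. nrm (R k (basis i))) \<longlonglongrightarrow> 0" and \<phi>: "\<phi> \<in> hl2"
  shows "(\<lambda>k. nrm (R k \<phi>)) \<longlonglongrightarrow> 0"
proof (rule LIMSEQ_I)
  fix e :: real assume e: "e > 0"
  have "0 < e / (2 * (\<bar>B\<bar> + 1))" using e by simp
  from hl2_small_tail[OF \<phi> this] obtain S where S: "finite S" "(\<lambda>i. if i \<in> S then 0 else \<phi> i) \<in> hl2"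
    "nrm (\<lambda>i. if i \<in> S then 0 else \<phi> i) < e / (2 * (\<bar>B\<bar> + 1))" by blast
  let ?t = "\<lambda>i. if i \<in> S then 0 else \<phi> i" and ?f = "\<lambda>i. \<Sum>s\<in>S. \<phi> s * basis s i"
  have dec: "\<phi> = (\<lambda>i. ?f i + ?t i)"
  proof
    fix i
    have "?f i = (\<Sum>s\<in>S. if i = s then \<phi> s else 0)"
      by (intro sum.cong) (auto simp: basis_def)
    then show "\<phi> i = ?f i + ?t i" using S(1) by simp
  qed
  have Rf: "R k ?f = (\<lambda>i. \<Sum>s\<in>S. \<phi> s * R k (basis s) i)" for k
    using clinear_op_sum[OF lin S(1), of k "\<lambda>s i. \<phi> s * basis s i"] by (simp add: clinear_opD[OF lin])
  have fm: "?f \<in> hl2" using S(1) by (intro hl2_sum hl2_scale basis_L2)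
  have nf: "nrm (R k ?f) \<le> (\<Sum>s\<in>S. cmod (\<phi> s) * nrm (R k (basis s)))" for k
    unfolding Rf using nrm_sum[OF S(1), of "\<lambda>s i. \<phi> s * R k (basis s) i"]
    by (simp add: nrm_scale hl2_scale mem basis_L2)
  have "(\<lambda>k. \<Sum>s\<in>S. cmod (\<phi> s) * nrm (R k (basis s))) \<longlonglongrightarrow> (\<Sum>s\<in>S. cmod (\<phi> s) * 0)"
    by (intro tendsto_intros bas)
  then have "\<exists>N. \<forall>k\<ge>N. norm ((\<Sum>s\<in>S. cmod (\<phi> s) * nrm (R k (basis s))) - 0) < e / 2"
    using e by (intro LIMSEQ_D) auto
  then obtain N where N: "\<And>k. k \<ge> N \<Longrightarrow> norm ((\<Sum>s\<in>S. cmod (\<phi> s) * nrm (R k (basis s))) - 0) < e / 2"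
    by blast
  have nt: "nrm (R k ?t) \<le> e / 2" for k
  proof -
    have "nrm (R k ?t) \<le> B * nrm ?t" by (rule bd[OF S(2)])
    also have "\<dots> \<le> (\<bar>B\<bar> + 1) * (e / (2 * (\<bar>B\<bar> + 1)))"
      using S(3) by (intro mult_mono) auto
    also have "\<dots> = e / 2" by (simp add: field_simps)
    finally show ?thesis .
  qed
  have "nrm (R k \<phi>) < e" if "k \<ge> N" for k
  proof -
    have "R k \<phi> = (\<lambda>i. R k ?f i + R k ?t i)" by (subst dec) (rule clinear_opD(1)[OF lin])
    then have "nrm (R k \<phi>) \<le> nrm (R k ?f) + nrm (R k ?t)"
      using nrm_add[OF mem[OF fm] mem[OF S(2)]] by simp
    moreover have "(\<Sum>s\<in>S. cmod (\<phi> s) * nrm (R k (basis s))) < e / 2"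
      using N[OF that] unfolding real_norm_def diff_0_right by (rule abs_less_iff[THEN iffD1, THEN conjunct1])
    ultimately show ?thesis using nf[of k] nt[of k] by linarith
  qed
  then show "\<exists>N. \<forall>k\<ge>N. norm (nrm (R k \<phi>) - 0) < e" by auto
qed

section \<open>Gordon's argument along the Liouville approximants\<close>

locale liouville_scattering = scattering +
  fixes \<beta> \<theta> :: real and p q :: "nat \<Rightarrow> nat"
  assumes coprime: "\<And>k. coprime (p k) (q k)" and q_pos: "\<And>k. q k > 0"
    and approx: "\<And>k. \<bar>\<beta> - real (p k) / real (q k)\<bar> \<le> 1 / real (Suc k) ^ q k"
    and q_lim: "filterlim q at_top sequentially"
begin

definition W :: "(bool \<times> int \<Rightarrow> complex) \<Rightarrow> bool \<times> int \<Rightarrow> complex" where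
  "W = walk (rot \<beta> \<theta>)"

text \<open>The error of \<open>approx_trace_identity\<close> divided by \<open>t ^ q k\<close>, at
  sites with |j| \<le> m + q. Sites beyond \<open>m\<close> matter because Gordon's argument also
  uses the identity at j + q; |j| + 3 q \<le> m + 4 q explains the 4.\<close>

definition err :: "real \<Rightarrow> nat \<Rightarrow> real" where
  "err m k = 24 * pi * (real (q k) * (m + 4 * real (q k)) * \<bar>\<beta> - real (p k) / real (q k)\<bar> / t ^ q k)"

lemma err_tendsto_0: "0 \<le> m \<Longrightarrow> err m \<longlonglongrightarrow> 0"
  unfolding err_def[abs_def]
  using tendsto_mult[OF tendsto_const superexponential_error_tendsto_0[OF t_pos _ q_pos _ approx]]
  by fastforce

lemma err_nonneg: "0 \<le> m \<Longrightarrow> 0 \<le> err m k"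
  unfolding err_def using t_pos by simp

lemma err_bound:
  assumes "of_int \<bar>j\<bar> \<le> m + real (q k)"
  shows "24 * pi * real (q k) * (of_int \<bar>j\<bar> + 3 * real (q k)) * \<bar>\<beta> - real (p k) / real (q k)\<bar> \<le> t ^ q k * err m k"
proof -
  have "24 * pi * real (q k) * (of_int \<bar>j\<bar> + 3 * real (q k)) * \<bar>\<beta> - real (p k) / real (q k)\<bar>
    \<le> 24 * pi * real (q k) * (m + 4 * real (q k)) * \<bar>\<beta> - real (p k) / real (q k)\<bar>"
    using assms by (intro mult_right_mono mult_left_mono) auto
  then show ?thesis using t_pos by (simp add: err_def)
qed

lemma W_isometry: "l2_isometry W"
  unfolding W_def by (rule walk_isometry) simp

lemma W_linear: "clinear_op W"
  unfolding W_def by (rule walk_clinear)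

text \<open>The coefficients are fixed before the basis vector: one polynomial has to serve all
  sites.\<close>

definition trace_coeffs :: "nat \<Rightarrow> complex \<Rightarrow> complex \<Rightarrow> complex \<Rightarrow> bool" where
  "trace_coeffs k c0 c1 c2 \<longleftrightarrow> cmod c0 = 1 \<and> cmod c2 = 1 \<and> cmod c1 \<le> 4 \<and>
    (\<forall>s j. \<exists>g1 g2. cmod g1 = 1 \<and> cmod g2 = 1 \<and>
      nrm (\<lambda>i. (c0 * basis (s, j) i + c1 * (W ^^ q k) (basis (s, j)) i + c2 * (W ^^ (2 * q k)) (basis (s, j)) i)
        - (\<i> * of_real t) ^ q k * (W ^^ q k) (\<lambda>i. g1 * basis (s, j + int (q k)) i + g2 * basis (s, j - int (q k)) i) i)
      \<le> 24 * pi * real (q k) * (of_int \<bar>j\<bar> + 3 * real (q k)) * \<bar>\<beta> - real (p k) / real (q k)\<bar>)"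

lemma trace_coeffs_exist: "\<exists>c0 c1 c2. trace_coeffs k c0 c1 c2"
  unfolding trace_coeffs_def W_def by (rule approx_trace_identity[OF coprime q_pos])

text \<open>Pairing the approximate identity on \<open>basis (s, j)\<close> with \<open>F\<close>
  turns powers of \<open>W\<close> into powers of \<open>w\<close> and leaves a relation between the
  values of \<open>F\<close> at j, j + q and j - q. The number \<Delta> = |\<kappa>| / t^q, the same
  for all sites, plays the role of the trace of a transfer matrix.\<close>

lemma three_term:
  assumes F: "F \<in> hl2" "W F = (\<lambda>i. w * F i)" and w: "cmod w = 1"
  obtains \<Delta> :: real where "0 \<le> \<Delta>"
    "\<And>s j m. of_int \<bar>j\<bar> \<le> m + real (q k) \<Longrightarrow>
      \<Delta> * cmod (F (s, j)) \<le> cmod (F (s, j + int (q k))) + cmod (F (s, j - int (q k))) + err m k * nrm F"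
    "\<And>s j m. of_int \<bar>j\<bar> \<le> m + real (q k) \<Longrightarrow>
      cmod (F (s, j - int (q k))) \<le> \<Delta> * cmod (F (s, j)) + cmod (F (s, j + int (q k))) + err m k * nrm F"
proof -
  obtain c0 c1 c2 where c: "trace_coeffs k c0 c1 c2" using trace_coeffs_exist by blast
  let ?q = "q k"
  note Wm = l2_isometryD(3)[OF W_isometry] and Ln = clinear_opD[OF clinear_op_funpow[OF W_linear]]
  have Wn: "(W ^^ n) F = (\<lambda>i. w ^ n * F i)" for n
    by (induction n) (simp_all add: clinear_opD[OF W_linear] F(2) mult.assoc mult.left_commute)
  \<comment> \<open>An isometry satisfies <F, e> = <W^n F, W^n e>, and the eigenvalue of
    \<open>F\<close> comes out of the first argument conjugated.\<close>
  have dual: "ip F ((W ^^ n) e) = w ^ n * ip F e" if "e \<in> hl2" for n e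
  proof -
    have "ip F e = ip ((W ^^ n) F) ((W ^^ n) e)" by (rule ip_funpow[OF W_isometry F(1) that, symmetric])
    also have "\<dots> = cnj (ip ((W ^^ n) e) (\<lambda>i. w ^ n * F i))" unfolding Wn by (simp add: ip_cnj)
    also have "\<dots> = cnj (w ^ n) * ip F ((W ^^ n) e)" by (simp add: ip_scale_right ip_cnj)
    finally have 1: "w ^ n * ip F e = (cnj (w ^ n) * w ^ n) * ip F ((W ^^ n) e)" by simp
    have "cnj (w ^ n) * w ^ n = 1" using of_real_cmod_sq[of "w ^ n"] w by (simp add: norm_power)
    then show ?thesis using 1 by simp
  qed
  have ipb: "ip F (basis i) = cnj (F i)" for i by (metis ip_basis ip_cnj)
  define \<kappa> where "\<kappa> = c0 + c1 * w ^ ?q + c2 * w ^ (2 * ?q)"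
  define \<Delta> where "\<Delta> = cmod \<kappa> / t ^ ?q"
  have tq: "t ^ ?q > 0" using t_pos by simp
  \<comment> \<open>The unimodular factors g1 and g2 vary with the site; they are absorbed into
    \<open>y\<close> and \<open>z\<close>, of which only the moduli enter the inequalities.\<close>
  have main: "\<exists>y z. cmod y = cmod (F (s, j + int ?q)) \<and> cmod z = cmod (F (s, j - int ?q)) \<and>
      cmod (\<kappa> * cnj (F (s, j)) - (\<i> * of_real t) ^ ?q * w ^ ?q * (y + z)) \<le> t ^ ?q * (err m k * nrm F)"
    if m: "of_int \<bar>j\<bar> \<le> m + real ?q" for s j m
  proof -
    let ?e = "basis (s, j) :: bool \<times> int \<Rightarrow> complex"
    obtain g1 g2 where g: "cmod g1 = 1" "cmod g2 = 1" and le: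
      "nrm (\<lambda>i. (c0 * ?e i + c1 * (W ^^ ?q) ?e i + c2 * (W ^^ (2 * ?q)) ?e i)
        - (\<i> * of_real t) ^ ?q * (W ^^ ?q) (\<lambda>i. g1 * basis (s, j + int ?q) i + g2 * basis (s, j - int ?q) i) i)
      \<le> 24 * pi * real ?q * (of_int \<bar>j\<bar> + 3 * real ?q) * \<bar>\<beta> - real (p k) / real ?q\<bar>"
      using c unfolding trace_coeffs_def by blast
    let ?f = "\<lambda>i. g1 * basis (s, j + int ?q) i + g2 * basis (s, j - int ?q) i"
    let ?X = "\<lambda>i. c0 * ?e i + c1 * (W ^^ ?q) ?e i + c2 * (W ^^ (2 * ?q)) ?e i"
    let ?Y = "\<lambda>i. (\<i> * of_real t) ^ ?q * (W ^^ ?q) ?f i"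
    have f: "?f \<in> hl2" by (intro hl2_add hl2_scale basis_L2)
    have X: "?X \<in> hl2" by (intro hl2_add hl2_scale Wm basis_L2)
    have Y: "?Y \<in> hl2" by (intro hl2_scale Wm f)
    have "ip F ?X = \<kappa> * cnj (F (s, j))"
      by (simp add: ip_add_right ip_scale_right hl2_add hl2_scale Wm basis_L2 F(1) dual ipb \<kappa>_def distrib_right)
    moreover have "ip F ?Y = (\<i> * of_real t) ^ ?q * w ^ ?q * (g1 * cnj (F (s, j + int ?q)) + g2 * cnj (F (s, j - int ?q)))"
      by (simp add: ip_add_right ip_scale_right hl2_add hl2_scale basis_L2 F(1) dual[OF f] ipb mult.assoc)
    moreover have "ip F (\<lambda>i. ?X i - ?Y i) = ip F ?X - ip F ?Y"
      using ip_add_right[OF F(1) X hl2_scale[OF Y, of "-1"]] ip_scale_right[of F "-1" ?Y] by simp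
    moreover have "cmod (ip F (\<lambda>i. ?X i - ?Y i)) \<le> nrm F * nrm (\<lambda>i. ?X i - ?Y i)"
      by (intro ip_bound F(1) hl2_diff X Y)
    moreover have "nrm F * nrm (\<lambda>i. ?X i - ?Y i) \<le> nrm F * (t ^ ?q * err m k)"
      by (intro mult_left_mono order_trans[OF le] err_bound m) simp
    ultimately show ?thesis
      using g by (intro exI[of _ "g1 * cnj (F (s, j + int ?q))"] exI[of _ "g2 * cnj (F (s, j - int ?q))"])
        (simp add: norm_mult mult_ac)
  qed
  have tau: "cmod ((\<i> * of_real t) ^ ?q * w ^ ?q) = t ^ ?q"
    using w t_pos by (simp add: norm_mult norm_power)
  show ?thesis
  proof (rule that[of \<Delta>])
    show "0 \<le> \<Delta>" using tq by (simp add: \<Delta>_def)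
  next
    fix s j m assume m: "of_int \<bar>j\<bar> \<le> m + real ?q"
    obtain y z where yz: "cmod y = cmod (F (s, j + int ?q))" "cmod z = cmod (F (s, j - int ?q))"
      "cmod (\<kappa> * cnj (F (s, j)) - (\<i> * of_real t) ^ ?q * w ^ ?q * (y + z)) \<le> t ^ ?q * (err m k * nrm F)"
      using main[OF m, of s] by blast
    define A B where "A = \<kappa> * cnj (F (s, j))" and "B = (\<i> * of_real t) ^ ?q * w ^ ?q * (y + z)"
    have A: "cmod A = t ^ ?q * (\<Delta> * cmod (F (s, j)))" using t_pos by (simp add: A_def \<Delta>_def norm_mult)
    have B: "cmod B = t ^ ?q * cmod (y + z)" unfolding B_def norm_mult[of _ "y + z"] tau ..
    have AB: "cmod (A - B) \<le> t ^ ?q * (err m k * nrm F)" using yz(3) unfolding A_def B_def .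
    have "cmod A \<le> cmod B + cmod (A - B)" "cmod B \<le> cmod A + cmod (A - B)"
      using norm_triangle_sub[of A B] norm_triangle_sub[of B A] by (simp_all add: norm_minus_commute)
    then have "t ^ ?q * (\<Delta> * cmod (F (s, j))) \<le> t ^ ?q * (cmod (y + z) + err m k * nrm F)"
      "t ^ ?q * cmod (y + z) \<le> t ^ ?q * (\<Delta> * cmod (F (s, j)) + err m k * nrm F)"
      using A B AB unfolding distrib_left by linarith+
    then have 1: "\<Delta> * cmod (F (s, j)) \<le> cmod (y + z) + err m k * nrm F"
      "cmod (y + z) \<le> \<Delta> * cmod (F (s, j)) + err m k * nrm F"
      using tq by (simp_all only: mult_le_cancel_left_pos)
    have "cmod (y + z) \<le> cmod y + cmod z" "cmod z \<le> cmod (y + z) + cmod y"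
      using norm_triangle_ineq[of y z] norm_triangle_ineq4[of "y + z" y] by simp_all
    with 1 yz(1,2)
    show "\<Delta> * cmod (F (s, j)) \<le> cmod (F (s, j + int ?q)) + cmod (F (s, j - int ?q)) + err m k * nrm F"
      "cmod (F (s, j - int ?q)) \<le> \<Delta> * cmod (F (s, j)) + cmod (F (s, j + int ?q)) + err m k * nrm F"
      by linarith+
  qed
qed

text \<open>Gordon's argument: by the three-term relation, whether \<open>\<Delta>\<close> is small or large, the value of an eigenvector
  at \<open>j\<close> is dominated by its values at \<open>j - q\<close>, \<open>j + q\<close> and \<open>j + 2 q\<close>.\<close>

lemma W_no_eigenvector:
  assumes F: "F \<in> hl2" "W F = (\<lambda>i. w * F i)" and w: "cmod w = 1"
  shows "F = (\<lambda>i. 0)"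
proof
  fix i :: "bool \<times> int"
  obtain s j where i: "i = (s, j)" by (cases i)
  define m where "m = real_of_int \<bar>j\<bar>"
  define b where "b k = cmod (F (s, j + int (q k))) + cmod (F (s, j - int (q k)))
      + cmod (F (s, j + int (2 * q k))) + err m k * nrm F" for k
  have le: "cmod (F (s, j)) \<le> b k" for k
  proof -
    obtain \<Delta> where D: "0 \<le> \<Delta>"
      "\<And>s j m. of_int \<bar>j\<bar> \<le> m + real (q k) \<Longrightarrow>
        \<Delta> * cmod (F (s, j)) \<le> cmod (F (s, j + int (q k))) + cmod (F (s, j - int (q k))) + err m k * nrm F"
      "\<And>s j m. of_int \<bar>j\<bar> \<le> m + real (q k) \<Longrightarrow>
        cmod (F (s, j - int (q k))) \<le> \<Delta> * cmod (F (s, j)) + cmod (F (s, j + int (q k))) + err m k * nrm F"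
      by (rule three_term[OF F w, of k]) (assumption | rule that)+
    have e: "0 \<le> err m k * nrm F" by (simp add: m_def err_nonneg)
    show ?thesis
    \<comment> \<open>For \<Delta> \<ge> 1 the relation is centred at j. Otherwise it is centred at
      j + q, where j appears as the left neighbour and the central value has a factor below
      1.\<close>
    proof (cases "\<Delta> \<ge> 1")
      case True
      then have "1 * cmod (F (s, j)) \<le> \<Delta> * cmod (F (s, j))" by (intro mult_right_mono) auto
      also have "\<dots> \<le> cmod (F (s, j + int (q k))) + cmod (F (s, j - int (q k))) + err m k * nrm F"
        by (rule D(2)) (simp add: m_def)
      finally show ?thesis
        unfolding b_def using norm_ge_zero[of "F (s, j + int (2 * q k))"] by linarith
    next
      case False
      have "of_int \<bar>j + int (q k)\<bar> \<le> m + real (q k)" unfolding m_def by linarith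
      from D(3)[OF this, of s]
      have "cmod (F (s, j)) \<le> \<Delta> * cmod (F (s, j + int (q k))) + cmod (F (s, j + int (2 * q k))) + err m k * nrm F"
        by (simp add: algebra_simps)
      moreover have "\<Delta> * cmod (F (s, j + int (q k))) \<le> 1 * cmod (F (s, j + int (q k)))"
        using False by (intro mult_right_mono) auto
      moreover have "0 \<le> cmod (F (s, j - int (q k)))" by simp
      ultimately show ?thesis unfolding b_def by linarith
    qed
  qed
  have inf: "filterlim (\<lambda>k. \<bar>J k\<bar>) at_top sequentially"
    if "\<And>k. \<bar>J k\<bar> \<ge> int (q k) - \<bar>j\<bar>" for J :: "nat \<Rightarrow> int"
    unfolding filterlim_at_top
  proof
    fix Z :: int
    have "\<forall>\<^sub>F k in sequentially. nat (Z + \<bar>j\<bar>) \<le> q k" using q_lim by (simp add: filterlim_at_top)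
    then show "\<forall>\<^sub>F k in sequentially. Z \<le> \<bar>J k\<bar>"
      by eventually_elim (use that in \<open>smt (verit) nat_le_iff\<close>)
  qed
  have "b \<longlonglongrightarrow> 0 + 0 + 0 + 0 * nrm F"
    unfolding b_def
    by (intro tendsto_intros hl2_tendsto_0_at_infinity[OF F(1)] inf err_tendsto_0) (auto simp: m_def)
  then have "cmod (F (s, j)) \<le> 0"
    using le by (intro LIMSEQ_le_const[of b]) auto
  then show "F i = 0" by (simp add: i)
qed

end

section \<open>Vanishing polynomials in the squared walk\<close>

context liouville_scattering
begin

lemma W_power_square: "(W ^^ 2) ^^ n = W ^^ (2 * n)"
  by (simp add: funpow_mult mult.commute)

text \<open>On a basis vector the right-hand side of the identity has norm at most 2 t^q and the
  error is at most t^q \<open>err m k\<close>; both vanish, since r > 0 forces t < 1.\<close>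

lemma trace_polynomial_basis_limit:
  assumes c: "\<And>k. trace_coeffs k (c0 k) (c1 k) (c2 k)"
  shows "(\<lambda>k. nrm (\<lambda>i. c0 k * basis b i + c1 k * (W ^^ q k) (basis b) i + c2 k * (W ^^ (2 * q k)) (basis b) i)) \<longlonglongrightarrow> 0"
proof -
  obtain s j where b: "b = (s, j)" by (cases b)
  define m where "m = real_of_int \<bar>j\<bar>"
  note Wm = l2_isometryD(3)[OF W_isometry] and Wn = l2_isometryD(4)[OF W_isometry]
  have bound: "\<forall>\<^sub>F k in sequentially. norm (nrm (\<lambda>i. c0 k * basis b i + c1 k * (W ^^ q k) (basis b) i + c2 k * (W ^^ (2 * q k)) (basis b) i))
     \<le> t ^ q k * (2 + err m k)"
  proof (intro always_eventually allI)
    fix k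
    obtain g1 g2 where g: "cmod g1 = 1" "cmod g2 = 1" and le:
      "nrm (\<lambda>i. (c0 k * basis (s, j) i + c1 k * (W ^^ q k) (basis (s, j)) i + c2 k * (W ^^ (2 * q k)) (basis (s, j)) i)
        - (\<i> * of_real t) ^ q k * (W ^^ q k) (\<lambda>i. g1 * basis (s, j + int (q k)) i + g2 * basis (s, j - int (q k)) i) i)
      \<le> 24 * pi * real (q k) * (of_int \<bar>j\<bar> + 3 * real (q k)) * \<bar>\<beta> - real (p k) / real (q k)\<bar>"
      using c[of k] unfolding trace_coeffs_def by blast
    let ?f = "\<lambda>i. g1 * basis (s, j + int (q k)) i + g2 * basis (s, j - int (q k)) i"
    let ?X = "\<lambda>i. c0 k * basis (s, j) i + c1 k * (W ^^ q k) (basis (s, j)) i + c2 k * (W ^^ (2 * q k)) (basis (s, j)) i"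
    let ?Y = "\<lambda>i. (\<i> * of_real t) ^ q k * (W ^^ q k) ?f i"
    have f: "?f \<in> hl2" by (intro hl2_add hl2_scale basis_L2)
    have X: "?X \<in> hl2" by (intro hl2_add hl2_scale Wm basis_L2)
    have Y: "?Y \<in> hl2" by (intro hl2_scale Wm f)
    have nf: "nrm ?f \<le> 2"
      using nrm_add[OF hl2_scale[OF basis_L2(1)] hl2_scale[OF basis_L2(1)], of g1 "(s, j + int (q k))" g2 "(s, j - int (q k))"]
      by (simp add: nrm_scale basis_L2 g)
    have "nrm ?Y \<le> t ^ q k * 2"
      unfolding nrm_scale Wn[OF f] using t_pos nf by (simp add: norm_mult norm_power)
    moreover have "nrm ?X \<le> nrm (\<lambda>i. ?X i - ?Y i) + nrm ?Y"
      using nrm_add[OF hl2_diff[OF X Y] Y] by simp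
    moreover have "nrm (\<lambda>i. ?X i - ?Y i) \<le> t ^ q k * err m k"
      by (rule order_trans[OF le err_bound]) (simp add: m_def)
    ultimately have "nrm ?X \<le> t ^ q k * (2 + err m k)" unfolding distrib_left by linarith
    then show "norm (nrm (\<lambda>i. c0 k * basis b i + c1 k * (W ^^ q k) (basis b) i + c2 k * (W ^^ (2 * q k)) (basis b) i))
     \<le> t ^ q k * (2 + err m k)" unfolding b real_norm_def abs_of_nonneg[OF nrm_nonneg] .
  qed
  have "t\<^sup>2 < 1\<^sup>2" using rt r_pos zero_less_power[OF r_pos, of 2] unfolding one_power2 by linarith
  then have "t < 1" by (rule power2_less_imp_less) simp
  then have "(\<lambda>n. t ^ n) \<longlonglongrightarrow> 0" using t_pos by (intro LIMSEQ_power_zero) auto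
  then have "(\<lambda>k. t ^ q k) \<longlonglongrightarrow> 0" by (rule filterlim_compose[OF _ q_lim])
  moreover have "err m \<longlonglongrightarrow> 0" by (rule err_tendsto_0) (simp add: m_def)
  ultimately have "(\<lambda>k. t ^ q k * (2 + err m k)) \<longlonglongrightarrow> 0 * (2 + 0)" by (intro tendsto_intros)
  then have "(\<lambda>k. t ^ q k * (2 + err m k)) \<longlonglongrightarrow> 0" by simp
  with bound show ?thesis by (rule Lim_null_comparison)
qed

text \<open>The product of \<open>c0 + c1 x\<^sup>q + c2 x\<^sup>2\<^sup>q\<close> and \<open>c0 - c1 x\<^sup>q + c2 x\<^sup>2\<^sup>q\<close> is a polynomial in \<open>x\<^sup>2\<close>, even for odd \<open>q\<close>.\<close>

lemma square_polynomial_limit: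
  assumes \<phi>: "\<phi> \<in> hl2"
  obtains d0 d1 d2 :: "nat \<Rightarrow> complex" where
    "\<And>k. cmod (d0 k) = 1" "\<And>k. cmod (d1 k) \<le> 18" "\<And>k. cmod (d2 k) \<le> 18"
    "(\<lambda>k. nrm (\<lambda>i. d0 k * \<phi> i + d1 k * (W ^^ (2 * q k)) \<phi> i + d2 k * (W ^^ (4 * q k)) \<phi> i)) \<longlonglongrightarrow> 0"
proof -
  obtain c0 c1 c2 where c: "\<And>k. trace_coeffs k (c0 k) (c1 k) (c2 k)"
    using trace_coeffs_exist by metis
  have cn: "cmod (c0 k) = 1" "cmod (c2 k) = 1" "cmod (c1 k) \<le> 4" for k
    using c[of k] by (auto simp: trace_coeffs_def)
  note Wm = l2_isometryD(3)[OF W_isometry] and Wn = l2_isometryD(4)[OF W_isometry]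
    and Ln = clinear_opD[OF clinear_op_funpow[OF W_linear]]
  have comb: "nrm (\<lambda>i. x * f i + y * (W ^^ n) f i + z * (W ^^ m) f i) \<le> (cmod x + cmod y + cmod z) * nrm f"
    and comb_mem: "(\<lambda>i. x * f i + y * (W ^^ n) f i + z * (W ^^ m) f i) \<in> hl2"
    if f: "f \<in> hl2" for x y z n m f
  proof -
    have "nrm (\<lambda>i. x * f i + y * (W ^^ n) f i + z * (W ^^ m) f i)
       \<le> nrm (\<lambda>i. x * f i) + nrm (\<lambda>i. y * (W ^^ n) f i) + nrm (\<lambda>i. z * (W ^^ m) f i)"
      using nrm_add[OF hl2_add[OF hl2_scale[OF f] hl2_scale[OF Wm[OF f]]] hl2_scale[OF Wm[OF f]], of x y n z m]
        nrm_add[OF hl2_scale[OF f] hl2_scale[OF Wm[OF f]], of x y n] by linarith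
    then show "nrm (\<lambda>i. x * f i + y * (W ^^ n) f i + z * (W ^^ m) f i) \<le> (cmod x + cmod y + cmod z) * nrm f"
      by (simp add: nrm_scale Wn[OF f] distrib_right)
    show "(\<lambda>i. x * f i + y * (W ^^ n) f i + z * (W ^^ m) f i) \<in> hl2"
      by (intro hl2_add hl2_scale Wm f)
  qed
  \<comment> \<open>Coefficients of (c0 + c2 x^(2q))^2 - (c1 x^q)^2. The powers 2 q and 4 q of
    \<open>W\<close> are the powers q and 2 q of \<open>W ^^ 2\<close>. The bound 18 below is 2 + 4
    * 4.\<close>
  define d0 where "d0 k = c0 k * c0 k" for k
  define d1 where "d1 k = 2 * c0 k * c2 k - c1 k * c1 k" for k
  define d2 where "d2 k = c2 k * c2 k" for k
  have dn: "cmod (d0 k) = 1" "cmod (d1 k) \<le> 18" "cmod (d2 k) \<le> 18" for k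
  proof -
    show "cmod (d0 k) = 1" "cmod (d2 k) \<le> 18" by (simp_all add: d0_def d2_def norm_mult cn)
    have "cmod (d1 k) \<le> cmod (2 * c0 k * c2 k) + cmod (c1 k * c1 k)"
      unfolding d1_def by (rule norm_triangle_ineq4)
    also have "\<dots> \<le> 2 + 4 * 4"
      unfolding norm_mult using cn[of k] by (intro add_mono mult_mono) auto
    finally show "cmod (d1 k) \<le> 18" by simp
  qed
  define R where "R k f = (\<lambda>i. d0 k * f i + d1 k * (W ^^ (2 * q k)) f i + d2 k * (W ^^ (4 * q k)) f i)" for k f
  have "(\<lambda>k. nrm (R k \<phi>)) \<longlonglongrightarrow> 0"
  proof (rule strong_limit_0[where B="1 + 18 + 18"])
    show "clinear_op (R k)" for k
      unfolding clinear_op_def R_def by (simp add: Ln algebra_simps)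
    show "R k f \<in> hl2" if "f \<in> hl2" for k f
      unfolding R_def by (rule comb_mem[OF that])
    show "nrm (R k f) \<le> (1 + 18 + 18) * nrm f" if "f \<in> hl2" for k f
      unfolding R_def by (rule order_trans[OF comb[OF that]]) (use dn[of k] in \<open>intro mult_right_mono; auto\<close>)
    show "(\<lambda>k. nrm (R k (basis b))) \<longlonglongrightarrow> 0" for b
    proof (rule Lim_null_comparison)
      \<comment> \<open>The constant 6 is 1 + 4 + 1, the norm bound for the second factor c0 - c1
        W^q + c2 W^(2q).\<close>
      let ?X = "\<lambda>k i. c0 k * basis b i + c1 k * (W ^^ q k) (basis b) i + c2 k * (W ^^ (2 * q k)) (basis b) i"
      show "\<forall>\<^sub>F k in sequentially. norm (nrm (R k (basis b))) \<le> 6 * nrm (?X k)"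
      proof (intro always_eventually allI)
        fix k
        have comp: "(W ^^ n) ((W ^^ m) f) = (W ^^ (n + m)) f" for n m f by (simp add: funpow_add)
        have Req: "R k (basis b) = (\<lambda>i. c0 k * ?X k i + (- c1 k) * (W ^^ q k) (?X k) i + c2 k * (W ^^ (2 * q k)) (?X k) i)"
        proof
          fix i
          define y where "y n = (W ^^ (n * q k)) (basis b) i" for n :: nat
          have y: "(W ^^ q k) ((W ^^ q k) (basis b)) i = y 2" "(W ^^ q k) ((W ^^ (2 * q k)) (basis b)) i = y 3"
            "(W ^^ (2 * q k)) ((W ^^ q k) (basis b)) i = y 3" "(W ^^ (2 * q k)) ((W ^^ (2 * q k)) (basis b)) i = y 4"
            "(W ^^ q k) (basis b) i = y 1" "(W ^^ (2 * q k)) (basis b) i = y 2" "(W ^^ (4 * q k)) (basis b) i = y 4"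
            unfolding comp y_def by (simp_all add: mult_2[symmetric] algebra_simps)
          show "R k (basis b) i = c0 k * ?X k i + (- c1 k) * (W ^^ q k) (?X k) i + c2 k * (W ^^ (2 * q k)) (?X k) i"
            unfolding R_def Ln y d0_def d1_def d2_def by algebra
        qed
        have "nrm (R k (basis b)) \<le> (cmod (c0 k) + cmod (- c1 k) + cmod (c2 k)) * nrm (?X k)"
          unfolding Req by (rule comb[OF comb_mem[OF basis_L2(1)]])
        also have "\<dots> \<le> 6 * nrm (?X k)"
          using cn[of k] by (intro mult_right_mono) auto
        finally show "norm (nrm (R k (basis b))) \<le> 6 * nrm (?X k)" by simp
      qed
      show "(\<lambda>k. 6 * nrm (?X k)) \<longlonglongrightarrow> 0"
        using tendsto_mult[OF tendsto_const trace_polynomial_basis_limit[of c0 c1 c2 b, OF c], of 6] by simp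
    qed
  qed (rule \<phi>)
  then show ?thesis unfolding R_def by (rule that[of d0 d1 d2, OF dn])
qed

lemma W_square_spectral_meas:
  assumes \<phi>: "\<phi> \<in> hl2"
  obtains \<mu> where "spectral_meas (W ^^ 2) \<phi> \<mu>" "\<And>x. emeasure \<mu> {x} = 0"
    "\<exists>N \<in> null_sets lborel. emeasure \<mu> (- N) = 0"
proof -
  have V: "l2_isometry (W ^^ 2)" by (rule l2_isometry_funpow[OF W_isometry])
  obtain \<mu> where \<mu>: "spectral_meas (W ^^ 2) \<phi> \<mu>" using spectral_meas_exists[OF V \<phi>] by blast
  \<comment> \<open>Every output coordinate of \<open>W\<close> depends on two input coordinates, so
    coordinatewise limits pass through.\<close>
  have local: "(\<lambda>N. (W ^^ 2) (f N) i) \<longlonglongrightarrow> (W ^^ 2) F i"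
    if f: "\<And>j. (\<lambda>N::nat. f N j) \<longlonglongrightarrow> F j" for f F i
  proof -
    have W1: "(\<lambda>N. W (h N) i) \<longlonglongrightarrow> W H i" if h: "\<And>j. (\<lambda>N::nat. h N j) \<longlonglongrightarrow> H j" for h H i
    proof -
      obtain s j where i: "i = (s, j)" by (cases i)
      show ?thesis unfolding W_def walk_def i by (cases s) (auto intro!: tendsto_intros h)
    qed
    show ?thesis unfolding numeral_2_eq_2 funpow.simps comp_def id_def by (intro W1 f)
  qed
  \<comment> \<open>Factor W^2 - z = (W - w)(W + w) with w^2 = z: the vector (W + w) F satisfies the
    eigenvalue equation of \<open>W\<close> for w and so vanishes; then \<open>F\<close> satisfies
    it for -w.\<close>
  have no_ev: "F = (\<lambda>i. 0)" if z: "cmod z = 1" and F: "F \<in> hl2" "(W ^^ 2) F = (\<lambda>i. z * F i)" for z F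
  proof -
    define w where "w = csqrt z"
    have w2: "w * w = z" by (simp add: w_def flip: power2_eq_square)
    have w1: "cmod w = 1" by (simp add: w_def z)
    then have w0: "w \<noteq> 0" by auto
    have WW: "W (W F) = (\<lambda>i. z * F i)" using F(2) by (simp add: numeral_2_eq_2)
    note L = clinear_opD[OF W_linear]
    have "(\<lambda>i. w * F i + W F i) = (\<lambda>i. 0)"
    proof (rule W_no_eigenvector[OF _ _ w1])
      show "(\<lambda>i. w * F i + W F i) \<in> hl2"
        by (intro hl2_add hl2_scale F(1) l2_isometryD(1)[OF W_isometry])
      show "W (\<lambda>i. w * F i + W F i) = (\<lambda>i. w * (w * F i + W F i))"
        by (simp add: L WW flip: w2) (simp add: algebra_simps)
    qed
    then have "W F i = (- w) * F i" for i
      using fun_cong[of "\<lambda>i. w * F i + W F i" "\<lambda>i. 0" i] by (simp add: add_eq_0_iff)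
    then have "W F = (\<lambda>i. (- w) * F i)" by (rule ext)
    then show ?thesis by (rule W_no_eigenvector[OF F(1)]) (simp add: w1)
  qed
  have "emeasure \<mu> {x} = 0" for x
    by (rule spectral_meas_no_atom[OF V \<phi> \<mu> local no_ev])
  moreover have "\<exists>N \<in> null_sets lborel. emeasure \<mu> (- N) = 0"
  proof -
    obtain d0 d1 d2 where d: "\<And>k. cmod (d0 k) = 1" "\<And>k. cmod (d1 k) \<le> 18" "\<And>k. cmod (d2 k) \<le> 18"
      "(\<lambda>k. nrm (\<lambda>i. d0 k * \<phi> i + d1 k * (W ^^ (2 * q k)) \<phi> i + d2 k * (W ^^ (4 * q k)) \<phi> i)) \<longlonglongrightarrow> 0"
      using square_polynomial_limit[OF \<phi>] by blast
    have "(\<lambda>k. nrm (\<lambda>i. d0 k * \<phi> i + d1 k * ((W ^^ 2) ^^ q k) \<phi> i + d2 k * ((W ^^ 2) ^^ (2 * q k)) \<phi> i)) \<longlonglongrightarrow> 0"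
      using d(4) by (simp add: W_power_square)
    then show ?thesis by (rule spectral_meas_singular[OF V \<phi> \<mu> q_lim d(1-3)])
  qed
  ultimately show ?thesis using \<mu> that by blast
qed

end

section \<open>Embedding of the given operator into the squared walk\<close>

definition embed :: "(int \<Rightarrow> complex) \<Rightarrow> bool \<times> int \<Rightarrow> complex" where
  "embed \<psi> = (\<lambda>(s, j). if s = even j then \<psi> j else 0)"

lemma ip_embed: "ip (embed \<phi>) (embed \<psi>) = l2_inner \<phi> \<psi>"
proof -
  let ?h = "\<lambda>j. (even j, j) :: bool \<times> int"
  have "ip (embed \<phi>) (embed \<psi>) = infsum (\<lambda>i. cnj (embed \<phi> i) * embed \<psi> i) (range ?h)"
    unfolding ip_def by (rule infsum_cong_neutral) (auto simp: embed_def)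
  also have "\<dots> = infsum ((\<lambda>i. cnj (embed \<phi> i) * embed \<psi> i) \<circ> ?h) UNIV"
    by (rule infsum_reindex) (auto simp: inj_on_def)
  finally show ?thesis by (simp add: l2_inner_def embed_def o_def)
qed

lemma embed_hl2:
  assumes "\<psi> \<in> l2" shows "embed \<psi> \<in> hl2"
proof -
  let ?h = "\<lambda>j. (even j, j) :: bool \<times> int"
  have "((\<lambda>i. (cmod (embed \<psi> i))\<^sup>2) \<circ> ?h) summable_on UNIV"
    using assms by (simp add: l2_def embed_def o_def)
  then have "(\<lambda>i. (cmod (embed \<psi> i))\<^sup>2) summable_on range ?h"
    by (subst summable_on_reindex) (auto simp: inj_on_def)
  moreover have "(\<lambda>i. (cmod (embed \<psi> i))\<^sup>2) summable_on range ?h \<longleftrightarrow> (\<lambda>i. (cmod (embed \<psi> i))\<^sup>2) summable_on UNIV"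
    by (rule summable_on_cong_neutral) (auto simp: embed_def)
  ultimately show ?thesis by (simp add: hl2_def)
qed

context liouville_scattering
begin

abbreviation "U \<equiv> M_op r t (\<lambda>k. 2 * pi * \<beta> * of_int k + \<theta>) (\<lambda>k. a) g"

text \<open>\<open>embed\<close> puts even sites at flag True and odd sites at flag False. There the
  first application of \<open>W\<close> meets only the even bonds, which is \<open>U_even\<close>;
  it lands on the opposite flags, where the second meets only the odd bonds, which is
  \<open>U_odd\<close>.\<close>

lemma W_square_embed: "(W ^^ 2) (embed \<psi>) = embed (U \<psi>)"
proof
  fix i :: "bool \<times> int"
  obtain s j where i: "i = (s, j)" by (cases i)
  define S where "S = scatter r t (\<lambda>k. 2 * pi * \<beta> * of_int k + \<theta>) (\<lambda>k. a) g"
  have sc: "S k $ 1 $ 1 = rot \<beta> \<theta> k * (of_real r * cis (- a))" "S k $ 1 $ 2 = rot \<beta> \<theta> k * (\<i> * of_real t * cis (g k))"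
    "S k $ 2 $ 1 = rot \<beta> \<theta> k * (\<i> * of_real t * cis (- g k))" "S k $ 2 $ 2 = rot \<beta> \<theta> k * (of_real r * cis a)" for k
    by (simp_all add: S_def scatter_def rot_def vector_2)
  have U: "U \<psi> = U_odd S (U_even S \<psi>)" by (simp add: M_op_def S_def)
  have W2: "(W ^^ 2) f = W (W f)" for f by (simp add: numeral_2_eq_2)
  show "(W ^^ 2) (embed \<psi>) i = embed (U \<psi>) i"
    unfolding i U W2 unfolding W_def walk_def embed_def U_odd_def U_even_def sc
    by (cases s; cases "even j") (simp_all add: distrib_left mult.assoc)
qed


lemma purely_singular_continuous_U: "purely_singular_continuous U"
proof -
  have emb: "embed ((U ^^ n) \<psi>) = ((W ^^ 2) ^^ n) (embed \<psi>)" for n \<psi>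
    by (induction n) (simp_all add: W_square_embed[symmetric])
  have "\<psi> \<in> sc_subspace U" if \<psi>: "\<psi> \<in> l2" for \<psi>
  proof -
    obtain \<mu> where \<mu>: "spectral_meas (W ^^ 2) (embed \<psi>) \<mu>" "\<And>x. emeasure \<mu> {x} = 0"
      "\<exists>N \<in> null_sets lborel. emeasure \<mu> (- N) = 0"
      using W_square_spectral_meas[OF embed_hl2[OF \<psi>]] by blast
    have "spectral_measure U \<psi> \<mu>"
      using \<mu>(1) unfolding spectral_measure_def spectral_meas_def by (simp add: emb[symmetric] ip_embed)
    then show ?thesis
      using \<mu>(2,3) \<psi> unfolding sc_subspace_def singular_continuous_measure_def by blast
  qed
  then show ?thesis unfolding purely_singular_continuous_def by (auto simp: sc_subspace_def)
qed

end

theorem theorem7p1: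
  fixes t r \<beta> \<alpha> :: real and \<gamma> :: "int \<Rightarrow> real"
  assumes "0 < t" and "t < 1" and "r = sqrt (1 - t\<^sup>2)"
    and "\<beta> \<notin> \<rat>" and "liouville_number \<beta>"
  shows "AE \<theta> in lborel. \<theta> \<in> {0..<2 * pi} \<longrightarrow>
           purely_singular_continuous
             (M_op r t (\<lambda>k. 2 * pi * \<beta> * of_int k + \<theta>) (\<lambda>k. \<alpha>) \<gamma>)"
proof -
  have t2: "t\<^sup>2 < 1" using assms(1,2) by (simp add: power_less_one_iff)
  obtain p q :: "nat \<Rightarrow> nat" where pq: "\<And>k. coprime (p k) (q k)" "\<And>k. q k > 0"
    "\<And>k. \<bar>\<beta> - real (p k) / real (q k)\<bar> \<le> 1 / real (Suc k) ^ q k" "filterlim q at_top sequentially"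
    using liouville_coprime_approx[OF assms(5,4)] by blast
  have "liouville_scattering r t \<beta> p q"
    using assms(1,3) t2 pq by unfold_locales auto
  then show ?thesis
    using liouville_scattering.purely_singular_continuous_U by (intro always_eventually) blast
qed

end
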